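(* For every integer $v \geq 1$, the function $\mathcal{N}_{2v}(1,1;q)$ is a quasimodular form (as a function of $z$ in the upper half-plane, with $q=e^{2\pi i z}$).
   Context: Notation: for $|q|<1$, $(a_1,\dots,a_j;q)_\infty:=\prod_{k\ge0}(1-a_1q^k)\cdots(1-a_jq^k)$ and, for every integer $n$ (including negative $n$), $(a_1,\dots,a_j;q)_n:=(a_1,\dots,a_j;q)_\infty/(a_1q^n,\dots,a_jq^n;q)_\infty$; the base $;q$ is dropped when it is $q$. For $v\ge1$ define $$\mathcal{N}_{2v}(d,e;q):=\frac{(-dq,-eq)_\infty}{(q,deq)_\infty}\sum_{n\in\mathbb{Z}\setminus\{0\}}\frac{(-1)^{n-1}q^{\binom{n+1}{2}+vn}(de)^n(-1/d,-1/e)_n}{(1-q^n)^{2v}(-dq,-eq)_n}.$$ Thus $\mathcal{N}_{2v}(1,1;q)=\frac{(-q)_\infty^2}{(q)_\infty^2}\sum_{n\neq0}\frac{(-1)^{n-1}q^{\binom{n+1}{2}+vn}(-1)_n^2}{(1-q^n)^{2v}(-q)_n^2}$. Quasimodular forms are in the sense of Kaneko–Zagier.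
   Formalization: "Quasimodular form" is taken to mean a finite sum of quasimodular forms of possibly different weights on some finite-index subgroup of SL_2(Z), with poles at the cusps allowed; in the strict Kaneko–Zagier sense (one weight, no poles at cusps) the claim already fails for v = 1. *)

theory Defs
  imports "HOL-Analysis.Analysis" "HOL-Algebra.Coset"
begin

section \<open>The function \<open>N\<^sub>2\<^sub>v(d, e; q)\<close>\<close>

definition qpoch_inf :: "complex \<Rightarrow> complex \<Rightarrow> complex" where
  "qpoch_inf a q = prodinf (\<lambda>k. 1 - a * q ^ k)"

definition qpoch :: "complex \<Rightarrow> complex \<Rightarrow> int \<Rightarrow> complex" where
  "qpoch a q n = qpoch_inf a q / qpoch_inf (a * q powi n) q"

text \<open>
  The argument \<open>v\<close> stands for the subscript \<open>2v\<close>. The formula is meaningful for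
  \<open>0 < norm q < 1\<close> and \<open>d, e \<noteq> 0\<close>; \<open>n * (n + 1) div 2\<close> is the binomial coefficient
  \<open>n + 1\<close> over \<open>2\<close>, also for negative \<open>n\<close>.
\<close>

definition N_even :: "nat \<Rightarrow> complex \<Rightarrow> complex \<Rightarrow> complex \<Rightarrow> complex" where
  "N_even v d e q =
     (qpoch_inf (- d * q) q * qpoch_inf (- e * q) q) / (qpoch_inf q q * qpoch_inf (d * e * q) q) *
     (\<Sum>\<^sub>\<infinity>n\<in>UNIV - {0 :: int}.
        (-1) powi (n - 1) * q powi (n * (n + 1) div 2 + int v * n) * (d * e) powi n *
          (qpoch (- 1 / d) q n * qpoch (- 1 / e) q n) /
        ((1 - q powi n) ^ (2 * v) * (qpoch (- d * q) q n * qpoch (- e * q) q n)))"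


section \<open>Quasimodular forms\<close>

definition upper_half_plane :: "complex set" where
  "upper_half_plane = {z. Im z > 0}"

definition SL2Z :: "(int^2^2) monoid" where
  "SL2Z = \<lparr>carrier = {A. det A = 1}, monoid.mult = (**), one = mat 1\<rparr>"

lemma group_SL2Z: "group SL2Z"
proof (rule groupI)
  fix A assume A: "A \<in> carrier SL2Z"
  define B :: "int^2^2" where "B = vector [vector [A$2$2, - A$1$2], vector [- A$2$1, A$1$1]]"
  have d: "A$1$1 * A$2$2 - A$1$2 * A$2$1 = 1"
    using A by (simp add: SL2Z_def det_2)
  have "det B = 1"
    using d by (simp add: B_def det_2 mult.commute)
  moreover have "B ** A = mat 1"
    using d by (simp add: B_def matrix_matrix_mult_def mat_def vec_eq_iff forall_2 sum_2 algebra_simps)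
  ultimately show "\<exists>B\<in>carrier SL2Z. B \<otimes>\<^bsub>SL2Z\<^esub> A = \<one>\<^bsub>SL2Z\<^esub>"
    by (auto simp: SL2Z_def)
qed (auto simp: SL2Z_def det_mul matrix_mul_assoc)

definition finite_index_subgroup :: "(int^2^2) set \<Rightarrow> bool" where
  "finite_index_subgroup \<Gamma> \<longleftrightarrow> subgroup \<Gamma> SL2Z \<and> finite (rcosets\<^bsub>SL2Z\<^esub> \<Gamma>)"

definition moebius :: "int^2^2 \<Rightarrow> complex \<Rightarrow> complex" where
  "moebius A z = (of_int (A$1$1) * z + of_int (A$1$2)) / (of_int (A$2$1) * z + of_int (A$2$2))"

definition slash :: "int \<Rightarrow> int^2^2 \<Rightarrow> (complex \<Rightarrow> complex) \<Rightarrow> complex \<Rightarrow> complex" where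
  "slash k A F z = (of_int (A$2$1) * z + of_int (A$2$2)) powi (- k) * F (moebius A z)"

text \<open>
  For a function of weight \<open>k\<close> on a finite-index subgroup, at most linear exponential growth
  at every cusp is the analytic form of meromorphy at the cusps: it says that the
  \<open>q\<close>-expansions at all cusps have only finitely many negative exponents.
\<close>

definition meromorphic_at_cusps :: "int \<Rightarrow> (complex \<Rightarrow> complex) \<Rightarrow> bool" where
  "meromorphic_at_cusps k F \<longleftrightarrow>
     (\<forall>A\<in>carrier SL2Z. \<exists>C c. \<forall>z. Im z \<ge> 1 \<longrightarrow> norm (slash k A F z) \<le> C * exp (c * Im z))"

text \<open>
  The almost holomorphic function of Kaneko and Zagier with coefficients \<open>f 0, \<dots>, f M\<close>,
  a polynomial in \<open>1 / (4 \<pi> Im z)\<close>.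
\<close>

definition almost_holomorphic :: "nat \<Rightarrow> (nat \<Rightarrow> complex \<Rightarrow> complex) \<Rightarrow> complex \<Rightarrow> complex" where
  "almost_holomorphic M f z = (\<Sum>m\<le>M. f m z / of_real (4 * pi * Im z) ^ m)"

definition almost_holomorphic_modular_form ::
  "(int^2^2) set \<Rightarrow> int \<Rightarrow> nat \<Rightarrow> (nat \<Rightarrow> complex \<Rightarrow> complex) \<Rightarrow> bool" where
  "almost_holomorphic_modular_form \<Gamma> k M f \<longleftrightarrow>
     (\<forall>m\<le>M. f m holomorphic_on upper_half_plane) \<and>
     (\<forall>A\<in>\<Gamma>. \<forall>z\<in>upper_half_plane.
        slash k A (almost_holomorphic M f) z = almost_holomorphic M f z) \<and>
     meromorphic_at_cusps k (almost_holomorphic M f)"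

definition quasimodular_form_of_weight ::
  "(int^2^2) set \<Rightarrow> int \<Rightarrow> (complex \<Rightarrow> complex) \<Rightarrow> bool" where
  "quasimodular_form_of_weight \<Gamma> k g \<longleftrightarrow>
     (\<exists>M f. almost_holomorphic_modular_form \<Gamma> k M f \<and> (\<forall>z\<in>upper_half_plane. g z = f 0 z))"

text \<open>
  A quasimodular form is an element of the graded ring of weakly holomorphic quasimodular forms
  for some finite-index subgroup of \<open>SL\<^sub>2(\<int>)\<close>: poles at the cusps are allowed, and
  so are components of several weights. For instance, with
  \<open>P = \<eta>(2z)\<^sup>2 / \<eta>(z)\<^sup>4\<close>, of weight \<open>-1\<close> and with a pole at the
  cusp \<open>0\<close>, one has
  \<open>N\<^sub>2(1, 1; q) = - P E\<^sub>2 / 24 - 5 P / 24 + 1 / 4\<close>,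
  which has components of weights \<open>1\<close>, \<open>-1\<close> and \<open>0\<close>.
\<close>

definition quasimodular_form :: "(complex \<Rightarrow> complex) \<Rightarrow> bool" where
  "quasimodular_form g \<longleftrightarrow>
     (\<exists>\<Gamma> K h. finite_index_subgroup \<Gamma> \<and> finite K \<and>
        (\<forall>k\<in>K. quasimodular_form_of_weight \<Gamma> k (h k)) \<and>
        (\<forall>z\<in>upper_half_plane. g z = (\<Sum>k\<in>K. h k z)))"

end

theory Submission
  imports Defs "HOL-Complex_Analysis.Complex_Analysis"
begin

text \<open>
  Put \<open>X\<^sub>n = q\<^sup>n / (1 - q\<^sup>n)\<^sup>2\<close> and let \<open>L(s)\<close> be the sum over \<open>n \<noteq> 0\<close> of
  \<open>(-1)\<^bsup>n-1\<^esup> q\<^bsup>n(n-1)/2\<^esup> / (1 - s X\<^sub>n)\<close>, a generating function of the Lambert type sums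
  \<open>M\<^sub>k\<close>, in which a factor \<open>X\<^sub>n\<^sup>k\<close> replaces the denominator. Comparing quasi-periods (Liouville's theorem)
  shows that \<open>L(w - 2 + 1/w)\<close> is essentially the reciprocal of the theta product
  \<open>(w, q/w)\<^sub>\<infinity>\<close>; so with \<open>w = exp (2 \<pi> i u)\<close> the function
  \<open>\<phi>(z, u) = w\<^bsup>-1/2\<^esup> (w, q/w)\<^sub>\<infinity> / (q)\<^sub>\<infinity>\<^sup>2\<close> has the Taylor coefficients of \<open>u / \<phi>\<close> in the
  span of the \<open>M\<^sub>k\<close>, and conversely. Again by Liouville's theorem \<open>\<phi>\<close> is a Jacobi form of weight
  \<open>-1\<close> and index \<open>1/2\<close> for the full modular group, so that after multiplication by a Gaussian in \<open>u\<close>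
  these coefficients become almost holomorphic modular. Finally
  \<open>P = (-q)\<^sub>\<infinity>\<^sup>2 / (q)\<^sub>\<infinity>\<^sup>2\<close> is a multiple of \<open>\<phi>(z, 1/2)\<close>, hence of weight \<open>-1\<close> on \<open>\<Gamma>(8)\<close> and
  equal to \<open>1 / L(-4)\<close>, and expanding \<open>X\<^bsup>v+1\<^esup> / (1 + 4 X)\<close> writes \<open>N\<^sub>2\<^sub>v(1, 1; q)\<close> as a linear
  combination of \<open>1\<close> and of the \<open>P M\<^sub>k\<close>.
\<close>

section \<open>Infinite sums over the integers\<close>

text \<open>The \<open>M\<^sub>k\<close> in general mix several weights; homogeneous are the Taylor
  coefficients of u / phi, the n-th of weight n after the Gaussian correction. The passage between
  the two is a triangular system whose constants come from sin(pi u), which is why it is carried out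
  on formal power series in u. The substitution s = w - 2 + 1/w is dictated by the factorisation of
  1 - s X_n as (1 - w q^n) (1 - q^n/w) / (1 - q^n)^2: the poles in s become the zeros of the theta
  product. The value -4 belongs to w = -1, that is u = 1/2, where 1 + 4 X_n = ((1 + q^n) / (1 -
  q^n))^2 accounts for the factors (1 + q^n)^2 that the Pochhammer quotients leave in the
  denominators of N. Each use of Liouville's theorem leaves a constant, which is found at u = 0:
  from M_0 = 1 in the first case, from the linear term of sin(pi u) in the second. The
  Gaussian-corrected coefficients transform under all of SL2(Z), so one bound on Im z >= 1 controls
  them at every cusp. The level 8 and the exponential growth at the cusps come from P alone.\<close>

lemma holomorphic_on_infsum:
  fixes f :: "'a \<Rightarrow> complex \<Rightarrow> complex"
  assumes S: "open S" and hol: "\<And>n. n \<in> I \<Longrightarrow> f n holomorphic_on S"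
    and bound: "\<And>n z. n \<in> I \<Longrightarrow> z \<in> S \<Longrightarrow> norm (f n z) \<le> M n"
    and M: "M summable_on I"
  shows "(\<lambda>z. \<Sum>\<^sub>\<infinity>n\<in>I. f n z) holomorphic_on S"
proof -
  have "(\<lambda>z. \<Sum>\<^sub>\<infinity>n\<in>I. f n z) field_differentiable at x" if x: "x \<in> S" for x
  proof -
    obtain r where r: "r > 0" "cball x r \<subseteq> S"
      using S x open_contains_cball by blast
    \<comment> \<open>The limit is along the net of finite subsets of \<open>I\<close>; the theorem
      on holomorphic uniform limits holds for any nontrivial filter, so no enumeration of
      \<open>I\<close> is chosen.\<close>
    have ul: "uniform_limit (cball x r) (\<lambda>X y. \<Sum>n\<in>X. f n y) (\<lambda>y. \<Sum>\<^sub>\<infinity>n\<in>I. f n y)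
        (finite_subsets_at_top I)"
      using r bound M by (intro Weierstrass_m_test_general[where M = M]) auto
    have ev: "eventually (\<lambda>X. continuous_on (cball x r) (\<lambda>y. \<Sum>n\<in>X. f n y) \<and>
        (\<lambda>y. \<Sum>n\<in>X. f n y) holomorphic_on ball x r) (finite_subsets_at_top I)"
    proof (rule eventually_finite_subsets_at_top_weakI)
      fix X assume X: "finite X" "X \<subseteq> I"
      have "(\<lambda>y. \<Sum>n\<in>X. f n y) holomorphic_on S"
        using X hol by (intro holomorphic_on_sum) auto
      thus "continuous_on (cball x r) (\<lambda>y. \<Sum>n\<in>X. f n y) \<and>
          (\<lambda>y. \<Sum>n\<in>X. f n y) holomorphic_on ball x r"
        using r subset_trans[OF ball_subset_cball r(2)]
        by (auto intro: continuous_on_subset[OF holomorphic_on_imp_continuous_on] holomorphic_on_subset)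
    qed
    have "(\<lambda>y. \<Sum>\<^sub>\<infinity>n\<in>I. f n y) holomorphic_on ball x r"
      by (rule holomorphic_uniform_limit[OF ev ul]) auto
    thus ?thesis
      using r by (intro holomorphic_on_imp_differentiable_at[of _ "ball x r"]) auto
  qed
  thus ?thesis
    by (auto simp: holomorphic_on_def intro: field_differentiable_at_within)
qed

lemma summable_on_power_abs_int:
  fixes r :: real
  assumes "0 \<le> r" "r < 1"
  shows "(\<lambda>n::int. r ^ nat \<bar>n\<bar>) summable_on UNIV"
proof -
  have geo: "(\<lambda>n::nat. r ^ n) summable_on UNIV"
    using assms by (intro summable_nonneg_imp_summable_on) (auto intro: summable_geometric)
  have "(\<lambda>n::int. r ^ nat \<bar>n\<bar>) summable_on {0..}"
  proof -
    have "(\<lambda>n::int. r ^ nat \<bar>n\<bar>) summable_on (range int)"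
      by (subst summable_on_reindex) (auto simp: o_def geo)
    also have "range int = {0..}"
      using zero_le_imp_eq_int by auto
    finally show ?thesis .
  qed
  moreover have "(\<lambda>n::int. r ^ nat \<bar>n\<bar>) summable_on {..0}"
  proof -
    have "(\<lambda>n::int. r ^ nat \<bar>n\<bar>) summable_on ((\<lambda>n. - int n) ` UNIV)"
      by (subst summable_on_reindex) (auto simp: o_def geo inj_def)
    also have "range (\<lambda>n. - int n) = {..0}"
    proof (intro equalityI subsetI)
      fix x :: int assume "x \<in> {..0}"
      thus "x \<in> range (\<lambda>n. - int n)"
        by (intro image_eqI[of _ _ "nat (- x)"]) auto
    qed auto
    finally show ?thesis .
  qed
  moreover have "{0..} \<union> {..0} = (UNIV :: int set)"
    by auto
  ultimately show ?thesis
    using summable_on_union[of "\<lambda>n::int. r ^ nat \<bar>n\<bar>" "{0..}" "{..0}"] by simp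
qed

section \<open>The infinite q-Pochhammer symbol\<close>

lemma summable_qpoch:
  fixes a q :: complex
  assumes "norm q < 1"
  shows "summable (\<lambda>k. norm (a * q ^ k))"
  using assms by (auto simp: norm_mult norm_power intro!: summable_mult summable_geometric)

lemma convergent_qpoch:
  fixes a q :: complex
  assumes "norm q < 1"
  shows "convergent_prod (\<lambda>k. 1 - a * q ^ k)"
  using summable_qpoch[OF assms, of a]
  by (intro abs_convergent_prod_imp_convergent_prod)
     (simp add: abs_convergent_prod_conv_summable)

lemma qpoch_inf_LIMSEQ:
  assumes "norm q < 1"
  shows "(\<lambda>n. \<Prod>k\<le>n. 1 - a * q ^ k) \<longlonglongrightarrow> qpoch_inf a q"
  unfolding qpoch_inf_def by (intro convergent_prod_LIMSEQ convergent_qpoch assms)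

lemma qpoch_inf_rec:
  assumes "norm q < 1"
  shows "qpoch_inf a q = (1 - a) * qpoch_inf (a * q) q"
proof (rule LIMSEQ_unique)
  show "(\<lambda>n. \<Prod>k\<le>Suc n. 1 - a * q ^ k) \<longlonglongrightarrow> qpoch_inf a q"
    using qpoch_inf_LIMSEQ[OF assms] by (rule LIMSEQ_Suc)
  have "(\<Prod>k\<le>Suc n. 1 - a * q ^ k) = (1 - a) * (\<Prod>k\<le>n. 1 - (a * q) * q ^ k)" for n
    by (subst prod.atMost_Suc_shift) (simp add: mult.assoc)
  thus "(\<lambda>n. \<Prod>k\<le>Suc n. 1 - a * q ^ k) \<longlonglongrightarrow> (1 - a) * qpoch_inf (a * q) q"
    using tendsto_mult_left[OF qpoch_inf_LIMSEQ[OF assms, of "a * q"]] by simp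
qed

lemma qpoch_inf_nonzero:
  assumes "norm q < 1" "\<And>k. a * q ^ k \<noteq> 1"
  shows "qpoch_inf a q \<noteq> 0"
  unfolding qpoch_inf_def
  using assms(2) by (intro prodinf_nonzero convergent_qpoch assms(1)) (metis right_minus_eq)

lemma qpoch_inf_nonzero':
  assumes "norm q < 1" "norm a < 1"
  shows "qpoch_inf a q \<noteq> 0"
proof (rule qpoch_inf_nonzero[OF assms(1)])
  fix k
  have "norm (a * q ^ k) \<le> norm a * 1"
    unfolding norm_mult norm_power using assms by (intro mult_left_mono power_le_one) auto
  thus "a * q ^ k \<noteq> 1"
    using assms by auto
qed

text \<open>Each factor satisfies |1 - x| <= 1 + |x| <= exp |x|, and the exponents form a geometric
  series.\<close>

lemma norm_qpoch_inf_le: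
  assumes "norm q < 1"
  shows "norm (qpoch_inf a q) \<le> exp (norm a / (1 - norm q))"
proof (rule LIMSEQ_le_const2[OF tendsto_norm[OF qpoch_inf_LIMSEQ[OF assms]]], intro exI allI impI)
  fix n :: nat
  have "norm (\<Prod>k\<le>n. 1 - a * q ^ k) = (\<Prod>k\<le>n. norm (1 - a * q ^ k))"
    by (simp add: prod_norm)
  also have "\<dots> \<le> (\<Prod>k\<le>n. exp (norm (a * q ^ k)))"
  proof (intro prod_mono conjI)
    fix k
    have "norm (1 - a * q ^ k) \<le> 1 + norm (a * q ^ k)"
      using norm_triangle_ineq4[of 1 "a * q ^ k"] by simp
    thus "norm (1 - a * q ^ k) \<le> exp (norm (a * q ^ k))"
      using exp_ge_add_one_self[of "norm (a * q ^ k)"] by linarith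
  qed auto
  also have "\<dots> = exp (\<Sum>k\<le>n. norm (a * q ^ k))"
    by (simp add: exp_sum)
  also have "(\<Sum>k\<le>n. norm (a * q ^ k)) \<le> (\<Sum>k. norm (a * q ^ k))"
    by (intro sum_le_suminf summable_qpoch assms) auto
  also have "\<dots> = norm a / (1 - norm q)"
    using assms by (simp add: norm_mult norm_power suminf_mult suminf_geometric summable_geometric)
  finally show "norm (\<Prod>k\<le>n. 1 - a * q ^ k) \<le> exp (norm a / (1 - norm q))"
    by simp
qed

text \<open>For 0 <= x <= 1/2 one has 1 - x >= exp (- 2 x); the bound on \<open>a\<close> puts every
  factor into this range. It serves to bound denominators in the estimates at the cusps.\<close>

lemma norm_qpoch_inf_ge:
  assumes "norm q < 1" "norm a \<le> 1 / 2"
  shows "norm (qpoch_inf a q) \<ge> exp (- (2 * norm a / (1 - norm q)))"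
proof (rule LIMSEQ_le_const[OF tendsto_norm[OF qpoch_inf_LIMSEQ[OF assms(1)]]], intro exI allI impI)
  fix n :: nat
  have *: "norm (a * q ^ k) \<le> 1 / 2" for k
  proof -
    have "norm (a * q ^ k) \<le> norm a * 1"
      unfolding norm_mult norm_power using assms by (intro mult_left_mono power_le_one) auto
    thus ?thesis using assms by simp
  qed
  have "(\<Sum>k\<le>n. norm (a * q ^ k)) \<le> (\<Sum>k. norm (a * q ^ k))"
    by (intro sum_le_suminf summable_qpoch assms) auto
  also have "\<dots> = norm a / (1 - norm q)"
    using assms by (simp add: norm_mult norm_power suminf_mult suminf_geometric summable_geometric)
  finally have "exp (- (2 * norm a / (1 - norm q))) \<le> exp (\<Sum>k\<le>n. - (2 * norm (a * q ^ k)))"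
    by (simp add: sum_negf flip: sum_distrib_left)
  also have "\<dots> = (\<Prod>k\<le>n. exp (- (2 * norm (a * q ^ k))))"
    by (simp add: exp_sum)
  also have "\<dots> \<le> (\<Prod>k\<le>n. norm (1 - a * q ^ k))"
  proof (intro prod_mono conjI)
    fix k
    define x where "x = norm (a * q ^ k)"
    have x: "0 \<le> x" "x \<le> 1 / 2" using *[of k] by (auto simp: x_def)
    have "2 * x \<ge> - ln (1 - x)"
    proof -
      have "- ln (1 - x) = ln (1 / (1 - x))" using x by (simp add: ln_div)
      also have "\<dots> \<le> 1 / (1 - x) - 1" using x by (intro ln_le_minus_one) auto
      also have "\<dots> \<le> 2 * x"
      proof -
        have "x * (1 - 2 * x) \<ge> 0" using x by simp
        thus ?thesis using x by (simp add: field_simps)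
      qed
      finally show ?thesis .
    qed
    hence "exp (- (2 * x)) \<le> exp (ln (1 - x))" by simp
    also have "\<dots> = 1 - x" using x by simp
    also have "\<dots> \<le> norm (1 - a * q ^ k)"
      using norm_triangle_ineq2[of 1 "a * q ^ k"] by (simp add: x_def)
    finally show "exp (- (2 * norm (a * q ^ k))) \<le> norm (1 - a * q ^ k)"
      by (simp add: x_def)
  qed auto
  also have "\<dots> = norm (\<Prod>k\<le>n. 1 - a * q ^ k)"
    by (simp add: prod_norm)
  finally show "exp (- (2 * norm a / (1 - norm q))) \<le> norm (\<Prod>k\<le>n. 1 - a * q ^ k)" .
qed

lemma holomorphic_on_qpoch_inf:
  assumes q: "norm q < 1"
  shows "(\<lambda>a. qpoch_inf a q) holomorphic_on UNIV"
proof (rule holomorphic_uniform_sequence)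
  show "(\<lambda>a. \<Prod>k<n. 1 - a * q ^ k) holomorphic_on UNIV" for n
    by (intro holomorphic_intros)
  fix x :: complex
  have "uniformly_convergent_on (cball x 1) (\<lambda>N a. \<Prod>k<N. 1 - a * q ^ k)"
  proof (rule uniformly_convergent_on_prod')
    show "uniformly_convergent_on (cball x 1) (\<lambda>N a. \<Sum>n<N. norm (1 - a * q ^ n - 1))"
    proof (rule Weierstrass_m_test')
      fix n a assume "a \<in> cball x 1"
      hence "norm a \<le> norm x + 1"
        using norm_triangle_sub[of a x] by (simp add: dist_norm norm_minus_commute)
      thus "norm (norm (1 - a * q ^ n - 1)) \<le> (norm x + 1) * norm q ^ n"
        by (simp add: norm_mult norm_power mult_right_mono)
    qed (use q in \<open>auto intro!: summable_mult summable_geometric\<close>)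
  qed (auto intro!: continuous_intros)
  then obtain l where l: "uniform_limit (cball x 1) (\<lambda>N a. \<Prod>k<N. 1 - a * q ^ k) l sequentially"
    by (auto simp: uniformly_convergent_on_def)
  have "l a = qpoch_inf a q" if "a \<in> cball x 1" for a
  proof (rule LIMSEQ_unique)
    show "(\<lambda>N. \<Prod>k<Suc N. 1 - a * q ^ k) \<longlonglongrightarrow> l a"
      by (rule LIMSEQ_Suc, rule tendsto_uniform_limitI[OF l that])
    show "(\<lambda>N. \<Prod>k<Suc N. 1 - a * q ^ k) \<longlonglongrightarrow> qpoch_inf a q"
      using qpoch_inf_LIMSEQ[OF q, of a] by (simp add: lessThan_Suc_atMost)
  qed
  hence "uniform_limit (cball x 1) (\<lambda>N a. \<Prod>k<N. 1 - a * q ^ k) (\<lambda>a. qpoch_inf a q) sequentially"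
    using l by (subst uniform_limit_cong'[where i = l and g = "\<lambda>N a. \<Prod>k<N. 1 - a * q ^ k"]) simp_all
  thus "\<exists>d>0. cball x d \<subseteq> UNIV \<and>
      uniform_limit (cball x d) (\<lambda>n a. \<Prod>k<n. 1 - a * q ^ k) (\<lambda>a. qpoch_inf a q) sequentially"
    by (intro exI[of _ 1]) auto
qed auto

lemma holomorphic_on_qpoch_inf' [holomorphic_intros]:
  assumes "norm q < 1" "f holomorphic_on S"
  shows "(\<lambda>z. qpoch_inf (f z) q) holomorphic_on S"
  using holomorphic_on_compose_gen[OF assms(2) holomorphic_on_qpoch_inf[OF assms(1)]]
  by (simp add: o_def)

section \<open>Elliptic functions without poles\<close>

definition period_lattice :: "complex \<Rightarrow> complex set" where
  "period_lattice z = {of_int m * z + of_int n | m n. True}"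

lemma period_latticeI: "of_int m * z + of_int n \<in> period_lattice z"
  by (auto simp: period_lattice_def)

lemma zero_in_period_lattice [simp]: "0 \<in> period_lattice z"
  using period_latticeI[of 0 z 0] by simp

lemma period_lattice_add_iff [simp]:
  "u + of_int m * z + of_int n \<in> period_lattice z \<longleftrightarrow> u \<in> period_lattice z"
proof
  assume "u + of_int m * z + of_int n \<in> period_lattice z"
  then obtain a b :: int where "u + of_int m * z + of_int n = of_int a * z + of_int b"
    by (auto simp: period_lattice_def)
  hence "u = of_int (a - m) * z + of_int (b - n)"
    by (simp add: algebra_simps)
  thus "u \<in> period_lattice z"
    by (simp only: period_latticeI)
next
  assume "u \<in> period_lattice z"
  then obtain a b :: int where "u = of_int a * z + of_int b"
    by (auto simp: period_lattice_def)
  hence "u + of_int m * z + of_int n = of_int (a + m) * z + of_int (b + n)"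
    by (simp add: algebra_simps)
  thus "u + of_int m * z + of_int n \<in> period_lattice z"
    by (simp only: period_latticeI)
qed

lemma period_lattice_add_periods [simp]:
  "u + 1 \<in> period_lattice z \<longleftrightarrow> u \<in> period_lattice z"
  "u + z \<in> period_lattice z \<longleftrightarrow> u \<in> period_lattice z"
  using period_lattice_add_iff[of u 0 z 1] period_lattice_add_iff[of u 1 z 0] by simp_all

text \<open>The imaginary part of m z + n bounds m, after which the modulus bounds n.\<close>

lemma finite_period_lattice_bounded:
  assumes z: "Im z > 0"
  shows "finite (period_lattice z \<inter> cball 0 R)"
proof -
  define M where "M = \<lceil>R / Im z\<rceil>"
  define N where "N = \<lceil>R + of_int M * norm z\<rceil>"
  have "period_lattice z \<inter> cball 0 R \<subseteq> (\<lambda>(m, n). of_int m * z + of_int n) ` ({-M..M} \<times> {-N..N})"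
  proof
    fix u assume u: "u \<in> period_lattice z \<inter> cball 0 R"
    then obtain m n :: int where mn: "u = of_int m * z + of_int n"
      by (auto simp: period_lattice_def)
    have "\<bar>of_int m\<bar> * Im z = \<bar>Im u\<bar>"
      using z by (simp add: mn abs_mult)
    also have "\<dots> \<le> R"
      using u abs_Im_le_cmod[of u] by simp
    finally have "\<bar>of_int m\<bar> \<le> R / Im z"
      using z by (simp add: field_simps)
    hence m: "\<bar>m\<bar> \<le> M"
      unfolding M_def by linarith
    have "norm (of_int n :: complex) = norm (u - of_int m * z)"
      by (simp add: mn)
    also have "\<dots> \<le> R + of_int \<bar>m\<bar> * norm z"
      using u norm_triangle_ineq4[of u "of_int m * z"] by (simp add: norm_mult)
    also have "\<dots> \<le> R + of_int M * norm z"
      using m by (intro add_left_mono mult_right_mono) auto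
    finally have "\<bar>of_int n\<bar> \<le> R + of_int M * norm z"
      by simp
    hence "\<bar>n\<bar> \<le> N"
      unfolding N_def by linarith
    with m show "u \<in> (\<lambda>(m, n). of_int m * z + of_int n) ` ({-M..M} \<times> {-N..N})"
      by (intro image_eqI[of _ _ "(m, n)"]) (auto simp: mn)
  qed
  thus ?thesis
    by (rule finite_subset) auto
qed

lemma open_minus_period_lattice:
  assumes z: "Im z > 0"
  shows "open (- period_lattice z)"
proof (rule openI)
  fix u assume u: "u \<in> - period_lattice z"
  define U where "U = ball 0 (norm u + 1) - (period_lattice z \<inter> cball 0 (norm u + 1))"
  have "open U" unfolding U_def
    by (intro open_Diff open_ball finite_imp_closed finite_period_lattice_bounded z)
  moreover have "u \<in> U" "U \<subseteq> - period_lattice z"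
    using u by (auto simp: U_def)
  ultimately show "\<exists>e>0. ball u e \<subseteq> - period_lattice z"
    by (meson openE subset_trans)
qed

lemma period_lattice_isolated_0:
  assumes z: "Im z > 0"
  obtains e where "e > 0" "period_lattice z \<inter> ball 0 e = {0}"
proof -
  define F where "F = period_lattice z \<inter> cball 0 1 - {0}"
  have "open (ball 0 1 - F)"
    unfolding F_def
    by (intro open_Diff open_ball finite_imp_closed finite_Diff finite_period_lattice_bounded z)
  moreover have "0 \<in> ball 0 1 - F"
    by (auto simp: F_def)
  ultimately obtain e where e: "e > 0" "ball 0 e \<subseteq> ball 0 1 - F"
    by (meson openE)
  have "period_lattice z \<inter> ball 0 e = {0}"
    using e by (auto simp: F_def)
  with e(1) show ?thesis
    by (rule that)
qed

lemma eventually_not_in_period_lattice: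
  assumes z: "Im z > 0"
  shows "eventually (\<lambda>u. u \<notin> period_lattice z) (at 0)"
proof -
  obtain e where e: "e > 0" "period_lattice z \<inter> ball 0 e = {0}"
    by (rule period_lattice_isolated_0[OF z])
  have "eventually (\<lambda>u. u \<in> ball 0 e - {0}) (at (0::complex))"
    using e(1) by (intro eventually_at_in_open) auto
  thus ?thesis
    by eventually_elim (use e(2) in blast)
qed

lemma periodic_of_int:
  fixes g :: "complex \<Rightarrow> 'a"
  assumes "\<And>u. g (u + a) = g u"
  shows "g (u + of_int n * a) = g u"
proof (induction n rule: int_induct[where k = 0])
  case (step1 n)
  show ?case
    using assms[of "u + of_int n * a"] step1 by (simp add: algebra_simps)
next
  case (step2 n)
  show ?case
    using assms[of "u + of_int (n - 1) * a"] step2 by (simp add: algebra_simps)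
qed simp

text \<open>All values are attained on the compact fundamental parallelogram, so Liouville's theorem
  applies.\<close>

lemma elliptic_entire_constant:
  assumes z: "Im z > 0" and hol: "g holomorphic_on UNIV"
    and per: "\<And>u. g (u + 1) = g u" "\<And>u. g (u + z) = g u"
  shows "g u = g 0"
proof -
  define P where "P = (\<lambda>(s, t). of_real s + of_real t * z) ` ({0..1} \<times> {0..1::real})"
  have "compact P"
    unfolding P_def case_prod_unfold
    by (intro compact_continuous_image compact_Times continuous_intros) auto
  hence "bounded (g ` P)"
    using hol by (intro compact_imp_bounded compact_continuous_image)
      (auto intro: holomorphic_on_imp_continuous_on holomorphic_on_subset)
  moreover have "range g \<subseteq> g ` P"
  proof safe
    fix u
    define t where "t = Im u / Im z"
    define s where "s = Re u - t * Re z"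
    have u: "u = of_real s + of_real t * z"
      using z by (simp add: complex_eq_iff s_def t_def)
    have "g u = g (of_real (frac s) + of_real (frac t) * z + of_int \<lfloor>s\<rfloor> * 1 + of_int \<lfloor>t\<rfloor> * z)"
      by (simp add: u frac_def algebra_simps)
    also have "\<dots> = g (of_real (frac s) + of_real (frac t) * z)"
      using periodic_of_int[of g, OF per(1), of _ "\<lfloor>s\<rfloor>"] periodic_of_int[of g, OF per(2), of _ "\<lfloor>t\<rfloor>"]
      by metis
    finally have "g u = g (of_real (frac s) + of_real (frac t) * z)" .
    moreover have "(frac s, frac t) \<in> {0..1} \<times> {0..1}"
      by (auto simp: frac_lt_1 less_imp_le)
    hence "of_real (frac s) + of_real (frac t) * z \<in> P"
      unfolding P_def by (rule rev_image_eqI) simp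
    ultimately show "g u \<in> g ` P"
      by blast
  qed
  ultimately have "g constant_on UNIV"
    by (rule Liouville_theorem[OF hol bounded_subset])
  thus ?thesis
    by (auto simp: constant_on_def)
qed

text \<open>The form suited to quotients of theta functions, which are known only off the lattice. A
  finite limit at 0 removes the singularity there, and periodicity carries the extension to every
  other lattice point.\<close>

lemma elliptic_constant:
  assumes z: "Im z > 0" and hol: "f holomorphic_on (- period_lattice z)"
    and per: "\<And>u. u \<notin> period_lattice z \<Longrightarrow> f (u + 1) = f u"
      "\<And>u. u \<notin> period_lattice z \<Longrightarrow> f (u + z) = f u"
    and lim: "(f \<longlongrightarrow> c) (at 0)"
    and u: "u \<notin> period_lattice z"
  shows "f u = c"
proof -
  define g where "g = (\<lambda>u. if u \<in> period_lattice z then c else f u)"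
  have g_per: "g (u + 1) = g u" "g (u + z) = g u" for u
    using per by (auto simp: g_def)
  have g_lat: "g (u + of_int m * z + of_int n) = g u" for u m n
    using periodic_of_int[of g 1 "u + of_int m * z" n] periodic_of_int[of g z u m] g_per by simp
  have holg: "g holomorphic_on (- period_lattice z)"
    using hol by (rule holomorphic_transform) (auto simp: g_def)
  obtain e where e: "e > 0" "period_lattice z \<inter> ball 0 e = {0}"
    by (rule period_lattice_isolated_0[OF z])
  have "g holomorphic_on ball 0 e"
  proof (rule no_isolated_singularity'[of "{0}"])
    fix w assume "w \<in> {0 :: complex}"
    hence [simp]: "w = 0" by simp
    have "eventually (\<lambda>u. f u = g u) (at 0)"
      using eventually_not_in_period_lattice[OF z] by eventually_elim (auto simp: g_def)
    hence "(g \<longlongrightarrow> c) (at 0)"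
      by (rule Lim_transform_eventually[OF lim])
    thus "(g \<longlongrightarrow> g w) (at w within ball 0 e)"
      using e(1) at_within_open[of 0 "ball (0::complex) e"] by (simp add: g_def)
  next
    show "g holomorphic_on ball 0 e - {0}"
      using holg by (rule holomorphic_on_subset) (use e in blast)
  qed auto
  hence g0: "g field_differentiable at 0"
    using e(1) by (intro holomorphic_on_imp_differentiable_at[of _ "ball 0 e"]) auto
  have "g field_differentiable at w" for w
  proof (cases "w \<in> period_lattice z")
    case True
    then obtain m n :: int where w: "w = of_int m * z + of_int n"
      by (auto simp: period_lattice_def)
    have "(\<lambda>v. g (v - w)) field_differentiable at w"
      using field_differentiable_compose[of "\<lambda>v. v - w" w g] g0
      by (simp add: o_def field_differentiable_diff)
    moreover have "g (v - w) = g v" for v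
      using g_lat[of "v - w" m n] by (simp add: w)
    ultimately show ?thesis
      by simp
  next
    case False
    thus ?thesis
      using holg open_minus_period_lattice[OF z]
      by (intro holomorphic_on_imp_differentiable_at[of _ "- period_lattice z"]) auto
  qed
  hence "g holomorphic_on UNIV"
    by (simp add: holomorphic_on_def)
  from elliptic_entire_constant[OF z this g_per, of u] show ?thesis
    using u by (simp add: g_def)
qed

section \<open>The Lambert type series\<close>

text \<open>The exponent n (n + 1) / 2 + v n of \<open>N_even\<close> is n (n - 1) / 2 plus (v + 1)
  n; the second part goes into the power v + 1 of \<open>lambert_var\<close>. The remaining exponent
  is invariant under n -> 1 - n, while the sign changes.\<close>

definition theta_coeff :: "complex \<Rightarrow> int \<Rightarrow> complex" where
  "theta_coeff q n = (-1) powi (n - 1) * q powi (n * (n - 1) div 2)"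

definition lambert_var :: "complex \<Rightarrow> int \<Rightarrow> complex" where
  "lambert_var q n = q powi n / (1 - q powi n) ^ 2"

text \<open>The value at s = 0 is the series \<open>M\<^sub>k\<close>; in general
  \<open>lambert_gen k q s\<close> is the generating function of \<open>M\<^sub>k\<close>,
  \<open>M\<^sub>k\<^sub>+\<^sub>1\<close>, and so on. Keeping both parameters makes the recursion
  in k available at every s.\<close>

definition lambert_gen :: "nat \<Rightarrow> complex \<Rightarrow> complex \<Rightarrow> complex" where
  "lambert_gen k q s =
     (\<Sum>\<^sub>\<infinity>n\<in>UNIV - {0}. theta_coeff q n * lambert_var q n ^ k / (1 - s * lambert_var q n))"

text \<open>A linear bound suffices to compare with a geometric series. The - 1 is forced by n = 1,
  where the triangular number is 0.\<close>

lemma triangular_ge: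
  fixes n :: int
  assumes "n \<noteq> 0"
  shows "\<bar>n\<bar> - 1 \<le> n * (n - 1) div 2"
proof -
  have "2 * (\<bar>n\<bar> - 1) \<le> n * (n - 1)"
  proof (cases "n > 0")
    case True
    have "0 \<le> (n - 1) * (n - 2)"
      using True by (cases "n = 1") auto
    thus ?thesis using True by (simp add: algebra_simps)
  next
    case False
    have "0 \<le> (- n) * (- n - 1)"
      using False assms by (intro mult_nonneg_nonneg) auto
    thus ?thesis using False by (simp add: algebra_simps)
  qed
  from zdiv_mono1[OF this, of 2] show ?thesis by simp
qed

lemma norm_theta_coeff_le:
  assumes "norm q \<le> r" "r < 1" "n \<noteq> 0"
  shows "norm (theta_coeff q n) \<le> r ^ (nat \<bar>n\<bar> - 1)"
proof -
  define t where "t = n * (n - 1) div 2"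
  have t: "t \<ge> \<bar>n\<bar> - 1" "t \<ge> 0"
    using triangular_ge[OF assms(3)] assms(3) by (auto simp: t_def)
  have "norm (theta_coeff q n) = norm q ^ nat t"
    using t by (simp add: theta_coeff_def norm_mult norm_power power_int_def flip: t_def)
  also have "\<dots> \<le> r ^ nat t"
    using assms by (intro power_mono) auto
  also have "\<dots> \<le> r ^ (nat \<bar>n\<bar> - 1)"
    using t assms order_trans[OF norm_ge_zero assms(1)] by (intro power_decreasing) auto
  finally show ?thesis .
qed

lemma summable_on_power_abs_int_diff_1:
  fixes r :: real
  assumes "0 < r" "r < 1"
  shows "(\<lambda>n::int. r ^ (nat \<bar>n\<bar> - 1)) summable_on UNIV - {0}"
proof -
  have "(\<lambda>n::int. r ^ nat \<bar>n\<bar> / r) summable_on UNIV - {0}"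
    using summable_on_subset_banach[OF summable_on_power_abs_int[of r], of "UNIV - {0}"] assms
    by (simp add: divide_inverse summable_on_cmult_left)
  moreover have "(\<lambda>n::int. r ^ nat \<bar>n\<bar> / r) summable_on UNIV - {0} \<longleftrightarrow>
      (\<lambda>n::int. r ^ (nat \<bar>n\<bar> - 1)) summable_on UNIV - {0}"
    by (rule summable_on_cong) (use assms in \<open>auto simp: power_diff\<close>)
  ultimately show ?thesis
    by blast
qed

lemma power_int_neq_1:
  fixes q :: complex
  assumes "0 < norm q" "norm q < 1" "n \<noteq> 0"
  shows "q powi n \<noteq> 1"
proof
  assume "q powi n = 1"
  hence "norm q powi n = 1"
    by (metis norm_one norm_power_int)
  moreover have "norm q ^ m \<noteq> 1" if "m > 0" for m
    using power_Suc_less_one[of "norm q" "m - 1"] that assms by simp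
  ultimately show False
    using assms(3) by (cases "n > 0") (auto simp: power_int_def power_inverse)
qed

text \<open>The expression x / (1 - x)^2 is invariant under x -> 1/x. If q^n = 1, both sides are 0
  by the convention for division by zero.\<close>

lemma lambert_var_minus:
  assumes "q \<noteq> 0"
  shows "lambert_var q (- n) = lambert_var q n"
proof (cases "q powi n = 1")
  case False
  thus ?thesis
    using assms by (simp add: lambert_var_def power_int_minus divide_simps power2_eq_square) (simp add: algebra_simps)
qed (simp add: lambert_var_def power_int_minus)

lemma lambert_var_abs:
  assumes "q \<noteq> 0"
  shows "lambert_var q \<bar>n\<bar> = lambert_var q n"
  using lambert_var_minus[OF assms, of n] by (simp add: abs_if)

lemma norm_lambert_var_le:
  assumes "q \<noteq> 0" "norm q \<le> r" "r < 1" "n \<noteq> 0"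
  shows "norm (lambert_var q n) \<le> r ^ nat \<bar>n\<bar> / (1 - r) ^ 2"
proof -
  define m where "m = nat \<bar>n\<bar>"
  have m: "m > 0" using assms by (simp add: m_def)
  have r: "0 \<le> r" using assms(2) norm_ge_zero order_trans by blast
  have "lambert_var q n = q ^ m / (1 - q ^ m) ^ 2"
    using lambert_var_abs[OF assms(1), of n] by (simp add: lambert_var_def m_def power_int_def)
  hence "norm (lambert_var q n) = norm q ^ m / norm (1 - q ^ m) ^ 2"
    by (simp add: norm_divide norm_power)
  also have "\<dots> \<le> r ^ m / (1 - r) ^ 2"
  proof (intro frac_le power_mono)
    have "norm (q ^ m) \<le> r ^ m"
      using assms by (simp add: norm_power power_mono)
    also have "r ^ m \<le> r ^ 1"
      using m r assms by (intro power_decreasing) auto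
    finally show "1 - r \<le> norm (1 - q ^ m)"
      using norm_triangle_ineq2[of 1 "q ^ m"] by simp
  qed (use assms r in auto)
  finally show ?thesis by (simp add: m_def)
qed

lemma norm_lambert_var_le':
  assumes "q \<noteq> 0" "norm q \<le> r" "r < 1" "n \<noteq> 0"
  shows "norm (lambert_var q n) \<le> 1 / (1 - r) ^ 2"
proof -
  have "r ^ nat \<bar>n\<bar> \<le> 1"
    using assms by (intro power_le_one) (auto intro: order_trans[OF norm_ge_zero])
  thus ?thesis
    using norm_lambert_var_le[OF assms] assms(3) by (smt (verit) divide_right_mono zero_le_power2)
qed

text \<open>As X_n tends to 0, the poles 1 / X_n in s have no finite accumulation point.\<close>

lemma finite_lambert_var_ge:
  assumes "q \<noteq> 0" "norm q < 1" "e > 0"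
  shows "finite {n. n \<noteq> 0 \<and> norm (lambert_var q n) \<ge> e}"
proof -
  define r where "r = norm q"
  have r: "0 < r" "r < 1" using assms by (auto simp: r_def)
  have "(\<lambda>m. r ^ m / (1 - r) ^ 2) \<longlonglongrightarrow> 0"
    using tendsto_divide[OF LIMSEQ_power_zero[of r] tendsto_const[of "(1 - r) ^ 2"]] r by simp
  hence "eventually (\<lambda>m. r ^ m / (1 - r) ^ 2 < e) sequentially"
    using assms(3) by (rule order_tendstoD)
  then obtain N where N: "\<And>m. m \<ge> N \<Longrightarrow> r ^ m / (1 - r) ^ 2 < e"
    by (auto simp: eventually_sequentially)
  have "{n. n \<noteq> 0 \<and> norm (lambert_var q n) \<ge> e} \<subseteq> {- int N..int N}"
  proof
    fix n assume n: "n \<in> {n. n \<noteq> 0 \<and> norm (lambert_var q n) \<ge> e}"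
    hence "e \<le> r ^ nat \<bar>n\<bar> / (1 - r) ^ 2"
      using norm_lambert_var_le[of q r n] assms r by (auto simp: r_def)
    hence "nat \<bar>n\<bar> < N"
      using N[of "nat \<bar>n\<bar>"] by linarith
    thus "n \<in> {- int N..int N}" by auto
  qed
  thus ?thesis
    by (rule finite_subset) auto
qed

text \<open>The common majorant for varying s, for varying q and for the growth estimates: it
  depends on q only through the bound r, and on s only through the lower bound d of the
  denominators.\<close>

lemma norm_lambert_term_le:
  assumes "q \<noteq> 0" "norm q \<le> r" "r < 1" "n \<noteq> 0" "d > 0" "d \<le> norm (1 - s * lambert_var q n)"
  shows "norm (theta_coeff q n * lambert_var q n ^ k / (1 - s * lambert_var q n))
           \<le> (1 / (1 - r) ^ 2) ^ k / d * r ^ (nat \<bar>n\<bar> - 1)"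
proof -
  have "0 \<le> r" using assms(2) norm_ge_zero order_trans by blast
  have "norm (theta_coeff q n) * norm (lambert_var q n) ^ k
      \<le> r ^ (nat \<bar>n\<bar> - 1) * (1 / (1 - r) ^ 2) ^ k"
    using assms \<open>0 \<le> r\<close>
    by (intro mult_mono norm_theta_coeff_le power_mono norm_lambert_var_le') auto
  hence "norm (theta_coeff q n) * norm (lambert_var q n) ^ k / norm (1 - s * lambert_var q n)
      \<le> r ^ (nat \<bar>n\<bar> - 1) * (1 / (1 - r) ^ 2) ^ k / d"
    using assms \<open>0 \<le> r\<close> by (intro frac_le) auto
  thus ?thesis
    by (simp add: norm_mult norm_divide norm_power mult_ac)
qed

lemma summable_lambert_bound:
  fixes r C :: real
  assumes "0 < r" "r < 1"
  shows "(\<lambda>n::int. C * r ^ (nat \<bar>n\<bar> - 1)) summable_on UNIV - {0}"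
  by (intro summable_on_cmult_right summable_on_power_abs_int_diff_1 assms)

section \<open>Dependence of the Lambert series on s and on q\<close>

definition lambert_good :: "complex \<Rightarrow> complex \<Rightarrow> bool" where
  "lambert_good q s \<longleftrightarrow> (\<forall>n. n \<noteq> 0 \<longrightarrow> s * lambert_var q n \<noteq> 1)"

lemma lambert_good_0 [simp]: "lambert_good q 0"
  by (simp add: lambert_good_def)

text \<open>
  Only finitely many of the poles \<open>1 / lambert_var q n\<close> lie in a given disc; the remaining
  terms are dominated there.
\<close>
lemma lambert_local:
  assumes q: "q \<noteq> 0" "norm q < 1" and s: "lambert_good q s"
  obtains U N where "open U" "s \<in> U" "finite N" "0 \<notin> N" "\<forall>t\<in>U. lambert_good q t"
    "\<forall>t\<in>U. \<forall>n. n \<noteq> 0 \<longrightarrow> n \<notin> N \<longrightarrow> 1 / 2 \<le> norm (1 - t * lambert_var q n)"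
proof -
  define R where "R = norm s + 1"
  have R: "R > 0" by (simp add: R_def add_nonneg_pos)
  define N where "N = {n. n \<noteq> 0 \<and> norm (lambert_var q n) \<ge> 1 / (2 * R)}"
  have N: "finite N"
    unfolding N_def using R by (intro finite_lambert_var_ge q) auto
  define U where "U = ball 0 R \<inter> (\<Inter>n\<in>N. {t. t * lambert_var q n \<noteq> 1})"
  have *: "1 / 2 \<le> norm (1 - t * lambert_var q n)" if "t \<in> U" "n \<noteq> 0" "n \<notin> N" for t n
  proof -
    have "norm (t * lambert_var q n) \<le> R * (1 / (2 * R))"
      unfolding norm_mult using that R by (intro mult_mono) (auto simp: U_def N_def)
    thus ?thesis
      using R norm_triangle_ineq2[of 1 "t * lambert_var q n"] by simp
  qed
  show ?thesis
  proof (rule that[of U N])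
    show "open U"
      unfolding U_def using N
      by (intro open_Int open_INT open_ball ballI open_Collect_neq continuous_intros) auto
    show "s \<in> U"
      using s by (auto simp: U_def R_def N_def lambert_good_def)
    show "\<forall>t\<in>U. lambert_good q t"
      unfolding lambert_good_def
    proof (intro ballI allI impI)
      fix t and n :: int assume "t \<in> U" "n \<noteq> 0"
      thus "t * lambert_var q n \<noteq> 1"
        using *[of t n] by (cases "n \<in> N") (auto simp: U_def)
    qed
  qed (use * N in \<open>auto simp: N_def\<close>)
qed

lemma summable_lambert_gen:
  assumes q: "q \<noteq> 0" "norm q < 1" and s: "lambert_good q s"
  shows "(\<lambda>n. theta_coeff q n * lambert_var q n ^ k / (1 - s * lambert_var q n)) summable_on UNIV - {0}"
proof -
  obtain U N where UN: "open U" "s \<in> U" "finite N" "0 \<notin> N" "\<forall>t\<in>U. lambert_good q t"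
    "\<forall>t\<in>U. \<forall>n. n \<noteq> 0 \<longrightarrow> n \<notin> N \<longrightarrow> 1 / 2 \<le> norm (1 - t * lambert_var q n)"
    by (rule lambert_local[OF q s])
  let ?f = "\<lambda>n. theta_coeff q n * lambert_var q n ^ k / (1 - s * lambert_var q n)"
  let ?M = "\<lambda>n::int. (1 / (1 - norm q) ^ 2) ^ k / (1 / 2) * norm q ^ (nat \<bar>n\<bar> - 1)"
  have "?M summable_on UNIV - {0} - N"
    using q by (intro summable_on_subset_banach[OF summable_lambert_bound]) auto
  hence "(\<lambda>n. norm (?f n)) summable_on UNIV - {0} - N"
    by (rule Infinite_Sum.abs_summable_on_comparison_test') (intro norm_lambert_term_le, use q UN in auto)
  hence "?f summable_on UNIV - {0} - N"
    by (rule abs_summable_summable)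
  hence "?f summable_on (UNIV - {0} - N) \<union> N"
    using UN by (intro summable_on_union) auto
  moreover have "(UNIV - {0} - N) \<union> N = UNIV - {0}"
    using UN by auto
  ultimately show ?thesis by simp
qed

lemma lambert_gen_differentiable:
  assumes q: "q \<noteq> 0" "norm q < 1" and s: "lambert_good q s"
  shows "lambert_gen k q field_differentiable at s"
proof -
  obtain U N where UN: "open U" "s \<in> U" "finite N" "0 \<notin> N" "\<forall>t\<in>U. lambert_good q t"
    "\<forall>t\<in>U. \<forall>n. n \<noteq> 0 \<longrightarrow> n \<notin> N \<longrightarrow> 1 / 2 \<le> norm (1 - t * lambert_var q n)"
    by (rule lambert_local[OF q s])
  let ?f = "\<lambda>s n. theta_coeff q n * lambert_var q n ^ k / (1 - s * lambert_var q n)"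
  let ?M = "\<lambda>n::int. (1 / (1 - norm q) ^ 2) ^ k / (1 / 2) * norm q ^ (nat \<bar>n\<bar> - 1)"
  have good: "1 - t * lambert_var q n \<noteq> 0" if "t \<in> U" "n \<noteq> 0" for t n
    using bspec[OF UN(5) that(1)] that(2) by (auto simp: lambert_good_def)
  have hol: "(\<lambda>t. ?f t n) holomorphic_on U" if "n \<noteq> 0" for n
    by (intro holomorphic_intros good that)
  have "(\<lambda>t. \<Sum>\<^sub>\<infinity>n\<in>UNIV - {0} - N. ?f t n) holomorphic_on U"
  proof (rule holomorphic_on_infsum[where M = ?M])
    show "?M summable_on UNIV - {0} - N"
      using q by (intro summable_on_subset_banach[OF summable_lambert_bound]) auto
    show "(\<lambda>t. ?f t n) holomorphic_on U" if "n \<in> UNIV - {0} - N" for n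
      using hol that by blast
    show "norm (?f t n) \<le> ?M n" if "n \<in> UNIV - {0} - N" "t \<in> U" for n t
      using that q UN by (intro norm_lambert_term_le) auto
  qed (use UN in auto)
  hence "(\<lambda>t. (\<Sum>\<^sub>\<infinity>n\<in>UNIV - {0} - N. ?f t n) + (\<Sum>n\<in>N. ?f t n)) holomorphic_on U"
  proof (intro holomorphic_on_add holomorphic_on_sum hol)
    show "n \<noteq> 0" if "n \<in> N" for n
      using that UN(4) by blast
  qed
  moreover have "(\<Sum>\<^sub>\<infinity>n\<in>UNIV - {0} - N. ?f t n) + (\<Sum>n\<in>N. ?f t n) = lambert_gen k q t"
    if "t \<in> U" for t
  proof -
    have sm: "?f t summable_on UNIV - {0}"
      using bspec[OF UN(5) that] by (rule summable_lambert_gen[OF q])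
    have "infsum (?f t) ((UNIV - {0} - N) \<union> N) = infsum (?f t) (UNIV - {0} - N) + infsum (?f t) N"
      using UN by (intro infsum_Un_disjoint summable_on_subset_banach[OF sm]) auto
    moreover have "(UNIV - {0} - N) \<union> N = UNIV - {0}"
      using UN by auto
    ultimately show ?thesis
      using UN by (simp add: lambert_gen_def)
  qed
  ultimately have "lambert_gen k q holomorphic_on U"
    by (rule holomorphic_transform)
  thus ?thesis
    by (rule holomorphic_on_imp_differentiable_at[OF _ UN(1,2)])
qed

text \<open>Termwise this is 1 / (1 - s X) = 1 + s X / (1 - s X). Near s = 0 it yields the Taylor
  coefficients; at s = -4 it raises k.\<close>

lemma lambert_gen_Suc:
  assumes q: "q \<noteq> 0" "norm q < 1" and s: "lambert_good q s"
  shows "lambert_gen k q s = lambert_gen k q 0 + s * lambert_gen (Suc k) q s"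
proof -
  have "lambert_gen k q s = (\<Sum>\<^sub>\<infinity>n\<in>UNIV - {0}. theta_coeff q n * lambert_var q n ^ k / (1 - 0 * lambert_var q n)
      + s * (theta_coeff q n * lambert_var q n ^ Suc k / (1 - s * lambert_var q n)))"
    unfolding lambert_gen_def
  proof (rule infsum_cong)
    fix n :: int assume "n \<in> UNIV - {0}"
    hence "1 - s * lambert_var q n \<noteq> 0"
      using s by (auto simp: lambert_good_def)
    thus "theta_coeff q n * lambert_var q n ^ k / (1 - s * lambert_var q n) =
        theta_coeff q n * lambert_var q n ^ k / (1 - 0 * lambert_var q n)
        + s * (theta_coeff q n * lambert_var q n ^ Suc k / (1 - s * lambert_var q n))"
      by (simp add: field_simps)
  qed
  also have "\<dots> = lambert_gen k q 0 + s * lambert_gen (Suc k) q s"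
    unfolding lambert_gen_def
    using summable_lambert_gen[OF q lambert_good_0, of k] summable_lambert_gen[OF q s, of "Suc k"]
    by (simp only: infsum_add summable_on_cmult_right infsum_cmult_right)
  finally show ?thesis .
qed

text \<open>The recursion in k stands in for a rearrangement of a double series: the expansion of
  \<open>lambert_gen k q\<close> has constant term \<open>lambert_gen k q 0\<close>, and its
  remaining coefficients are those for k + 1, shifted by one.\<close>

lemma has_fps_expansion_lambert_gen:
  assumes q: "q \<noteq> 0" "norm q < 1"
  shows "lambert_gen 0 q has_fps_expansion Abs_fps (\<lambda>k. lambert_gen k q 0)"
proof -
  obtain U N where U: "open U" "0 \<in> U" "finite N" "0 \<notin> N" "\<forall>t\<in>U. lambert_good q t"
    "\<forall>t\<in>U. \<forall>n. n \<noteq> 0 \<longrightarrow> n \<notin> N \<longrightarrow> 1 / 2 \<le> norm (1 - t * lambert_var q n)"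
    by (rule lambert_local[OF q lambert_good_0])
  define F where "F = (\<lambda>k. fps_expansion (lambert_gen k q) 0)"
  have F: "lambert_gen k q has_fps_expansion F k" for k
    unfolding F_def
  proof (rule has_fps_expansion_fps_expansion[OF U(1,2)])
    show "lambert_gen k q holomorphic_on U"
      unfolding holomorphic_on_def
      using lambert_gen_differentiable[OF q bspec[OF U(5)]] field_differentiable_at_within by blast
  qed
  have rec: "F k = fps_const (lambert_gen k q 0) + fps_X * F (Suc k)" for k
  proof -
    have "(\<lambda>s. lambert_gen k q 0 + s * lambert_gen (Suc k) q s) has_fps_expansion
        fps_const (lambert_gen k q 0) + fps_X * F (Suc k)"
      by (intro has_fps_expansion_add has_fps_expansion_mult has_fps_expansion_const has_fps_expansion_fps_X F)
    moreover have "eventually (\<lambda>s. lambert_gen k q 0 + s * lambert_gen (Suc k) q s = lambert_gen k q s) (nhds 0)"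
      using eventually_nhds_in_open[OF U(1,2)]
      by eventually_elim (rule lambert_gen_Suc[OF q bspec[OF U(5)], symmetric])
    ultimately have "lambert_gen k q has_fps_expansion
        fps_const (lambert_gen k q 0) + fps_X * F (Suc k)"
      by (subst (asm) has_fps_expansion_cong[OF _ refl]) auto
    thus ?thesis
      by (rule fps_expansion_unique_complex[OF F])
  qed
  have "F k $ n = lambert_gen (k + n) q 0" for k n
  proof (induction n arbitrary: k)
    case (Suc n)
    thus ?case by (subst rec) simp
  qed (subst rec, simp)
  hence "F 0 = Abs_fps (\<lambda>k. lambert_gen k q 0)"
    by (simp add: fps_eq_iff)
  thus ?thesis using F[of 0] by simp
qed

lemma lambert_gen_holomorphic_param:
  assumes U: "open U" "\<And>q. q \<in> U \<Longrightarrow> q \<noteq> 0 \<and> norm q \<le> r" and r: "0 < r" "r < 1"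
    and d: "d > 0" "\<And>q n. q \<in> U \<Longrightarrow> n \<noteq> 0 \<Longrightarrow> d \<le> norm (1 - s * lambert_var q n)"
  shows "(\<lambda>q. lambert_gen k q s) holomorphic_on U"
  unfolding lambert_gen_def
proof (rule holomorphic_on_infsum[OF U(1)])
  show "(\<lambda>n::int. (1 / (1 - r) ^ 2) ^ k / d * r ^ (nat \<bar>n\<bar> - 1)) summable_on UNIV - {0}"
    by (rule summable_lambert_bound[OF r])
next
  fix n :: int and q assume "n \<in> UNIV - {0}" "q \<in> U"
  thus "norm (theta_coeff q n * lambert_var q n ^ k / (1 - s * lambert_var q n))
      \<le> (1 / (1 - r) ^ 2) ^ k / d * r ^ (nat \<bar>n\<bar> - 1)"
    using U r d by (intro norm_lambert_term_le) auto
next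
  fix n :: int assume n: "n \<in> UNIV - {0}"
  have *: "0 < norm q" "norm q < 1" if "q \<in> U" for q
    using U(2)[OF that] r by auto
  have "1 - q powi n \<noteq> 0" if "q \<in> U" for q
    using power_int_neq_1[OF *[OF that], of n] n by auto
  moreover have "1 - s * lambert_var q n \<noteq> 0" if "q \<in> U" for q
    using d(2)[OF that, of n] d(1) n by auto
  ultimately show "(\<lambda>q. theta_coeff q n * lambert_var q n ^ k / (1 - s * lambert_var q n)) holomorphic_on U"
    using * unfolding theta_coeff_def lambert_var_def
    by (intro holomorphic_intros holomorphic_on_power_int) (auto dest: *)
qed

lemma norm_lambert_gen_le:
  assumes q: "q \<noteq> 0" "norm q \<le> r" and r: "0 < r" "r < 1"
    and d: "d > 0" "\<And>n. n \<noteq> 0 \<Longrightarrow> d \<le> norm (1 - s * lambert_var q n)"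
  shows "norm (lambert_gen k q s) \<le> (\<Sum>\<^sub>\<infinity>n\<in>UNIV - {0 :: int}. (1 / (1 - r) ^ 2) ^ k / d * r ^ (nat \<bar>n\<bar> - 1))"
  unfolding lambert_gen_def
proof (rule norm_infsum_le)
  show "((\<lambda>n::int. (1 / (1 - r) ^ 2) ^ k / d * r ^ (nat \<bar>n\<bar> - 1)) has_sum
      (\<Sum>\<^sub>\<infinity>n\<in>UNIV - {0}. (1 / (1 - r) ^ 2) ^ k / d * r ^ (nat \<bar>n\<bar> - 1))) (UNIV - {0})"
    by (intro has_sum_infsum summable_lambert_bound r)
  have "norm q < 1" using q r by simp
  moreover have "lambert_good q s"
    unfolding lambert_good_def using d by fastforce
  ultimately show "((\<lambda>n. theta_coeff q n * lambert_var q n ^ k / (1 - s * lambert_var q n)) has_sum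
      (\<Sum>\<^sub>\<infinity>n\<in>UNIV - {0}. theta_coeff q n * lambert_var q n ^ k / (1 - s * lambert_var q n))) (UNIV - {0})"
    using q by (intro has_sum_infsum summable_lambert_gen) auto
  show "norm (theta_coeff q n * lambert_var q n ^ k / (1 - s * lambert_var q n))
      \<le> (1 / (1 - r) ^ 2) ^ k / d * r ^ (nat \<bar>n\<bar> - 1)" if "n \<in> UNIV - {0}" for n
    using that q r d by (intro norm_lambert_term_le) auto
qed

section \<open>The Lambert type series and the theta product\<close>

lemma triangular_int_simps:
  fixes n :: int
  shows "(n + 1) * (n + 1 - 1) div 2 = n * (n - 1) div 2 + n"
    and "(- n) * (- n - 1) div 2 = n * (n - 1) div 2 + n"
    and "(1 - n) * (1 - n - 1) div 2 = n * (n - 1) div 2"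
proof -
  have *: "(n + 1) * n div 2 = n * (n - 1) div 2 + n"
  proof -
    have "(n + 1) * n = n * (n - 1) + n * 2" by (simp add: algebra_simps)
    thus ?thesis by (simp only: div_mult_self1)
  qed
  show "(n + 1) * (n + 1 - 1) div 2 = n * (n - 1) div 2 + n" using * by simp
  have "(- n) * (- n - 1) = (n + 1) * n" by (simp add: algebra_simps)
  with * show "(- n) * (- n - 1) div 2 = n * (n - 1) div 2 + n" by simp
  have "(1 - n) * (1 - n - 1) = n * (n - 1)" by (simp add: algebra_simps)
  thus "(1 - n) * (1 - n - 1) div 2 = n * (n - 1) div 2" by simp
qed

lemma minus_one_power_int_simps:
  fixes n :: int
  shows "(-1 :: complex) powi (n + 1 - 1) = - ((-1) powi (n - 1))"
    and "(-1 :: complex) powi (- n - 1) = (-1) powi (n - 1)"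
    and "(-1 :: complex) powi (1 - n - 1) = - ((-1) powi (n - 1))"
  by (auto simp: power_int_minus_left)

lemma theta_coeff_simps:
  assumes "q \<noteq> 0"
  shows "theta_coeff q (n + 1) = - (theta_coeff q n * q powi n)"
    and "theta_coeff q (- n) = theta_coeff q n * q powi n"
    and "theta_coeff q (1 - n) = - theta_coeff q n"
  unfolding theta_coeff_def triangular_int_simps minus_one_power_int_simps
  using assms by (simp_all add: power_int_add)

lemma theta_coeff_0 [simp]: "theta_coeff q 0 = -1"
  by (simp add: theta_coeff_def)

lemma summable_theta_coeff:
  assumes q: "q \<noteq> 0" "norm q < 1"
  shows "theta_coeff q summable_on UNIV"
proof -
  have "theta_coeff q summable_on UNIV - {0}"
    using summable_lambert_gen[OF q lambert_good_0, of 0] by simp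
  hence "theta_coeff q summable_on (UNIV - {0}) \<union> {0}"
    by (rule summable_on_union) simp
  thus ?thesis by simp
qed

text \<open>The involution n -> 1 - n reverses the sign of every term. The vanishing is used twice:
  for \<open>lambert_gen 0 q 0 = 1\<close>, and to remove the inhomogeneous term from the functional
  equation of \<open>appell\<close>.\<close>

lemma infsum_theta_coeff:
  assumes q: "q \<noteq> 0" "norm q < 1"
  shows "infsum (theta_coeff q) UNIV = 0"
proof -
  have "infsum (theta_coeff q) UNIV = (\<Sum>\<^sub>\<infinity>n. theta_coeff q (1 - n))"
    by (rule infsum_reindex_bij_witness[of _ "\<lambda>n. 1 - n" "\<lambda>n. 1 - n"]) auto
  also have "\<dots> = - infsum (theta_coeff q) UNIV"
    using q by (simp add: theta_coeff_simps infsum_uminus)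
  finally show ?thesis by simp
qed

lemma infsum_UNIV_minus_0:
  fixes f :: "int \<Rightarrow> complex"
  assumes "f summable_on UNIV"
  shows "infsum f UNIV = infsum f (UNIV - {0}) + f 0"
proof -
  have "infsum f ((UNIV - {0}) \<union> {0}) = infsum f (UNIV - {0}) + infsum f {0}"
    by (intro infsum_Un_disjoint summable_on_subset_banach[OF assms]) auto
  thus ?thesis by simp
qed

text \<open>The full theta sum vanishes and its omitted term at n = 0 is -1. This value fixes the
  constant in the product formula below.\<close>

lemma lambert_gen_0_0:
  assumes q: "q \<noteq> 0" "norm q < 1"
  shows "lambert_gen 0 q 0 = 1"
  using infsum_UNIV_minus_0[OF summable_theta_coeff[OF q]] infsum_theta_coeff[OF q]
  by (simp add: lambert_gen_def)

text \<open>The reason for the substitution s = w - 2 + 1/w: each pole in s splits into the two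
  values w = q^n and w = q^(-n).\<close>

lemma one_minus_lambert_var:
  assumes "w \<noteq> 0" "q powi n \<noteq> 1"
  shows "1 - (w - 2 + 1 / w) * lambert_var q n =
    (1 - w * q powi n) * (1 - q powi n / w) / (1 - q powi n) ^ 2"
  using assms by (simp add: lambert_var_def divide_simps) (simp add: algebra_simps power2_eq_square)

section \<open>The reciprocal theta product as an Appell type sum\<close>

definition theta_good :: "complex \<Rightarrow> complex \<Rightarrow> bool" where
  "theta_good q w \<longleftrightarrow> w \<noteq> 0 \<and> (\<forall>n::int. w * q powi n \<noteq> 1)"

lemma theta_goodD:
  assumes "theta_good q w" "q \<noteq> 0"
  shows "w \<noteq> 0" "w * q powi n \<noteq> 1" "q powi n \<noteq> w" "w \<noteq> 1"
proof -
  show w: "w \<noteq> 0" and *: "w * q powi n \<noteq> 1" for n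
    using assms by (auto simp: theta_good_def)
  show "q powi n \<noteq> w"
    using *[of "- n"] w assms(2) by (auto simp: power_int_minus)
  show "w \<noteq> 1"
    using *[of 0] by auto
qed

lemma theta_good_imp_lambert_good:
  assumes q: "q \<noteq> 0" "norm q < 1" and w: "theta_good q w"
  shows "lambert_good q (w - 2 + 1 / w)"
  unfolding lambert_good_def
proof (intro allI impI)
  fix n :: int assume "n \<noteq> 0"
  hence *: "q powi n \<noteq> 1"
    using q by (intro power_int_neq_1) auto
  have "1 - w * q powi n \<noteq> 0" "1 - q powi n / w \<noteq> 0" "1 - q powi n \<noteq> 0"
    using theta_goodD(2,3)[OF w q(1), of n] * by auto
  hence "1 - (w - 2 + 1 / w) * lambert_var q n \<noteq> 0"
    using theta_goodD(1)[OF w q(1)] * by (subst one_minus_lambert_var) simp_all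
  thus "(w - 2 + 1 / w) * lambert_var q n \<noteq> 1"
    by auto
qed

text \<open>The factor 1 / (1 - w q^(-n)) is bounded in n: it tends to 1 as n -> -infinity and to 0
  as n -> infinity. The decay of the theta coefficients does the rest.\<close>

lemma summable_appell:
  assumes q: "q \<noteq> 0" "norm q < 1" and w: "theta_good q w"
  shows "(\<lambda>n. theta_coeff q n / (1 - w * q powi (- n))) summable_on UNIV"
proof -
  have lim: "(\<lambda>m. q ^ m) \<longlonglongrightarrow> 0"
    using q by (intro LIMSEQ_power_zero) auto
  have "(\<lambda>m. 1 / (1 - w * q ^ m)) \<longlonglongrightarrow> 1 / (1 - w * 0)"
    by (intro tendsto_intros lim) auto
  hence "Bseq (\<lambda>m. 1 / (1 - w * q ^ m))"
    using convergentI convergent_imp_Bseq by blast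
  then obtain C1 where C1: "\<And>m. norm (1 / (1 - w * q ^ m)) \<le> C1"
    by (auto simp: Bseq_def)
  have "(\<lambda>m. q ^ m / (q ^ m - w)) \<longlonglongrightarrow> 0 / (0 - w)"
    using theta_goodD[OF w q(1)] by (intro tendsto_intros lim) auto
  hence "Bseq (\<lambda>m. q ^ m / (q ^ m - w))"
    using convergentI convergent_imp_Bseq by blast
  then obtain C2 where C2: "\<And>m. norm (q ^ m / (q ^ m - w)) \<le> C2"
    by (auto simp: Bseq_def)
  define C where "C = max C1 C2"
  have C: "norm (1 / (1 - w * q powi (- n))) \<le> C" for n :: int
  proof (cases "n \<ge> 0")
    case True
    define m where "m = nat n"
    have m: "q powi n = q ^ m"
      using True by (simp add: m_def power_int_def)
    have "q ^ m \<noteq> w"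
      using theta_goodD(3)[OF w q(1), of n] m by simp
    moreover have "1 - w * inverse (q ^ m) = (q ^ m - w) / q ^ m"
      using q by (simp add: field_simps)
    ultimately have "1 / (1 - w * q powi (- n)) = q ^ m / (q ^ m - w)"
      using q by (simp add: power_int_minus m)
    thus ?thesis using C2[of m] by (simp add: C_def)
  next
    case False
    have "q powi (- n) = q ^ nat (- n)"
      using False by (simp add: power_int_def)
    thus ?thesis using C1[of "nat (- n)"] by (simp add: C_def)
  qed
  have C0: "C \<ge> 0" using C[of 0] norm_ge_zero order_trans by blast
  have "(\<lambda>n. C * norm q ^ (nat \<bar>n\<bar> - 1)) summable_on UNIV - {0}"
    using q by (intro summable_lambert_bound) auto
  moreover have "norm (theta_coeff q n / (1 - w * q powi (- n))) \<le> C * norm q ^ (nat \<bar>n\<bar> - 1)"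
    if "n \<in> UNIV - {0}" for n
  proof -
    have "norm (theta_coeff q n / (1 - w * q powi (- n))) =
        norm (theta_coeff q n) * norm (1 / (1 - w * q powi (- n)))"
      by (simp add: norm_divide)
    also have "\<dots> \<le> norm q ^ (nat \<bar>n\<bar> - 1) * C"
      using that q C C0 by (intro mult_mono norm_theta_coeff_le) auto
    finally show ?thesis by (simp add: mult.commute)
  qed
  ultimately have "(\<lambda>n. norm (theta_coeff q n / (1 - w * q powi (- n)))) summable_on UNIV - {0}"
    by (rule Infinite_Sum.abs_summable_on_comparison_test')
  hence "(\<lambda>n. theta_coeff q n / (1 - w * q powi (- n))) summable_on UNIV - {0}"
    by (rule abs_summable_summable)
  hence "(\<lambda>n. theta_coeff q n / (1 - w * q powi (- n))) summable_on (UNIV - {0}) \<union> {0}"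
    by (rule summable_on_union) simp
  thus ?thesis by simp
qed

text \<open>A sum over simple poles at w = q^n with theta coefficients; unlike
  \<open>lambert_gen\<close> it includes n = 0, which supplies the pole at w = 1.\<close>

definition appell :: "complex \<Rightarrow> complex \<Rightarrow> complex" where
  "appell q w = (\<Sum>\<^sub>\<infinity>n. theta_coeff q n / (1 - w * q powi (- n)))"

text \<open>Partial fractions in w with poles at x and 1/x. In the application x = q^n and b is the
  theta coefficient of n, so that b x is the one of -n.\<close>

lemma appell_pair_identity:
  fixes b x w :: complex
  assumes "w \<noteq> 0" "x \<noteq> w" "1 - w * x \<noteq> 0" "x \<noteq> 1" "x \<noteq> 0"
  shows "(b + b * x) * ((w - 2 + 1 / w) * (x / (1 - x) ^ 2) / ((1 - w * x) * (1 - x / w) / (1 - x) ^ 2)) =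
    - (1 - w) * (b / (1 - w / x) + b * x / (1 - w * x))"
proof -
  have eqs: "w - 2 + 1 / w = (1 - w) ^ 2 / w" "1 - x / w = (w - x) / w" "1 - w / x = (x - w) / x"
    using assms by (simp_all add: field_simps power2_eq_square)
  have nz: "1 - x \<noteq> 0" "w - x \<noteq> 0" "x - w \<noteq> 0" using assms by auto
  have "(b + b * x) * ((w - 2 + 1 / w) * (x / (1 - x) ^ 2) / ((1 - w * x) * (1 - x / w) / (1 - x) ^ 2))
      = b * (1 + x) * (1 - w) ^ 2 * x / ((1 - w * x) * (w - x))"
    unfolding eqs using assms nz by (simp add: field_simps)
  moreover have "b / (1 - w / x) + b * x / (1 - w * x) = - (b * (1 + x) * (1 - w) * x / ((1 - w * x) * (w - x)))"
  proof -
    have "b / (1 - w / x) = - (b * x / (w - x))"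
      unfolding eqs using assms nz by (simp add: divide_simps) (simp add: algebra_simps)
    hence "b / (1 - w / x) + b * x / (1 - w * x) = b * x / (1 - w * x) - b * x / (w - x)"
      by simp
    also have "\<dots> = (b * x * (w - x) - b * x * (1 - w * x)) / ((1 - w * x) * (w - x))"
      using assms nz by (simp add: diff_frac_eq mult_ac)
    also have "b * x * (w - x) - b * x * (1 - w * x) = - (b * (1 + x) * (1 - w) * x)"
      by (simp add: algebra_simps)
    finally show ?thesis by simp
  qed
  moreover have "- (1 - w) * - (b * (1 + x) * (1 - w) * x / ((1 - w * x) * (w - x))) =
      b * (1 + x) * (1 - w) ^ 2 * x / ((1 - w * x) * (w - x))"
    by (simp only: minus_mult_minus times_divide_eq_right power2_eq_square mult_ac)
  ultimately show ?thesis
    by (simp only:)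
qed

text \<open>
  The terms for \<open>n\<close> and \<open>- n\<close> of both series are combined: the two sides agree only
  after this symmetrisation.
\<close>
lemma lambert_gen_eq_appell:
  assumes q: "q \<noteq> 0" "norm q < 1" and w: "theta_good q w"
  shows "lambert_gen 0 q (w - 2 + 1 / w) = - (1 - w) * appell q w"
proof -
  define s where "s = w - 2 + 1 / w"
  define h where "h = (\<lambda>n. theta_coeff q n / (1 - w * q powi (- n)))"
  define f where "f = (\<lambda>n. s * (theta_coeff q n * lambert_var q n / (1 - s * lambert_var q n)))"
  have good: "lambert_good q s"
    unfolding s_def by (rule theta_good_imp_lambert_good[OF q w])
  have h: "h summable_on UNIV"
    unfolding h_def by (rule summable_appell[OF q w])
  have h': "h summable_on UNIV - {0}"
    by (rule summable_on_subset_banach[OF h]) auto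
  have f: "f summable_on UNIV - {0}"
    unfolding f_def using summable_lambert_gen[OF q good, of 1]
    by (intro summable_on_cmult_right) simp
  have refl: "infsum g (UNIV - {0}) = (\<Sum>\<^sub>\<infinity>n\<in>UNIV - {0}. g (- n))" for g :: "int \<Rightarrow> complex"
    by (rule infsum_reindex_bij_witness[of _ uminus uminus]) auto
  have refl': "(\<lambda>n. g (- n)) summable_on UNIV - {0}" if "g summable_on UNIV - {0}" for g :: "int \<Rightarrow> complex"
    using summable_on_reindex_bij_witness[of "UNIV - {0}" uminus uminus "UNIV - {0}" g "\<lambda>n. g (- n)"] that
    by auto
  have "2 * infsum f (UNIV - {0}) = (\<Sum>\<^sub>\<infinity>n\<in>UNIV - {0}. f n + f (- n))"
    using infsum_add[OF f refl'[OF f]] refl[of f] by simp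
  also have "\<dots> = (\<Sum>\<^sub>\<infinity>n\<in>UNIV - {0}. - (1 - w) * (h n + h (- n)))"
  proof (rule infsum_cong)
    fix n :: int assume n: "n \<in> UNIV - {0}"
    define x where "x = q powi n"
    have x: "x \<noteq> 0" "x \<noteq> 1" "x \<noteq> w" "1 - w * x \<noteq> 0"
      using theta_goodD(2,3)[OF w q(1), of n] power_int_neq_1[of q n] n q by (auto simp: x_def)
    have "f n + f (- n) = (theta_coeff q n + theta_coeff q n * x) *
        (s * (x / (1 - x) ^ 2) / ((1 - w * x) * (1 - x / w) / (1 - x) ^ 2))"
    proof -
      have "1 - s * lambert_var q n = (1 - w * x) * (1 - x / w) / (1 - x) ^ 2"
        unfolding s_def x_def
        by (rule one_minus_lambert_var) (use theta_goodD(1)[OF w q(1)] x in \<open>auto simp: x_def\<close>)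
      moreover have "lambert_var q n = x / (1 - x) ^ 2"
        by (simp add: lambert_var_def x_def)
      moreover have "f n + f (- n) = (theta_coeff q n + theta_coeff q n * x) *
          (s * lambert_var q n / (1 - s * lambert_var q n))"
        unfolding f_def lambert_var_minus[OF q(1)] theta_coeff_simps(2)[OF q(1)] x_def
        by (simp add: add_divide_distrib ring_distribs mult_ac)
      ultimately show ?thesis by (simp only:)
    qed
    also have "\<dots> = - (1 - w) * (theta_coeff q n / (1 - w / x) + theta_coeff q n * x / (1 - w * x))"
      unfolding s_def by (rule appell_pair_identity) (use x theta_goodD[OF w q(1)] in auto)
    also have "\<dots> = - (1 - w) * (h n + h (- n))"
      using q by (simp add: h_def x_def theta_coeff_simps power_int_minus divide_inverse)
    finally show "f n + f (- n) = - (1 - w) * (h n + h (- n))" .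
  qed
  also have "\<dots> = - (1 - w) * (2 * infsum h (UNIV - {0}))"
    using infsum_add[OF h' refl'[OF h']] refl[of h] by (simp add: infsum_cmult_right')
  finally have "infsum f (UNIV - {0}) = - (1 - w) * infsum h (UNIV - {0})"
    by simp
  \<comment> \<open>Splitting off the value 1 at s = 0 turns 1 / (1 - s X) into s X / (1 - s X).
    This 1 cancels against the term n = 0 of \<open>appell\<close>, which is -1 / (1 - w).\<close>
  moreover have "lambert_gen 0 q s = 1 + infsum f (UNIV - {0})"
  proof -
    have "infsum f (UNIV - {0}) = s * lambert_gen (Suc 0) q s"
      unfolding f_def infsum_cmult_right' by (simp add: lambert_gen_def)
    thus ?thesis
      using lambert_gen_Suc[OF q good, of 0] lambert_gen_0_0[OF q] by simp
  qed
  moreover have "infsum h (UNIV - {0}) = appell q w + 1 / (1 - w)"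
    using infsum_UNIV_minus_0[OF h] by (simp add: appell_def h_def)
  moreover have "(1 - w) * (appell q w + 1 / (1 - w)) = (1 - w) * appell q w + 1"
    using theta_goodD(4)[OF w q(1)] by (simp add: distrib_left)
  ultimately show ?thesis
    unfolding s_def by (metis add.commute add_uminus_conv_diff minus_add_cancel minus_add_distrib mult_minus_left)
qed

text \<open>After the shift n -> n + 1, the identity x / (1 - w/x) = x + w / (1 - w/x) with x = q^n
  splits off a multiple of the original term; the leftover is the complete theta sum, which is
  0.\<close>

lemma appell_mult_q:
  assumes q: "q \<noteq> 0" "norm q < 1" and w: "theta_good q w"
  shows "appell q (w * q) = - w * appell q w"
proof -
  have "appell q (w * q) = (\<Sum>\<^sub>\<infinity>n. theta_coeff q (n + 1) / (1 - w * q * q powi (- (n + 1))))"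
    unfolding appell_def by (rule infsum_reindex_bij_witness[of _ "\<lambda>n. n + 1" "\<lambda>n. n - 1"]) auto
  also have "\<dots> = (\<Sum>\<^sub>\<infinity>n. theta_coeff q (n + 1) + - w * (theta_coeff q n / (1 - w * q powi (- n))))"
  proof (rule infsum_cong)
    fix n :: int
    define x where "x = q powi n"
    have x: "x \<noteq> 0" "x \<noteq> w"
      using theta_goodD(3)[OF w q(1), of n] q by (auto simp: x_def)
    have "q powi (n + 1) = x * q"
      using q by (simp add: x_def power_int_add)
    hence e: "q * q powi (- (n + 1)) = 1 / x" "q powi (- n) = 1 / x"
      using q by (simp_all only: power_int_minus) (simp_all add: x_def field_simps)
    have "x / (1 - w * (1 / x)) = x + w * (1 / (1 - w * (1 / x)))"
      using x by (simp add: divide_simps) (simp add: algebra_simps)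
    hence "- (theta_coeff q n * x / (1 - w * (1 / x))) = - (theta_coeff q n * (x + w * (1 / (1 - w * (1 / x)))))"
      by (metis times_divide_eq_right)
    thus "theta_coeff q (n + 1) / (1 - w * q * q powi (- (n + 1))) =
        theta_coeff q (n + 1) + - w * (theta_coeff q n / (1 - w * q powi (- n)))"
      unfolding theta_coeff_simps(1)[OF q(1)] mult.assoc e by (simp add: x_def ring_distribs mult_ac)
  qed
  also have "\<dots> = (\<Sum>\<^sub>\<infinity>n. theta_coeff q (n + 1)) + - w * appell q w"
    unfolding appell_def
  proof (subst infsum_add)
    show "(\<lambda>n. theta_coeff q (n + 1)) summable_on UNIV"
      using summable_on_reindex_bij_witness[of UNIV "\<lambda>n. n - 1" "\<lambda>n. n + 1" UNIV "theta_coeff q" "\<lambda>n. theta_coeff q (n + 1)"]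
        summable_theta_coeff[OF q] by auto
    show "(\<lambda>n. - w * (theta_coeff q n / (1 - w * q powi (- n)))) summable_on UNIV"
      by (intro summable_on_cmult_right summable_appell q w)
  qed (simp only: infsum_cmult_right')
  also have "(\<Sum>\<^sub>\<infinity>n. theta_coeff q (n + 1)) = infsum (theta_coeff q) UNIV"
    by (rule infsum_reindex_bij_witness[of _ "\<lambda>n. n - 1" "\<lambda>n. n + 1"]) auto
  finally show ?thesis
    by (simp add: infsum_theta_coeff[OF q])
qed

text \<open>The multiplier -1/w is the inverse of the multiplier -w of \<open>appell\<close>, so the
  product of the two functions is invariant under w -> w q.\<close>

lemma theta_product_mult_q:
  assumes q: "q \<noteq> 0" "norm q < 1" and w: "w \<noteq> 0" "w \<noteq> 1"
  shows "qpoch_inf (w * q) q * qpoch_inf (q / (w * q)) q =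
    - (qpoch_inf w q * qpoch_inf (q / w) q) / w"
proof -
  have "q / (w * q) = 1 / w" "1 / w * q = q / w"
    using q(1) by simp_all
  hence 1: "qpoch_inf (q / (w * q)) q = (1 - 1 / w) * qpoch_inf (q / w) q"
    using qpoch_inf_rec[OF q(2), of "1 / w"] by (simp only:)
  have 2: "qpoch_inf (w * q) q = qpoch_inf w q / (1 - w)"
    using w qpoch_inf_rec[OF q(2), of w] by simp
  have "a / (1 - w) * ((1 - 1 / w) * b) = - (a * b) / w" for a b
  proof -
    have "1 - 1 / w = - (1 - w) / w" using w by (simp add: field_simps)
    moreover have "a / c * (- c / w * b) = - (a * b) / w" if "c \<noteq> 0" for c
      using that w by (simp add: field_simps)
    from this[of "1 - w"] have "a / (1 - w) * (- (1 - w) / w * b) = - (a * b) / w"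
      using w by simp
    ultimately show ?thesis by (simp only:)
  qed
  thus ?thesis
    by (simp only: 1 2)
qed

section \<open>The normalised theta function\<close>

definition e2pi :: "complex \<Rightarrow> complex" where
  "e2pi u = exp (2 * of_real pi * \<i> * u)"

lemma e2pi_nonzero [simp]: "e2pi u \<noteq> 0"
  by (simp add: e2pi_def)

lemma e2pi_0 [simp]: "e2pi 0 = 1"
  by (simp add: e2pi_def)

lemma e2pi_add: "e2pi (u + v) = e2pi u * e2pi v"
  by (simp add: e2pi_def ring_distribs exp_add)

lemma e2pi_diff: "e2pi (u - v) = e2pi u / e2pi v"
  by (simp add: e2pi_def ring_distribs exp_diff)

lemma e2pi_minus: "e2pi (- u) = 1 / e2pi u"
  using e2pi_diff[of 0 u] by simp

lemma e2pi_of_int [simp]: "e2pi (of_int n) = 1"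
  unfolding e2pi_def exp_eq_1 by (auto intro: exI[of _ n])

lemma e2pi_1 [simp]: "e2pi 1 = 1"
  using e2pi_of_int[of 1] by simp

lemma e2pi_of_int_mult: "e2pi (of_int n * z) = e2pi z powi n"
proof -
  have "2 * of_real pi * \<i> * (of_int n * z) = of_int n * (2 * of_real pi * \<i> * z)"
    by simp
  thus ?thesis
    unfolding e2pi_def by (simp only: exp_power_int)
qed

lemma norm_e2pi: "norm (e2pi u) = exp (- (2 * pi * Im u))"
  by (simp add: e2pi_def)

lemma norm_e2pi_less_1: "Im z > 0 \<Longrightarrow> norm (e2pi z) < 1"
  by (simp add: norm_e2pi)

lemma e2pi_eq_1_iff: "e2pi u = 1 \<longleftrightarrow> (\<exists>n. u = of_int n)"
proof
  assume "e2pi u = 1"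
  then obtain n :: int where "Re (2 * of_real pi * \<i> * u) = 0" "Im (2 * of_real pi * \<i> * u) = of_int (2 * n) * pi"
    unfolding e2pi_def exp_eq_1 by auto
  hence "u = of_int n" by (simp add: complex_eq_iff)
  thus "\<exists>n. u = of_int n" by blast
qed auto

lemma holomorphic_on_e2pi [holomorphic_intros]:
  "f holomorphic_on S \<Longrightarrow> (\<lambda>u. e2pi (f u)) holomorphic_on S"
  unfolding e2pi_def by (intro holomorphic_intros)

lemma theta_good_e2pi:
  assumes "u \<notin> period_lattice z"
  shows "theta_good (e2pi z) (e2pi u)"
  unfolding theta_good_def
proof (intro conjI allI)
  fix n :: int
  show "e2pi u * e2pi z powi n \<noteq> 1"
  proof
    assume "e2pi u * e2pi z powi n = 1"
    hence "e2pi (u + of_int n * z) = 1"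
      by (simp add: e2pi_add e2pi_of_int_mult)
    then obtain m :: int where "u + of_int n * z = of_int m"
      by (auto simp: e2pi_eq_1_iff)
    hence "u = of_int (- n) * z + of_int m"
      by (simp add: algebra_simps)
    thus False
      using assms by (simp only: period_latticeI not_True_eq_False)
  qed
qed auto

text \<open>As a function of u the left side is elliptic with singularities at most on the lattice.
  With (w q) in place of (w) the zero at w = 1 is taken out, so the constant can be read off at u =
  0, where s = 0 and the Lambert series is 1.\<close>

theorem lambert_gen_theta_product:
  assumes z: "Im z > 0" and u: "u \<notin> period_lattice z"
  defines "q \<equiv> e2pi z"
  shows "lambert_gen 0 q (e2pi u - 2 + 1 / e2pi u) *
    (qpoch_inf (e2pi u * q) q * qpoch_inf (q / e2pi u) q) = qpoch_inf q q * qpoch_inf q q"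
proof -
  have q: "q \<noteq> 0" "norm q < 1"
    using norm_e2pi_less_1[OF z] by (simp_all add: q_def)
  define s where "s = (\<lambda>u. e2pi u - 2 + 1 / e2pi u)"
  define f where "f = (\<lambda>u. lambert_gen 0 q (s u) * (qpoch_inf (e2pi u * q) q * qpoch_inf (q / e2pi u) q))"
  have s_hol: "s holomorphic_on A" for A
    unfolding s_def by (intro holomorphic_intros) auto
  have prod_hol: "(\<lambda>u. qpoch_inf (e2pi u * q) q * qpoch_inf (q / e2pi u) q) holomorphic_on A" for A
    by (intro holomorphic_intros q) auto
  have lam_hol: "lambert_gen 0 q holomorphic_on {s. lambert_good q s}"
    unfolding holomorphic_on_def
    using lambert_gen_differentiable[OF q] field_differentiable_at_within by blast
  have good: "lambert_good q (s v)" if "v \<notin> period_lattice z" for v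
    unfolding s_def by (rule theta_good_imp_lambert_good[OF q]) (use that theta_good_e2pi in \<open>auto simp: q_def\<close>)
  \<comment> \<open>The factor 1 - w from \<open>lambert_gen_eq_appell\<close> completes (w q) to
    (w); in this form the multipliers of both factors under v -> v + z are known.\<close>
  have f_eq: "f v = - (appell q (e2pi v) * (qpoch_inf (e2pi v) q * qpoch_inf (q / e2pi v) q))"
    if "v \<notin> period_lattice z" for v
  proof -
    have "theta_good q (e2pi v)"
      using theta_good_e2pi[OF that] by (simp add: q_def)
    from lambert_gen_eq_appell[OF q this] show ?thesis
      unfolding f_def s_def qpoch_inf_rec[OF q(2), of "e2pi v"] by (simp only: mult_ac mult_minus_left mult_minus_right)
  qed
  have "f u = qpoch_inf q q * qpoch_inf q q"
  proof (rule elliptic_constant[OF z _ _ _ _ u])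
    have "(lambert_gen 0 q \<circ> s) holomorphic_on - period_lattice z"
      by (rule holomorphic_on_compose_gen[OF s_hol lam_hol]) (use good in auto)
    thus "f holomorphic_on - period_lattice z"
      unfolding f_def by (intro holomorphic_on_mult prod_hol[THEN holomorphic_on_subset]) (auto simp: o_def)
  next
    fix v assume v: "v \<notin> period_lattice z"
    show "f (v + 1) = f v"
      by (simp add: f_def s_def e2pi_add)
    have good_v: "theta_good q (e2pi v)"
      using theta_good_e2pi[OF v] by (simp add: q_def)
    have "f (v + z) = - (appell q (e2pi v * q) * (qpoch_inf (e2pi v * q) q * qpoch_inf (q / (e2pi v * q)) q))"
      using f_eq[of "v + z"] v by (simp add: e2pi_add flip: q_def)
    also have "\<dots> = f v"
      unfolding f_eq[OF v] appell_mult_q[OF q good_v]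
        theta_product_mult_q[OF q theta_goodD(1,4)[OF good_v q(1)]]
      by simp
    finally show "f (v + z) = f v" .
  next
    have "isCont (lambert_gen 0 q) (s 0)"
      by (intro field_differentiable_imp_continuous_at lambert_gen_differentiable q) (simp add: s_def)
    moreover have "isCont s 0"
      using s_hol[of UNIV] holomorphic_on_imp_continuous_on continuous_on_eq_continuous_at open_UNIV by blast
    ultimately have "isCont (\<lambda>v. lambert_gen 0 q (s v)) 0"
      using isCont_o2 by blast
    moreover have "isCont (\<lambda>v. qpoch_inf (e2pi v * q) q * qpoch_inf (q / e2pi v) q) 0"
      using holomorphic_on_imp_continuous_on[OF prod_hol[of UNIV]] by (simp add: continuous_on_eq_continuous_at)
    ultimately have "isCont f 0"
      unfolding f_def by (rule isCont_mult)
    moreover have "f 0 = qpoch_inf q q * qpoch_inf q q"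
      by (simp add: f_def s_def lambert_gen_0_0[OF q])
    ultimately show "(f \<longlongrightarrow> qpoch_inf q q * qpoch_inf q q) (at 0)"
      by (simp add: isCont_def)
  qed
  thus ?thesis
    by (simp add: f_def s_def)
qed

section \<open>The Jacobi form phi: quasi-periods, zeros and modular transformation\<close>

lemma e2pi_half_of_int: "e2pi (of_int k / 2) = (-1) powi k"
proof -
  have "exp (of_int k * (\<i> * of_real pi)) = exp (\<i> * of_real pi) powi k"
    by (rule exp_power_int [symmetric])
  also have "exp (\<i> * of_real pi) = -1"
    by simp
  finally show ?thesis
    by (simp add: e2pi_def mult_ac)
qed

text \<open>Up to a constant this is theta_1(u) / eta^3, in which the factors q^(1/8) cancel. The
  prefactor \<open>e2pi (- u / 2)\<close> fixes the branch of w^(-1/2), which makes it a function of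
  u and not of w.\<close>

definition jacobi_phi :: "complex \<Rightarrow> complex \<Rightarrow> complex" where
  "jacobi_phi z u = e2pi (- u / 2) * (qpoch_inf (e2pi u) (e2pi z) * qpoch_inf (e2pi z / e2pi u) (e2pi z))
     / qpoch_inf (e2pi z) (e2pi z) ^ 2"

lemma qpoch_inf_self_nonzero:
  assumes "Im z > 0"
  shows "qpoch_inf (e2pi z) (e2pi z) \<noteq> 0"
  using norm_e2pi_less_1[OF assms] by (intro qpoch_inf_nonzero')

lemma jacobi_phi_add_1: "jacobi_phi z (u + 1) = - jacobi_phi z u"
proof -
  have "e2pi (- (u + 1) / 2) = e2pi (- u / 2) * e2pi (of_int (- 1) / 2)"
    unfolding e2pi_add[symmetric] by (rule arg_cong[of _ _ e2pi]) (simp add: field_simps)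
  also have "\<dots> = - e2pi (- u / 2)"
    unfolding e2pi_half_of_int by (simp add: power_int_minus)
  finally show ?thesis
    by (simp add: jacobi_phi_def e2pi_add)
qed

lemma jacobi_phi_add_period:
  assumes z: "Im z > 0"
  shows "jacobi_phi z (u + z) = - e2pi (- (z / 2 + u)) * jacobi_phi z u"
proof -
  have q: "e2pi z \<noteq> 0" "norm (e2pi z) < 1"
    using norm_e2pi_less_1[OF z] by simp_all
  have "qpoch_inf (e2pi u * e2pi z) (e2pi z) * qpoch_inf (e2pi z / (e2pi u * e2pi z)) (e2pi z) =
    - (qpoch_inf (e2pi u) (e2pi z) * qpoch_inf (e2pi z / e2pi u) (e2pi z)) / e2pi u"
  \<comment> \<open>\<open>theta_product_mult_q\<close> excludes w = 1; there both sides contain the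
    factor (1; q) = 0.\<close>
  proof (cases "e2pi u = 1")
    case True
    thus ?thesis
      using qpoch_inf_rec[OF q(2), of 1] by simp
  next
    case False
    show ?thesis
      by (rule theta_product_mult_q[OF q _ False]) simp
  qed
  moreover have "e2pi (- (u + z) / 2) = e2pi (- (z / 2 + u)) * e2pi u * e2pi (- u / 2)"
  proof -
    have "- (u + z) / 2 = - (z / 2 + u) + u + - u / 2" by (simp add: field_simps)
    thus ?thesis by (simp only: e2pi_add)
  qed
  ultimately show ?thesis
    by (simp add: jacobi_phi_def e2pi_add)
qed

text \<open>The quadratic exponent m^2 z / 2 expresses the index 1/2. The integer n is added after m
  z and contributes only a sign, so no mixed term in m and n appears.\<close>

lemma jacobi_phi_add_lattice:
  assumes z: "Im z > 0"
  shows "jacobi_phi z (u + of_int m * z + of_int n) =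
    (-1) powi (m + n) * e2pi (- (of_int m ^ 2 * z / 2 + of_int m * u)) * jacobi_phi z u"
proof -
  have n: "jacobi_phi z (v + of_int n) = (-1) powi n * jacobi_phi z v" for v n
  proof (induction n rule: int_induct[where k = 0])
    case (step1 n)
    show ?case
      using jacobi_phi_add_1[of z "v + of_int n"] step1 by (simp add: power_int_add add.assoc)
  next
    case (step2 n)
    show ?case
      using jacobi_phi_add_1[of z "v + of_int (n - 1)"] step2 by (simp add: power_int_diff)
  qed simp
  have m: "jacobi_phi z (u + of_int m * z) =
      (-1) powi m * e2pi (- (of_int m ^ 2 * z / 2 + of_int m * u)) * jacobi_phi z u" for m
  proof (induction m rule: int_induct[where k = 0])
    case (step1 m)
    have "jacobi_phi z (u + of_int (m + 1) * z) = - e2pi (- (z / 2 + (u + of_int m * z))) * jacobi_phi z (u + of_int m * z)"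
      using jacobi_phi_add_period[OF z, of "u + of_int m * z"] by (simp add: algebra_simps)
    also have "\<dots> = (-1) powi (m + 1) *
        (e2pi (- (z / 2 + (u + of_int m * z))) * e2pi (- (of_int m ^ 2 * z / 2 + of_int m * u))) * jacobi_phi z u"
      unfolding step1 by (simp add: power_int_add)
    also have "e2pi (- (z / 2 + (u + of_int m * z))) * e2pi (- (of_int m ^ 2 * z / 2 + of_int m * u)) =
        e2pi (- (of_int (m + 1) ^ 2 * z / 2 + of_int (m + 1) * u))"
      unfolding e2pi_add[symmetric] by (rule arg_cong[of _ _ e2pi]) (simp add: field_simps power2_eq_square)
    finally show ?case .
  next
    case (step2 m)
    have "- e2pi (- (z / 2 + (u + of_int (m - 1) * z))) * jacobi_phi z (u + of_int (m - 1) * z) =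
        jacobi_phi z (u + of_int m * z)"
      using jacobi_phi_add_period[OF z, of "u + of_int (m - 1) * z"] by (simp add: algebra_simps)
    moreover have "a = - b / e" if "- e * a = b" "e \<noteq> 0" for a b e :: complex
      using that by auto
    ultimately have "jacobi_phi z (u + of_int (m - 1) * z) =
        - jacobi_phi z (u + of_int m * z) / e2pi (- (z / 2 + (u + of_int (m - 1) * z)))"
      using e2pi_nonzero by blast
    also have "\<dots> = (-1) powi (m - 1) * (e2pi (- (of_int m ^ 2 * z / 2 + of_int m * u))
        / e2pi (- (z / 2 + (u + of_int (m - 1) * z)))) * jacobi_phi z u"
      unfolding step2 by (simp add: power_int_diff)
    also have "e2pi (- (of_int m ^ 2 * z / 2 + of_int m * u)) / e2pi (- (z / 2 + (u + of_int (m - 1) * z))) =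
        e2pi (- (of_int (m - 1) ^ 2 * z / 2 + of_int (m - 1) * u))"
      unfolding e2pi_diff[symmetric] by (rule arg_cong[of _ _ e2pi]) (simp add: field_simps power2_eq_square)
    finally show ?case .
  qed simp
  show ?thesis
    unfolding n m by (simp add: power_int_add)
qed

lemma jacobi_phi_nonzero:
  assumes z: "Im z > 0" and u: "u \<notin> period_lattice z"
  shows "jacobi_phi z u \<noteq> 0"
proof -
  have q: "e2pi z \<noteq> 0" "norm (e2pi z) < 1"
    using norm_e2pi_less_1[OF z] by simp_all
  have w: "theta_good (e2pi z) (e2pi u)"
    by (rule theta_good_e2pi[OF u])
  have "qpoch_inf (e2pi u) (e2pi z) \<noteq> 0"
    using theta_goodD(2)[OF w q(1), of "int _"] by (intro qpoch_inf_nonzero q) auto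
  moreover have "qpoch_inf (e2pi z / e2pi u) (e2pi z) \<noteq> 0"
  proof (rule qpoch_inf_nonzero[OF q(2)])
    show "e2pi z / e2pi u * e2pi z ^ k \<noteq> 1" for k
      using theta_goodD(3)[OF w q(1), of "int (Suc k)"] by (simp add: field_simps del: of_nat_Suc)
  qed
  ultimately show ?thesis
    using qpoch_inf_self_nonzero[OF z] by (simp add: jacobi_phi_def)
qed

lemma holomorphic_on_jacobi_phi:
  assumes z: "Im z > 0"
  shows "jacobi_phi z holomorphic_on A"
  unfolding jacobi_phi_def
  by (intro holomorphic_intros norm_e2pi_less_1 z) (use qpoch_inf_self_nonzero[OF z] in auto)

lemma holomorphic_on_jacobi_phi':
  assumes z: "Im z > 0" and f: "f holomorphic_on A"
  shows "(\<lambda>u. jacobi_phi z (f u)) holomorphic_on A"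
  using holomorphic_on_compose_gen[OF f holomorphic_on_jacobi_phi[OF z, of UNIV]] by (simp add: o_def)

text \<open>This is -2 i sin(pi u), a square root of s = w - 2 + 1/w that is single-valued in
  u.\<close>

definition sine_kernel :: "complex \<Rightarrow> complex" where
  "sine_kernel u = e2pi (- u / 2) - e2pi (u / 2)"

lemma sine_kernel_squared: "sine_kernel u ^ 2 = e2pi u - 2 + 1 / e2pi u"
proof -
  have "e2pi (- u / 2) * e2pi (- u / 2) = 1 / e2pi u" "e2pi (u / 2) * e2pi (u / 2) = e2pi u"
    "e2pi (- u / 2) * e2pi (u / 2) = 1"
    unfolding e2pi_add[symmetric] by (simp_all add: e2pi_minus)
  thus ?thesis
    by (simp add: sine_kernel_def power2_eq_square algebra_simps)
qed

text \<open>Separates the simple zero at u = 0 from a factor that equals 1 there; limits at u = 0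
  then concern the sine alone.\<close>

lemma jacobi_phi_eq_sine_kernel:
  assumes z: "Im z > 0"
  shows "jacobi_phi z u = sine_kernel u *
    (qpoch_inf (e2pi u * e2pi z) (e2pi z) * qpoch_inf (e2pi z / e2pi u) (e2pi z) / qpoch_inf (e2pi z) (e2pi z) ^ 2)"
proof -
  have "e2pi (- u / 2) * (1 - e2pi u) = sine_kernel u"
    using e2pi_add[of "- u / 2" u] by (simp add: sine_kernel_def algebra_simps)
  thus ?thesis
    unfolding jacobi_phi_def qpoch_inf_rec[OF norm_e2pi_less_1[OF z], of "e2pi u"]
    by (metis (no_types, opaque_lifting) mult.assoc times_divide_eq_right)
qed

lemma lambert_gen_jacobi_phi:
  assumes z: "Im z > 0" and u: "u \<notin> period_lattice z"
  shows "lambert_gen 0 (e2pi z) (sine_kernel u ^ 2) * jacobi_phi z u = sine_kernel u"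
proof -
  have "lambert_gen 0 (e2pi z) (sine_kernel u ^ 2) *
      (qpoch_inf (e2pi u * e2pi z) (e2pi z) * qpoch_inf (e2pi z / e2pi u) (e2pi z)) =
      qpoch_inf (e2pi z) (e2pi z) ^ 2"
    by (rule lambert_gen_theta_product[OF z u, folded sine_kernel_squared power2_eq_square])
  thus ?thesis
    using qpoch_inf_self_nonzero[OF z] unfolding jacobi_phi_eq_sine_kernel[OF z]
    by (simp add: divide_simps)
qed

lemma sine_kernel_deriv:
  assumes "k \<noteq> 0"
  shows "((\<lambda>u. sine_kernel (u / k)) has_field_derivative - (2 * of_real pi * \<i>) / k) (at 0)"
  unfolding sine_kernel_def e2pi_def
  using assms by (auto intro!: derivative_eq_intros simp: field_simps)

lemma sine_kernel_ratio_tendsto: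
  assumes "k \<noteq> 0"
  shows "((\<lambda>u. sine_kernel (u / k) / sine_kernel u) \<longlongrightarrow> 1 / k) (at 0)"
proof -
  have "((\<lambda>u. sine_kernel (u / k) / u / (sine_kernel u / u)) \<longlongrightarrow>
      (- (2 * of_real pi * \<i>) / k) / (- (2 * of_real pi * \<i>))) (at 0)"
  proof (rule tendsto_divide)
    show "((\<lambda>u. sine_kernel (u / k) / u) \<longlongrightarrow> - (2 * of_real pi * \<i>) / k) (at 0)"
      using sine_kernel_deriv[OF assms] by (simp add: has_field_derivative_iff sine_kernel_def)
    show "((\<lambda>u. sine_kernel u / u) \<longlongrightarrow> - (2 * of_real pi * \<i>)) (at 0)"
      using sine_kernel_deriv[of 1] by (simp add: has_field_derivative_iff sine_kernel_def)
  qed simp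
  moreover have "eventually (\<lambda>u. sine_kernel (u / k) / u / (sine_kernel u / u) = sine_kernel (u / k) / sine_kernel u) (at 0)"
    using eventually_neq_at_within[of 0 0 UNIV] by eventually_elim simp
  ultimately show ?thesis
    using Lim_transform_eventually by fastforce
qed

text \<open>For an arbitrary matrix, the quotient R of the two sides (up to 1/J) is elliptic in u
  with removable singularities, and its constant value is the limit 1/J of sin(pi u/J) / sin(pi u)
  at 0.\<close>

lemma jacobi_phi_modular:
  fixes a b c d :: int
  assumes z: "Im z > 0" and det: "a * d - b * c = 1" and u: "u \<notin> period_lattice z"
  defines "J \<equiv> of_int c * z + of_int d"
  defines "z' \<equiv> (of_int a * z + of_int b) / J"
  assumes z': "Im z' > 0" and J: "J \<noteq> 0"
  shows "jacobi_phi z' (u / J) = e2pi (of_int c * u ^ 2 / (2 * J)) * jacobi_phi z u / J"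
proof -
  define E where "E = (\<lambda>u. e2pi (- (of_int c * u ^ 2 / (2 * J))))"
  define R where "R = (\<lambda>u. jacobi_phi z' (u / J) * E u / jacobi_phi z u)"
  have det': "of_int a * of_int d - of_int b * of_int c = (1 :: complex)"
    using arg_cong[OF det, of "of_int :: int \<Rightarrow> complex"] by simp
  \<comment> \<open>Because the determinant is 1, the old periods 1 and z, divided by J, are
    integral combinations of z' and 1; hence the quasi-periods at z' apply to them.\<close>
  have J1: "1 / J = of_int a - of_int c * z'"
  proof -
    have "(of_int a - of_int c * z') * J = of_int a * J - of_int c * (of_int a * z + of_int b)"
      using J by (simp add: z'_def field_simps)
    also have "\<dots> = of_int a * of_int d - of_int b * of_int c"
      by (simp add: J_def algebra_simps)
    finally show ?thesis using J det' by (simp add: field_simps)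
  qed
  have Jz: "z / J = of_int d * z' - of_int b"
  proof -
    have "(of_int d * z' - of_int b) * J = of_int d * (of_int a * z + of_int b) - of_int b * J"
      using J by (simp add: z'_def field_simps)
    also have "\<dots> = (of_int a * of_int d - of_int b * of_int c) * z"
      by (simp add: J_def algebra_simps)
    finally show ?thesis using J det' by (simp add: field_simps)
  qed
  have sign_add: "(-1 :: complex) powi (k + l) = (-1) powi k * (-1) powi l" for k l :: int
    by (rule power_int_add) simp
  have R_1: "R (v + 1) = R v" for v
  proof -
    have "(v + 1) / J = v / J + of_int (- c) * z' + of_int a"
      using J1 by (simp add: add_divide_distrib)
    hence "jacobi_phi z' ((v + 1) / J) * E (v + 1) =
        (-1) powi (- c + a) * (e2pi (- (of_int (- c) ^ 2 * z' / 2 + of_int (- c) * (v / J))) * E (v + 1)) * jacobi_phi z' (v / J)"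
      by (simp only: jacobi_phi_add_lattice[OF z']) (simp only: mult_ac)
    also have "e2pi (- (of_int (- c) ^ 2 * z' / 2 + of_int (- c) * (v / J))) * E (v + 1) =
        e2pi (of_int (- (c * a)) / 2) * E v"
    proof -
      have "- (of_int (- c) ^ 2 * z' / 2 + of_int (- c) * (v / J)) + - (of_int c * (v + 1) ^ 2 / (2 * J))
          = - (of_int c * (of_int c * z' + 1 / J) / 2) + - (of_int c * v ^ 2 / (2 * J))"
        using J by (simp add: field_simps power2_eq_square)
      also have "of_int c * z' + 1 / J = of_int a"
        using J1 by simp
      finally show ?thesis
        unfolding E_def e2pi_add[symmetric] by simp
    qed
    also have "(-1) powi (- c + a) * (e2pi (of_int (- (c * a)) / 2) * E v) * jacobi_phi z' (v / J) =
        (-1) powi (- c + a + - (c * a)) * (E v * jacobi_phi z' (v / J))"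
      unfolding e2pi_half_of_int sign_add[of "- c + a"] by (simp only: mult_ac)
    \<comment> \<open>Modulo 2 the exponent is (1 + a) (1 + c) - 1. It is odd because a and c cannot
      both be even; the resulting -1 matches the sign of phi under u -> u + 1.\<close>
    also have "(-1 :: complex) powi (- c + a + - (c * a)) = -1"
    proof -
      have "odd (a * d - b * c)" using det by simp
      hence "odd (- c + a + - (c * a))" by auto
      thus ?thesis by (simp add: power_int_minus_left)
    qed
    finally show ?thesis
      by (simp add: R_def jacobi_phi_add_1 mult_ac)
  qed
  have R_z: "R (v + z) = R v" for v
  proof -
    have "(v + z) / J = v / J + of_int d * z' + of_int (- b)"
      using Jz by (simp add: add_divide_distrib)
    hence "jacobi_phi z' ((v + z) / J) * E (v + z) =
        (-1) powi (d + - b) * (e2pi (- (of_int d ^ 2 * z' / 2 + of_int d * (v / J))) * E (v + z)) * jacobi_phi z' (v / J)"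
      by (simp only: jacobi_phi_add_lattice[OF z']) (simp only: mult_ac)
    also have "e2pi (- (of_int d ^ 2 * z' / 2 + of_int d * (v / J))) * E (v + z) =
        e2pi (of_int (- (b * d)) / 2) * E v * e2pi (- (z / 2 + v))"
    proof -
      have "- (of_int d ^ 2 * z' / 2 + of_int d * (v / J)) + - (of_int c * (v + z) ^ 2 / (2 * J))
          = - (of_int d * (of_int d * z') + z * (of_int c * z / J)) / 2
            - v * ((of_int c * z + of_int d) / J) + - (of_int c * v ^ 2 / (2 * J))"
        using J by (simp add: field_simps power2_eq_square)
      also have "(of_int c * z + of_int d) / J = 1"
        using J by (simp add: J_def)
      also have "of_int d * z' = z / J + of_int b"
        using Jz by simp
      also have "of_int d * (z / J + of_int b) + z * (of_int c * z / J) = of_int (b * d) + z"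
      proof -
        have "of_int d * (z / J) + z * (of_int c * z / J) = z * ((of_int c * z + of_int d) / J)"
          by (simp add: add_divide_distrib ring_distribs mult_ac)
        also have "\<dots> = z"
          using J by (simp add: J_def)
        finally have "of_int d * (z / J) + z * (of_int c * z / J) = z" .
        thus ?thesis by (simp add: ring_distribs mult_ac add_ac)
      qed
      also have "- (of_int (b * d) + z) / 2 - v * 1 + - (of_int c * v ^ 2 / (2 * J)) =
          of_int (- (b * d)) / 2 + - (of_int c * v ^ 2 / (2 * J)) + - (z / 2 + v)"
        by (simp add: add_divide_distrib diff_divide_distrib)
      finally have "- (of_int d ^ 2 * z' / 2 + of_int d * (v / J)) + - (of_int c * (v + z) ^ 2 / (2 * J)) =
          of_int (- (b * d)) / 2 + - (of_int c * v ^ 2 / (2 * J)) + - (z / 2 + v)" .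
      thus ?thesis
        unfolding E_def e2pi_add[symmetric] by simp
    qed
    also have "(-1) powi (d + - b) * (e2pi (of_int (- (b * d)) / 2) * E v * e2pi (- (z / 2 + v))) * jacobi_phi z' (v / J) =
        (-1) powi (d + - b + - (b * d)) * (E v * e2pi (- (z / 2 + v)) * jacobi_phi z' (v / J))"
      unfolding e2pi_half_of_int sign_add[of "d + - b"] by (simp only: mult_ac)
    also have "(-1 :: complex) powi (d + - b + - (b * d)) = -1"
    proof -
      have "odd (a * d - b * c)" using det by simp
      hence "odd (d + - b + - (b * d))" by auto
      thus ?thesis by (simp add: power_int_minus_left)
    qed
    finally show ?thesis
      by (simp add: R_def jacobi_phi_add_period[OF z] mult_ac)
  qed
  have "R u = 1 / J"
  proof (rule elliptic_constant[OF z _ R_1 R_z _ u])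
    show "R holomorphic_on - period_lattice z"
      unfolding R_def E_def
      by (intro holomorphic_intros holomorphic_on_jacobi_phi' z z') (use J jacobi_phi_nonzero[OF z] in auto)
  next
    define T where "T = (\<lambda>z u. qpoch_inf (e2pi u * e2pi z) (e2pi z) *
      qpoch_inf (e2pi z / e2pi u) (e2pi z) / qpoch_inf (e2pi z) (e2pi z) ^ 2)"
    have T0: "T z 0 = 1" if "Im z > 0" for z
      using qpoch_inf_self_nonzero[OF that] by (simp add: T_def power2_eq_square)
    have T: "isCont (\<lambda>u. T z (u / k)) 0" if "Im z > 0" "k \<noteq> 0" for z k
    proof -
      have "(\<lambda>u. T z (u / k)) holomorphic_on UNIV"
        unfolding T_def
        by (intro holomorphic_intros norm_e2pi_less_1 that) (use that qpoch_inf_self_nonzero in auto)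
      from holomorphic_on_imp_continuous_on[OF this] show ?thesis
        by (simp add: continuous_on_eq_continuous_at)
    qed
    have E: "isCont E 0"
    proof -
      have "E holomorphic_on UNIV"
        unfolding E_def by (intro holomorphic_intros) (use J in auto)
      from holomorphic_on_imp_continuous_on[OF this] show ?thesis
        by (simp add: continuous_on_eq_continuous_at)
    qed
    have "((\<lambda>v. sine_kernel (v / J) / sine_kernel v * (T z' (v / J) * E v / T z (v / 1))) \<longlongrightarrow>
        1 / J * (T z' (0 / J) * E 0 / T z (0 / 1))) (at 0)"
      using T[OF z' J] T[OF z, of 1] E T0[OF z]
      by (intro tendsto_mult tendsto_divide sine_kernel_ratio_tendsto J) (auto simp: isCont_def)
    moreover have "1 / J * (T z' (0 / J) * E 0 / T z (0 / 1)) = 1 / J"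
      using T0[OF z] T0[OF z'] by (simp add: E_def)
    moreover have "(\<lambda>v. sine_kernel (v / J) / sine_kernel v * (T z' (v / J) * E v / T z (v / 1))) = R"
      by (simp add: R_def fun_eq_iff T_def jacobi_phi_eq_sine_kernel[OF z] jacobi_phi_eq_sine_kernel[OF z'] mult_ac)
    ultimately show "(R \<longlongrightarrow> 1 / J) (at 0)"
      by (simp only:)
  qed
  hence "jacobi_phi z' (u / J) * E u = jacobi_phi z u / J"
    using jacobi_phi_nonzero[OF z u] J by (simp add: R_def field_simps)
  moreover have "E u * e2pi (of_int c * u ^ 2 / (2 * J)) = 1"
    unfolding E_def e2pi_add[symmetric] by simp
  ultimately show ?thesis
    by (metis (no_types, opaque_lifting) mult.assoc mult.commute mult.right_neutral times_divide_eq_right)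
qed

unbundle no vec_syntax

section \<open>Laurent coefficients of the reciprocal theta function\<close>

definition gauss_fps :: "complex \<Rightarrow> complex fps" where
  "gauss_fps a = fps_compose (fps_exp a) (fps_X ^ 2)"

lemma gauss_fps_nth: "gauss_fps a $ n = (if even n then a ^ (n div 2) / fact (n div 2) else 0)"
proof -
  have "gauss_fps a $ n = (\<Sum>i = 0..n. a ^ i / fact i * (if n = 2 * i then 1 else 0))"
    by (simp add: gauss_fps_def fps_compose_nth fps_X_power_nth flip: power_mult)
  also have "\<dots> = (\<Sum>i = 0..n. if i = n div 2 \<and> even n then a ^ i / fact i else 0)"
    by (rule sum.cong) auto
  also have "\<dots> = (if even n then a ^ (n div 2) / fact (n div 2) else 0)"
    by (cases "even n") simp_all
  finally show ?thesis .
qed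

lemma gauss_fps_add: "gauss_fps (a + b) = gauss_fps a * gauss_fps b"
  by (simp add: gauss_fps_def fps_exp_add_mult fps_compose_mult_distrib)

lemma gauss_fps_compose_linear: "fps_compose (gauss_fps a) (fps_const k * fps_X) = gauss_fps (a * k ^ 2)"
proof (rule fps_ext)
  fix n
  show "fps_compose (gauss_fps a) (fps_const k * fps_X) $ n = gauss_fps (a * k ^ 2) $ n"
    by (auto simp: gauss_fps_nth power_mult_distrib simp flip: power_mult elim!: evenE)
qed

lemma has_fps_expansion_gauss: "(\<lambda>u. exp (a * u ^ 2)) has_fps_expansion gauss_fps a"
proof -
  have "((\<lambda>u. exp (a * u)) \<circ> (\<lambda>u. u ^ 2)) has_fps_expansion fps_compose (fps_exp a) (fps_X ^ 2)"
    by (intro has_fps_expansion_compose has_fps_expansion_exp has_fps_expansion_fps_X_power) simp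
  thus ?thesis by (simp add: o_def gauss_fps_def)
qed

definition sine_fps :: "complex fps" where
  "sine_fps = fps_exp (- (of_real pi * \<i>)) - fps_exp (of_real pi * \<i>)"

lemma has_fps_expansion_sine_kernel: "sine_kernel has_fps_expansion sine_fps"
proof -
  have "(\<lambda>u. exp (- (of_real pi * \<i>) * u) - exp (of_real pi * \<i> * u)) has_fps_expansion sine_fps"
    unfolding sine_fps_def by (intro has_fps_expansion_diff has_fps_expansion_exp)
  moreover have "(\<lambda>u. exp (- (of_real pi * \<i>) * u) - exp (of_real pi * \<i> * u)) = sine_kernel"
    by (simp add: fun_eq_iff sine_kernel_def e2pi_def mult.assoc)
  ultimately show ?thesis by simp
qed

lemma sine_fps_0 [simp]: "sine_fps $ 0 = 0"
  by (simp add: sine_fps_def)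

lemma sine_fps_1: "sine_fps $ 1 = - (2 * of_real pi * \<i>)"
  by (simp add: sine_fps_def)

lemma subdegree_sine_fps: "subdegree sine_fps = 1"
proof (rule subdegreeI)
  show "sine_fps $ 1 \<noteq> 0"
    unfolding sine_fps_1 by simp
qed auto

lemma sine_fps_nonzero [simp]: "sine_fps \<noteq> 0"
  using subdegree_sine_fps by auto

text \<open>The value at 0 fills the removable singularity, so that the function is analytic
  there.\<close>

definition sine_inv :: "complex \<Rightarrow> complex" where
  "sine_inv u = (if u = 0 then 1 / sine_fps $ 1 else u / sine_kernel u)"

definition sine_inv_fps :: "complex fps" where
  "sine_inv_fps = fps_X / sine_fps"

lemma has_fps_expansion_sine_inv: "sine_inv has_fps_expansion sine_inv_fps"
  unfolding sine_inv_fps_def sine_inv_def[abs_def]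
  by (rule has_fps_expansion_divide[OF has_fps_expansion_fps_X has_fps_expansion_sine_kernel])
     (simp_all add: subdegree_sine_fps)

lemma sine_inv_fps_mult: "sine_inv_fps * sine_fps = fps_X"
proof -
  have "sine_fps dvd fps_X"
    by (simp add: fps_dvd_iff subdegree_sine_fps)
  thus ?thesis
    unfolding sine_inv_fps_def by (rule dvd_div_mult_self)
qed

definition lambert_fps :: "complex \<Rightarrow> complex fps" where
  "lambert_fps z = Abs_fps (\<lambda>k. lambert_gen k (e2pi z) 0)"

text \<open>The power series in \<open>u\<close> of \<open>u / jacobi_phi z u\<close>.\<close>
definition jacobi_inv_fps :: "complex \<Rightarrow> complex fps" where
  "jacobi_inv_fps z = fps_compose (lambert_fps z) (sine_fps ^ 2) * sine_inv_fps"

text \<open>Off the lattice this is u / phi; written through the Lambert series it also has the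
  correct value at u = 0.\<close>

definition jacobi_inv :: "complex \<Rightarrow> complex \<Rightarrow> complex" where
  "jacobi_inv z u = lambert_gen 0 (e2pi z) (sine_kernel u ^ 2) * sine_inv u"

lemma has_fps_expansion_jacobi_inv:
  assumes z: "Im z > 0"
  shows "jacobi_inv z has_fps_expansion jacobi_inv_fps z"
proof -
  have "(lambert_gen 0 (e2pi z) \<circ> (\<lambda>u. sine_kernel u ^ 2)) has_fps_expansion
      fps_compose (lambert_fps z) (sine_fps ^ 2)"
    unfolding lambert_fps_def
    by (intro has_fps_expansion_compose has_fps_expansion_lambert_gen has_fps_expansion_power
        has_fps_expansion_sine_kernel norm_e2pi_less_1 z) auto
  from has_fps_expansion_mult[OF this has_fps_expansion_sine_inv] show ?thesis
    by (simp add: jacobi_inv_def[abs_def] jacobi_inv_fps_def o_def)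
qed

lemma sine_kernel_nonzero:
  assumes "u \<notin> period_lattice z"
  shows "sine_kernel u \<noteq> 0"
proof
  assume "sine_kernel u = 0"
  hence "e2pi (- u / 2) * e2pi (- u / 2) = e2pi (u / 2) * e2pi (- u / 2)"
    by (simp add: sine_kernel_def)
  hence "e2pi (- u) = 1"
    unfolding e2pi_add[symmetric] by simp
  hence "e2pi u = 1"
    by (simp add: e2pi_minus)
  then obtain n where "u = of_int 0 * z + of_int n"
    by (auto simp: e2pi_eq_1_iff)
  with assms show False
    using period_latticeI by blast
qed

lemma jacobi_inv_eq:
  assumes z: "Im z > 0" and u: "u \<notin> period_lattice z"
  shows "jacobi_inv z u = u / jacobi_phi z u"
proof -
  have "u \<noteq> 0" using u by auto
  thus ?thesis
    using lambert_gen_jacobi_phi[OF z u] sine_kernel_nonzero[OF u] jacobi_phi_nonzero[OF z u]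
    by (simp add: jacobi_inv_def sine_inv_def field_simps)
qed

lemma jacobi_inv_0:
  assumes z: "Im z > 0"
  shows "jacobi_inv z 0 = 1 / sine_fps $ 1"
  using lambert_gen_0_0[OF _ norm_e2pi_less_1[OF z]]
  by (simp add: jacobi_inv_def sine_inv_def sine_kernel_def)

section \<open>Modular transformation of the Taylor coefficients of u / phi\<close>

lemma sl2_action:
  fixes a b c d :: int
  assumes z: "Im z > 0" and det: "a * d - b * c = 1"
  defines "J \<equiv> of_int c * z + of_int d"
  defines "z' \<equiv> (of_int a * z + of_int b) / J"
  shows "J \<noteq> 0" "Im z' = Im z / norm J ^ 2" "Im z' > 0"
proof -
  show J: "J \<noteq> 0"
  proof
    assume "J = 0"
    hence "Im J = 0" "Re J = 0" by simp_all
    hence "c = 0" "d = 0" using z by (auto simp: J_def)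
    thus False using det by simp
  qed
  have "Im z' = Im ((of_int a * z + of_int b) * cnj J) / norm J ^ 2"
    by (simp add: z'_def Im_divide cmod_power2 algebra_simps)
  also have "Im ((of_int a * z + of_int b) * cnj J) = of_int (a * d - b * c) * Im z"
    by (simp add: J_def algebra_simps)
  finally show *: "Im z' = Im z / norm J ^ 2" using det by simp
  show "Im z' > 0" unfolding * using z J by simp
qed

text \<open>The reciprocal of the transformation of phi: the numerator u / J cancels its factor 1 /
  J, and only the exponential remains. At u = 0 both sides are the constant 1 /
  \<open>sine_fps $ 1\<close>.\<close>

lemma jacobi_inv_modular:
  fixes a b c d :: int
  assumes z: "Im z > 0" and det: "a * d - b * c = 1"
  defines "J \<equiv> of_int c * z + of_int d"
  defines "z' \<equiv> (of_int a * z + of_int b) / J"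
  shows "eventually (\<lambda>u. jacobi_inv z' (1 / J * u) = jacobi_inv z u * exp (- (of_real pi * \<i> * of_int c / J) * u ^ 2)) (nhds 0)"
proof -
  have J: "J \<noteq> 0" and z': "Im z' > 0"
    using sl2_action[OF z det] by (simp_all add: J_def z'_def)
  have "eventually (\<lambda>u. jacobi_inv z' (1 / J * u) = jacobi_inv z u * exp (- (of_real pi * \<i> * of_int c / J) * u ^ 2)) (at 0)"
    using eventually_not_in_period_lattice[OF z]
  proof eventually_elim
    case (elim u)
    have "u / J \<notin> period_lattice z'"
    proof
      assume "u / J \<in> period_lattice z'"
      then obtain m n :: int where "u / J = of_int m * z' + of_int n"
        by (auto simp: period_lattice_def)
      hence "u = of_int m * (of_int a * z + of_int b) + of_int n * J"
        using J by (simp add: z'_def field_simps)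
      also have "\<dots> = of_int (m * a + n * c) * z + of_int (m * b + n * d)"
        by (simp add: J_def algebra_simps)
      finally show False
        using elim period_latticeI by blast
    qed
    hence "jacobi_inv z' (u / J) = (u / J) / jacobi_phi z' (u / J)"
      by (rule jacobi_inv_eq[OF z'])
    also have "jacobi_phi z' (u / J) = e2pi (of_int c * u ^ 2 / (2 * J)) * jacobi_phi z u / J"
      unfolding z'_def J_def
      by (rule jacobi_phi_modular[OF z det elim]) (use J z' in \<open>simp_all add: J_def z'_def\<close>)
    also have "(u / J) / (e2pi (of_int c * u ^ 2 / (2 * J)) * jacobi_phi z u / J) =
        u / jacobi_phi z u * e2pi (- (of_int c * u ^ 2 / (2 * J)))"
      using J by (simp add: e2pi_minus)
    also have "u / jacobi_phi z u = jacobi_inv z u"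
      using jacobi_inv_eq[OF z elim] by simp
    also have "e2pi (- (of_int c * u ^ 2 / (2 * J))) = exp (- (of_real pi * \<i> * of_int c / J) * u ^ 2)"
      unfolding e2pi_def by (rule arg_cong[of _ _ exp]) (simp add: field_simps)
    finally show ?case by simp
  qed
  moreover have "jacobi_inv z' (1 / J * 0) = jacobi_inv z 0 * exp (- (of_real pi * \<i> * of_int c / J) * 0 ^ 2)"
    by (simp add: jacobi_inv_0[OF z] jacobi_inv_0[OF z'])
  ultimately show ?thesis
    unfolding eventually_nhds_conv_at by simp
qed

text \<open>
  The Gaussian factor absorbs the index of the Jacobi form, at the price of a dependence on
  \<open>Im z\<close>.
\<close>
definition jacobi_inv_ah :: "complex \<Rightarrow> complex fps" where
  "jacobi_inv_ah z = jacobi_inv_fps z * gauss_fps (- of_real (pi / (2 * Im z)))"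

text \<open>From |J|^2 = J (J - 2 i c Im z) one gets pi / (2 Im z' J^2) = pi / (2 Im z) - pi i c /
  J, so the Gaussian factors absorb exactly the exponential of \<open>jacobi_inv_modular\<close>.
  The rescaling u -> u / J then gives the n-th coefficient weight n.\<close>

lemma jacobi_inv_ah_modular:
  fixes a b c d :: int
  assumes z: "Im z > 0" and det: "a * d - b * c = 1"
  defines "J \<equiv> of_int c * z + of_int d"
  defines "z' \<equiv> (of_int a * z + of_int b) / J"
  shows "jacobi_inv_ah z' $ n = J ^ n * jacobi_inv_ah z $ n"
proof -
  have J: "J \<noteq> 0" and z': "Im z' > 0" and Im: "Im z' = Im z / norm J ^ 2"
    using sl2_action[OF z det] by (simp_all add: J_def z'_def)
  let ?L = "fps_const (1 / J) * fps_X :: complex fps"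
  let ?a = "- (of_real pi * \<i> * of_int c / J)"
  let ?f = "jacobi_inv z' \<circ> (\<lambda>u. 1 / J * u)" and ?g = "\<lambda>u. jacobi_inv z u * exp (?a * u ^ 2)"
  have f: "?f has_fps_expansion fps_compose (jacobi_inv_fps z') ?L"
    by (intro has_fps_expansion_compose has_fps_expansion_jacobi_inv z' has_fps_expansion_cmult_left
        has_fps_expansion_fps_X) simp
  have g: "?g has_fps_expansion jacobi_inv_fps z * gauss_fps ?a"
    by (intro has_fps_expansion_mult has_fps_expansion_jacobi_inv z has_fps_expansion_gauss)
  have "eventually (\<lambda>u. ?f u = ?g u) (nhds 0)"
    using jacobi_inv_modular[OF z det] by (simp add: J_def z'_def o_def)
  from has_fps_expansion_cong[OF this refl, THEN iffD1, OF f]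
  have eq: "fps_compose (jacobi_inv_fps z') ?L = jacobi_inv_fps z * gauss_fps ?a"
    by (rule fps_expansion_unique_complex[OF _ g])
  have "fps_compose (jacobi_inv_ah z') ?L =
      jacobi_inv_fps z * (gauss_fps ?a * gauss_fps (- of_real (pi / (2 * Im z')) * (1 / J) ^ 2))"
  proof -
    have "fps_compose (jacobi_inv_ah z') ?L =
        fps_compose (jacobi_inv_fps z') ?L * fps_compose (gauss_fps (- of_real (pi / (2 * Im z')))) ?L"
      unfolding jacobi_inv_ah_def by (rule fps_compose_mult_distrib) simp
    thus ?thesis
      by (simp only: eq gauss_fps_compose_linear mult.assoc)
  qed
  also have "gauss_fps ?a * gauss_fps (- of_real (pi / (2 * Im z')) * (1 / J) ^ 2) =
      gauss_fps (- of_real (pi / (2 * Im z)))"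
  proof -
    have "of_real (norm J ^ 2) = J * cnj J"
      by (rule complex_norm_square)
    moreover have "cnj J = J - 2 * \<i> * of_int c * of_real (Im z)"
      by (simp add: J_def complex_eq_iff)
    ultimately have N: "of_real (norm J ^ 2) = J * (J - 2 * \<i> * of_int c * of_real (Im z))"
      by simp
    have "of_real (pi / (2 * Im z')) * (1 / J) ^ 2 = of_real pi * of_real (norm J ^ 2) / (2 * of_real (Im z) * J ^ 2)"
      by (simp add: Im power_divide)
    also have "\<dots> = of_real (pi / (2 * Im z)) + ?a"
      unfolding N using J z by (simp add: field_simps power2_eq_square)
    finally show ?thesis
      unfolding gauss_fps_add[symmetric] by (intro arg_cong[of _ _ gauss_fps]) (simp add: algebra_simps)
  qed
  finally have "fps_compose (jacobi_inv_ah z') ?L = jacobi_inv_ah z"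
    by (simp add: jacobi_inv_ah_def)
  hence "(1 / J) ^ n * jacobi_inv_ah z' $ n = jacobi_inv_ah z $ n"
    by (metis fps_nth_compose_linear)
  thus ?thesis
    using J by (simp add: field_simps)
qed

text \<open>The constant comes from - pi / (2 Im z) = - 2 pi^2 / (4 pi Im z), a rewriting in the
  variable of \<open>almost_holomorphic\<close>. The value 0 for 2 m > n lets the depth be taken as
  n.\<close>

definition jacobi_inv_coeff :: "nat \<Rightarrow> nat \<Rightarrow> complex \<Rightarrow> complex" where
  "jacobi_inv_coeff n m z =
     (if 2 * m \<le> n then of_real ((- 2 * pi ^ 2) ^ m / fact m) * jacobi_inv_fps z $ (n - 2 * m) else 0)"

lemma jacobi_inv_ah_nth:
  assumes z: "Im z > 0"
  shows "jacobi_inv_ah z $ n = almost_holomorphic n (jacobi_inv_coeff n) z"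
proof -
  let ?a = "- complex_of_real (pi / (2 * Im z))"
  let ?g = "\<lambda>i. gauss_fps ?a $ i * jacobi_inv_fps z $ (n - i)"
  have "jacobi_inv_ah z $ n = (\<Sum>i = 0..n. ?g i)"
    unfolding jacobi_inv_ah_def by (subst mult.commute) (rule fps_mult_nth)
  also have "\<dots> = (\<Sum>i \<in> (\<lambda>m. 2 * m) ` {m. 2 * m \<le> n}. ?g i)"
  proof (rule sum.mono_neutral_right)
    show "\<forall>i\<in>{0..n} - (\<lambda>m. 2 * m) ` {m. 2 * m \<le> n}. ?g i = 0"
      by (auto simp: gauss_fps_nth elim!: evenE)
  qed auto
  also have "\<dots> = (\<Sum>m | 2 * m \<le> n. ?g (2 * m))"
    by (subst sum.reindex) (auto simp: inj_on_def)
  also have "\<dots> = (\<Sum>m\<le>n. jacobi_inv_coeff n m z / of_real (4 * pi * Im z) ^ m)"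
  proof (rule sum.mono_neutral_cong_left)
    fix m assume "m \<in> {m. 2 * m \<le> n}"
    moreover have "?a = of_real (- 2 * pi ^ 2 / (4 * pi * Im z))"
      using z by (simp add: power2_eq_square)
    hence "?a ^ m = of_real ((- 2 * pi ^ 2) ^ m) / of_real (4 * pi * Im z) ^ m"
      by (simp only: power_divide of_real_divide of_real_power)
    ultimately show "?g (2 * m) = jacobi_inv_coeff n m z / of_real (4 * pi * Im z) ^ m"
      by (simp add: gauss_fps_nth jacobi_inv_coeff_def)
  qed (auto simp: jacobi_inv_coeff_def)
  finally show ?thesis
    by (simp add: almost_holomorphic_def)
qed

text \<open>
  The \<open>j\<close>-th power of \<open>sine_fps\<^sup>2\<close> starts with \<open>u\<^bsup>2j\<^esup>\<close>, so the coefficients of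
  \<open>u\<^bsup>2k\<^esup>\<close> form a triangular system for the values \<open>lambert_gen k q 0\<close>.
\<close>
lemma lambert_gen_in_terms_of_jacobi_inv:
  "of_real ((- 4 * pi ^ 2) ^ k) * lambert_gen k (e2pi z) 0 =
     (\<Sum>i = 0..2 * k + 1. jacobi_inv_fps z $ i * sine_fps $ (2 * k + 1 - i)) -
     (\<Sum>j<k. lambert_gen j (e2pi z) 0 * (sine_fps ^ 2) ^ j $ (2 * k))"
proof -
  have low: "(sine_fps ^ 2) ^ j $ (2 * k) = 0" if "j > k" for j
  proof -
    have "2 * k < subdegree ((sine_fps ^ 2) ^ j)"
      using that by (simp add: subdegree_power subdegree_sine_fps)
    thus ?thesis by (rule nth_less_subdegree_zero)
  qed
  have diag: "(sine_fps ^ 2) ^ k $ (2 * k) = of_real ((- 4 * pi ^ 2) ^ k)"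
  proof -
    have "(sine_fps ^ 2) ^ k $ (2 * k) = sine_fps ^ (2 * k) $ (2 * k)"
      by (simp add: power_mult)
    also have "\<dots> = (sine_fps $ 1) ^ (2 * k)"
      by (rule startsby_zero_power_nth_same) simp
    also have "\<dots> = of_real ((- 4 * pi ^ 2) ^ k)"
      unfolding sine_fps_1 by (simp add: power_mult power_mult_distrib)
    finally show ?thesis .
  qed
  \<comment> \<open>Multiplying by \<open>sine_fps\<close> turns \<open>sine_inv_fps\<close> into
    \<open>fps_X\<close>; hence the index 2 k + 1 on one side and 2 k on the other.\<close>
  have "fps_compose (lambert_fps z) (sine_fps ^ 2) * fps_X = jacobi_inv_fps z * sine_fps"
    by (simp add: jacobi_inv_fps_def mult.assoc sine_inv_fps_mult)
  hence "(\<Sum>i = 0..2 * k + 1. jacobi_inv_fps z $ i * sine_fps $ (2 * k + 1 - i)) =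
      (fps_compose (lambert_fps z) (sine_fps ^ 2) * fps_X) $ (2 * k + 1)"
    by (simp only: fps_mult_nth)
  also have "\<dots> = fps_compose (lambert_fps z) (sine_fps ^ 2) $ (2 * k)"
    by simp
  also have "\<dots> = (\<Sum>j = 0..2 * k. lambert_gen j (e2pi z) 0 * (sine_fps ^ 2) ^ j $ (2 * k))"
    by (simp add: fps_compose_nth lambert_fps_def)
  also have "\<dots> = (\<Sum>j\<le>k. lambert_gen j (e2pi z) 0 * (sine_fps ^ 2) ^ j $ (2 * k))"
    by (rule sum.mono_neutral_right) (auto simp: low)
  also have "\<dots> = (\<Sum>j<k. lambert_gen j (e2pi z) 0 * (sine_fps ^ 2) ^ j $ (2 * k)) +
      lambert_gen k (e2pi z) 0 * (sine_fps ^ 2) ^ k $ (2 * k)"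
    by (simp add: lessThan_Suc_atMost[symmetric])
  finally show ?thesis
    unfolding diag by (simp add: mult.commute)
qed

text \<open>A finite combination of Lambert series with constants independent of z, through which
  holomorphy and boundedness in z are inherited.\<close>

lemma jacobi_inv_fps_nth:
  "jacobi_inv_fps z $ n = (\<Sum>i = 0..n. (\<Sum>k = 0..i. lambert_gen k (e2pi z) 0 * (sine_fps ^ 2) ^ k $ i) * sine_inv_fps $ (n - i))"
  by (simp add: jacobi_inv_fps_def fps_mult_nth fps_compose_nth lambert_fps_def)

unbundle vec_syntax
no_notation fps_nth (infixl \<open>$\<close> 75)

section \<open>Principal congruence subgroups\<close>

definition principal_congruence_subgroup :: "int \<Rightarrow> (int^2^2) set" where
  "principal_congruence_subgroup N = {A. det A = 1 \<and> (\<forall>i j. A$i$j mod N = (mat 1 :: int^2^2)$i$j mod N)}"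

lemma matrix_mult_mod_cong:
  fixes A B A' B' :: "int^2^2"
  assumes "\<forall>i j. A$i$j mod N = A'$i$j mod N" "\<forall>i j. B$i$j mod N = B'$i$j mod N"
  shows "\<forall>i j. (A ** B)$i$j mod N = (A' ** B')$i$j mod N"
proof (intro allI)
  fix i j
  have "(A$i$1 * B$1$j + A$i$2 * B$2$j) mod N = (A'$i$1 * B'$1$j + A'$i$2 * B'$2$j) mod N"
    by (intro mod_add_cong mod_mult_cong) (use assms in auto)
  thus "(A ** B)$i$j mod N = (A' ** B')$i$j mod N"
    by (simp add: matrix_matrix_mult_def sum_2)
qed

text \<open>Matrices with equal residues mod N lie in the same coset, and there are only finitely
  many residue matrices.\<close>

lemma finite_index_principal_congruence_subgroup:
  assumes N: "N > 0"
  shows "finite_index_subgroup (principal_congruence_subgroup N)"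
proof -
  let ?\<Gamma> = "principal_congruence_subgroup N"
  interpret group SL2Z by (rule group_SL2Z)
  have carr: "carrier SL2Z = {A. det A = 1}" and mult: "A \<otimes>\<^bsub>SL2Z\<^esub> B = A ** B"
    and one: "\<one>\<^bsub>SL2Z\<^esub> = mat 1" for A B
    by (simp_all add: SL2Z_def)
  have mem: "A \<in> ?\<Gamma> \<longleftrightarrow> A \<in> carrier SL2Z \<and> (\<forall>i j. A$i$j mod N = (mat 1 :: int^2^2)$i$j mod N)" for A
    by (simp add: principal_congruence_subgroup_def carr)
  have sub: "subgroup ?\<Gamma> SL2Z"
  proof (rule subgroupI)
    show "?\<Gamma> \<subseteq> carrier SL2Z" using mem by blast
    have "mat 1 \<in> ?\<Gamma>" using one_closed by (simp add: mem one)
    thus "?\<Gamma> \<noteq> {}" by blast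
    fix A assume A: "A \<in> ?\<Gamma>"
    \<comment> \<open>Since A is congruent to 1, the inverse of A, multiplied by 1, is congruent to
      the inverse multiplied by A, which is 1.\<close>
    have "\<forall>i j. (inv\<^bsub>SL2Z\<^esub> A ** mat 1)$i$j mod N = (inv\<^bsub>SL2Z\<^esub> A ** A)$i$j mod N"
      by (rule matrix_mult_mod_cong) (use A mem in simp_all)
    moreover have "inv\<^bsub>SL2Z\<^esub> A ** A = mat 1"
      using l_inv[of A] A mem by (simp add: mult one)
    ultimately show "inv\<^bsub>SL2Z\<^esub> A \<in> ?\<Gamma>"
      using A by (simp add: mem)
    fix B assume B: "B \<in> ?\<Gamma>"
    have "\<forall>i j. (A ** B)$i$j mod N = (mat 1 ** mat 1 :: int^2^2)$i$j mod N"
      by (rule matrix_mult_mod_cong) (use A B mem in simp_all)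
    moreover have "A \<otimes>\<^bsub>SL2Z\<^esub> B \<in> carrier SL2Z"
      using A B mem by blast
    ultimately show "A \<otimes>\<^bsub>SL2Z\<^esub> B \<in> ?\<Gamma>"
      by (simp add: mem mult)
  qed
  define red where "red = (\<lambda>A :: int^2^2. (A$1$1 mod N, A$1$2 mod N, A$2$1 mod N, A$2$2 mod N))"
  have coset: "?\<Gamma> #>\<^bsub>SL2Z\<^esub> A = ?\<Gamma> #>\<^bsub>SL2Z\<^esub> B"
    if AB: "A \<in> carrier SL2Z" "B \<in> carrier SL2Z" "red A = red B" for A B
  proof -
    have "\<forall>i j. A$i$j mod N = B$i$j mod N"
      using AB(3) by (simp add: red_def forall_2)
    hence "\<forall>i j. (A ** inv\<^bsub>SL2Z\<^esub> B)$i$j mod N = (B ** inv\<^bsub>SL2Z\<^esub> B)$i$j mod N"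
      by (rule matrix_mult_mod_cong) simp
    moreover have "B ** inv\<^bsub>SL2Z\<^esub> B = mat 1"
      using r_inv[OF AB(2)] by (simp add: mult one)
    moreover have "A \<otimes>\<^bsub>SL2Z\<^esub> inv\<^bsub>SL2Z\<^esub> B \<in> carrier SL2Z"
      using AB by blast
    ultimately have "A \<otimes>\<^bsub>SL2Z\<^esub> inv\<^bsub>SL2Z\<^esub> B \<in> ?\<Gamma>"
      by (simp add: mem mult)
    moreover have "A = (A \<otimes>\<^bsub>SL2Z\<^esub> inv\<^bsub>SL2Z\<^esub> B) \<otimes>\<^bsub>SL2Z\<^esub> B"
      using AB by (simp add: m_assoc)
    ultimately have "A \<in> ?\<Gamma> #>\<^bsub>SL2Z\<^esub> B"
      unfolding r_coset_def by blast
    thus ?thesis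
      by (rule repr_independence[OF _ AB(2) sub, symmetric])
  qed
  have "finite ((\<lambda>A. ?\<Gamma> #>\<^bsub>SL2Z\<^esub> A) ` carrier SL2Z)"
  proof (rule finite_surj)
    have "red ` carrier SL2Z \<subseteq> {0..<N} \<times> {0..<N} \<times> {0..<N} \<times> {0..<N}"
      using N by (auto simp: red_def)
    thus "finite (red ` carrier SL2Z)"
      by (rule finite_subset) auto
    show "(\<lambda>A. ?\<Gamma> #>\<^bsub>SL2Z\<^esub> A) ` carrier SL2Z \<subseteq>
        (\<lambda>t. ?\<Gamma> #>\<^bsub>SL2Z\<^esub> (SOME A. A \<in> carrier SL2Z \<and> red A = t)) ` (red ` carrier SL2Z)"
    proof
      fix C assume "C \<in> (\<lambda>A. ?\<Gamma> #>\<^bsub>SL2Z\<^esub> A) ` carrier SL2Z"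
      then obtain A where A: "A \<in> carrier SL2Z" "C = ?\<Gamma> #>\<^bsub>SL2Z\<^esub> A" by blast
      define B where "B = (SOME B. B \<in> carrier SL2Z \<and> red B = red A)"
      have "B \<in> carrier SL2Z \<and> red B = red A"
        unfolding B_def by (rule someI[of _ A]) (use A in simp)
      hence "C = ?\<Gamma> #>\<^bsub>SL2Z\<^esub> B"
        using coset A by metis
      thus "C \<in> (\<lambda>t. ?\<Gamma> #>\<^bsub>SL2Z\<^esub> (SOME A. A \<in> carrier SL2Z \<and> red A = t)) ` (red ` carrier SL2Z)"
        using A(1) unfolding B_def by blast
    qed
  qed
  moreover have "rcosets\<^bsub>SL2Z\<^esub> ?\<Gamma> = (\<lambda>A. ?\<Gamma> #>\<^bsub>SL2Z\<^esub> A) ` carrier SL2Z"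
    by (auto simp: RCOSETS_def)
  ultimately show ?thesis
    using sub by (simp add: finite_index_subgroup_def)
qed

section \<open>Linear combinations of quasimodular forms\<close>

lemma slash_add: "slash k A (\<lambda>z. F z + G z) z = slash k A F z + slash k A G z"
  by (simp add: slash_def ring_distribs)

lemma slash_cmult: "slash k A (\<lambda>z. c * F z) z = c * slash k A F z"
  by (simp add: slash_def)

lemma quasimodular_form_of_weight_add:
  assumes "quasimodular_form_of_weight \<Gamma> k g1" "quasimodular_form_of_weight \<Gamma> k g2"
  shows "quasimodular_form_of_weight \<Gamma> k (\<lambda>z. g1 z + g2 z)"
proof -
  obtain M1 f1 where 1: "almost_holomorphic_modular_form \<Gamma> k M1 f1" "\<forall>z\<in>upper_half_plane. g1 z = f1 0 z"
    using assms(1) unfolding quasimodular_form_of_weight_def by blast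
  obtain M2 f2 where 2: "almost_holomorphic_modular_form \<Gamma> k M2 f2" "\<forall>z\<in>upper_half_plane. g2 z = f2 0 z"
    using assms(2) unfolding quasimodular_form_of_weight_def by blast
  \<comment> \<open>Padding with zero coefficients brings the two forms to the common depth
    \<open>max M1 M2\<close>.\<close>
  define p where "p = (\<lambda>M (f :: nat \<Rightarrow> complex \<Rightarrow> complex) m z. if m \<le> M then f m z else 0)"
  define M where "M = max M1 M2"
  define f where "f = (\<lambda>m z. p M1 f1 m z + p M2 f2 m z)"
  have p: "almost_holomorphic M (p L h) z = almost_holomorphic L h z" if "L \<le> M" for L h z
    unfolding almost_holomorphic_def p_def using that by (intro sum.mono_neutral_cong_right) auto
  have "almost_holomorphic M f z = almost_holomorphic M1 f1 z + almost_holomorphic M2 f2 z" for z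
  proof -
    have "almost_holomorphic M f z = almost_holomorphic M (p M1 f1) z + almost_holomorphic M (p M2 f2) z"
      by (simp add: almost_holomorphic_def f_def add_divide_distrib sum.distrib)
    thus ?thesis
      using p[of M1 f1 z] p[of M2 f2 z] by (simp add: M_def)
  qed
  hence eq: "almost_holomorphic M f = (\<lambda>z. almost_holomorphic M1 f1 z + almost_holomorphic M2 f2 z)"
    by blast
  have hol: "p L h m holomorphic_on upper_half_plane"
    if "\<forall>m\<le>L. h m holomorphic_on upper_half_plane" for L h m
    using that by (cases "m \<le> L") (auto simp: p_def)
  have "almost_holomorphic_modular_form \<Gamma> k M f"
    unfolding almost_holomorphic_modular_form_def
  proof (intro conjI)
    show "\<forall>m\<le>M. f m holomorphic_on upper_half_plane"
      using 1 2 unfolding f_def almost_holomorphic_modular_form_def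
      by (auto intro!: holomorphic_on_add hol)
    show "\<forall>A\<in>\<Gamma>. \<forall>z\<in>upper_half_plane. slash k A (almost_holomorphic M f) z = almost_holomorphic M f z"
      using 1 2 unfolding eq slash_add almost_holomorphic_modular_form_def by auto
    show "meromorphic_at_cusps k (almost_holomorphic M f)"
      unfolding meromorphic_at_cusps_def
    proof
      fix A assume A: "A \<in> carrier SL2Z"
      obtain C1 c1 where b1: "\<forall>z. Im z \<ge> 1 \<longrightarrow> norm (slash k A (almost_holomorphic M1 f1) z) \<le> C1 * exp (c1 * Im z)"
        using 1 A unfolding almost_holomorphic_modular_form_def meromorphic_at_cusps_def by blast
      obtain C2 c2 where b2: "\<forall>z. Im z \<ge> 1 \<longrightarrow> norm (slash k A (almost_holomorphic M2 f2) z) \<le> C2 * exp (c2 * Im z)"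
        using 2 A unfolding almost_holomorphic_modular_form_def meromorphic_at_cusps_def by blast
      \<comment> \<open>The constants in the growth condition may be negative, hence the absolute
        value before the exponents are compared.\<close>
      have mono: "C * exp (c * y) \<le> \<bar>C\<bar> * exp (max c1 c2 * y)" if "y \<ge> 1" "c \<le> max c1 c2" for C c y :: real
      proof -
        have "C * exp (c * y) \<le> \<bar>C\<bar> * exp (c * y)" by (intro mult_right_mono) auto
        also have "\<dots> \<le> \<bar>C\<bar> * exp (max c1 c2 * y)"
          using that by (intro mult_left_mono) (auto intro: mult_right_mono)
        finally show ?thesis .
      qed
      have "norm (slash k A (almost_holomorphic M f) z) \<le> (\<bar>C1\<bar> + \<bar>C2\<bar>) * exp (max c1 c2 * Im z)" if z: "Im z \<ge> 1" for z
      proof -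
        have "norm (slash k A (almost_holomorphic M f) z) \<le> C1 * exp (c1 * Im z) + C2 * exp (c2 * Im z)"
          unfolding eq slash_add using b1 b2 z by (intro norm_triangle_mono) auto
        also have "\<dots> \<le> \<bar>C1\<bar> * exp (max c1 c2 * Im z) + \<bar>C2\<bar> * exp (max c1 c2 * Im z)"
          using z by (intro add_mono mono) auto
        finally show ?thesis by (simp add: ring_distribs)
      qed
      thus "\<exists>C c. \<forall>z. Im z \<ge> 1 \<longrightarrow> norm (slash k A (almost_holomorphic M f) z) \<le> C * exp (c * Im z)"
        by blast
    qed
  qed
  moreover have "\<forall>z\<in>upper_half_plane. g1 z + g2 z = f 0 z"
    using 1 2 by (simp add: f_def p_def)
  ultimately show ?thesis
    unfolding quasimodular_form_of_weight_def by blast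
qed

lemma quasimodular_form_of_weight_cmult:
  assumes "quasimodular_form_of_weight \<Gamma> k g"
  shows "quasimodular_form_of_weight \<Gamma> k (\<lambda>z. c * g z)"
proof -
  obtain M f where f: "almost_holomorphic_modular_form \<Gamma> k M f" "\<forall>z\<in>upper_half_plane. g z = f 0 z"
    using assms unfolding quasimodular_form_of_weight_def by blast
  define h where "h = (\<lambda>m z. c * f m z)"
  have eq: "almost_holomorphic M h = (\<lambda>z. c * almost_holomorphic M f z)"
    by (simp add: fun_eq_iff almost_holomorphic_def h_def sum_distrib_left)
  have "almost_holomorphic_modular_form \<Gamma> k M h"
    unfolding almost_holomorphic_modular_form_def
  proof (intro conjI)
    show "\<forall>m\<le>M. h m holomorphic_on upper_half_plane"
      using f unfolding h_def almost_holomorphic_modular_form_def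
      by (auto intro!: holomorphic_on_mult)
    show "\<forall>A\<in>\<Gamma>. \<forall>z\<in>upper_half_plane. slash k A (almost_holomorphic M h) z = almost_holomorphic M h z"
      using f unfolding eq slash_cmult almost_holomorphic_modular_form_def by auto
    show "meromorphic_at_cusps k (almost_holomorphic M h)"
      unfolding meromorphic_at_cusps_def
    proof
      fix A assume A: "A \<in> carrier SL2Z"
      obtain C b where b: "\<forall>z. Im z \<ge> 1 \<longrightarrow> norm (slash k A (almost_holomorphic M f) z) \<le> C * exp (b * Im z)"
        using f A unfolding almost_holomorphic_modular_form_def meromorphic_at_cusps_def by blast
      have "norm (slash k A (almost_holomorphic M h) z) \<le> (norm c * C) * exp (b * Im z)" if "Im z \<ge> 1" for z
        unfolding eq slash_cmult norm_mult using b that by (simp add: mult.assoc mult_left_mono)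
      thus "\<exists>C c. \<forall>z. Im z \<ge> 1 \<longrightarrow> norm (slash k A (almost_holomorphic M h) z) \<le> C * exp (c * Im z)"
        by blast
    qed
  qed
  moreover have "\<forall>z\<in>upper_half_plane. c * g z = h 0 z"
    using f by (simp add: h_def)
  ultimately show ?thesis
    unfolding quasimodular_form_of_weight_def by blast
qed

text \<open>\<open>quasimodular_form\<close> with the subgroup held fixed, which makes the notion
  closed under sums.\<close>

definition quasimodular_on :: "(int^2^2) set \<Rightarrow> (complex \<Rightarrow> complex) \<Rightarrow> bool" where
  "quasimodular_on \<Gamma> g \<longleftrightarrow> (\<exists>K h. finite K \<and> (\<forall>k\<in>K. quasimodular_form_of_weight \<Gamma> k (h k)) \<and>
        (\<forall>z\<in>upper_half_plane. g z = (\<Sum>k\<in>K. h k z)))"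

lemma quasimodular_on_imp_quasimodular_form:
  "finite_index_subgroup \<Gamma> \<Longrightarrow> quasimodular_on \<Gamma> g \<Longrightarrow> quasimodular_form g"
  unfolding quasimodular_on_def quasimodular_form_def by blast

lemma quasimodular_on_of_weight:
  assumes "quasimodular_form_of_weight \<Gamma> k g"
  shows "quasimodular_on \<Gamma> g"
  unfolding quasimodular_on_def using assms by (intro exI[of _ "{k}"] exI[of _ "\<lambda>_. g"]) simp

lemma quasimodular_on_cong:
  "quasimodular_on \<Gamma> g \<Longrightarrow> (\<And>z. Im z > 0 \<Longrightarrow> g z = g' z) \<Longrightarrow> quasimodular_on \<Gamma> g'"
  unfolding quasimodular_on_def by (simp add: upper_half_plane_def)

lemma quasimodular_on_0: "quasimodular_on \<Gamma> (\<lambda>_. 0)"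
  unfolding quasimodular_on_def by (intro exI[of _ "{}"]) simp

lemma quasimodular_on_cmult:
  assumes "quasimodular_on \<Gamma> g"
  shows "quasimodular_on \<Gamma> (\<lambda>z. c * g z)"
proof -
  obtain K h where h: "finite K" "\<forall>k\<in>K. quasimodular_form_of_weight \<Gamma> k (h k)"
    "\<forall>z\<in>upper_half_plane. g z = (\<Sum>k\<in>K. h k z)"
    using assms unfolding quasimodular_on_def by blast
  show ?thesis
    unfolding quasimodular_on_def
    using h by (intro exI[of _ K] exI[of _ "\<lambda>k z. c * h k z"])
      (auto simp: sum_distrib_left intro: quasimodular_form_of_weight_cmult)
qed

lemma quasimodular_on_add:
  assumes "quasimodular_on \<Gamma> g1" "quasimodular_on \<Gamma> g2"
  shows "quasimodular_on \<Gamma> (\<lambda>z. g1 z + g2 z)"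
proof -
  obtain K1 h1 where 1: "finite K1" "\<forall>k\<in>K1. quasimodular_form_of_weight \<Gamma> k (h1 k)"
    "\<forall>z\<in>upper_half_plane. g1 z = (\<Sum>k\<in>K1. h1 k z)"
    using assms(1) unfolding quasimodular_on_def by blast
  obtain K2 h2 where 2: "finite K2" "\<forall>k\<in>K2. quasimodular_form_of_weight \<Gamma> k (h2 k)"
    "\<forall>z\<in>upper_half_plane. g2 z = (\<Sum>k\<in>K2. h2 k z)"
    using assms(2) unfolding quasimodular_on_def by blast
  define p where "p = (\<lambda>K (h :: int \<Rightarrow> complex \<Rightarrow> complex) k z. if k \<in> K then h k z else 0)"
  have p: "(\<Sum>k\<in>K1 \<union> K2. p K h k z) = (\<Sum>k\<in>K. h k z)" if "K \<subseteq> K1 \<union> K2" for K h z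
    unfolding p_def using that 1(1) 2(1) by (intro sum.mono_neutral_cong_right) auto
  define h where "h = (\<lambda>k z. p K1 h1 k z + p K2 h2 k z)"
  have "quasimodular_form_of_weight \<Gamma> k (h k)" if "k \<in> K1 \<union> K2" for k
  proof -
    consider "k \<in> K1" "k \<in> K2" | "k \<in> K1" "k \<notin> K2" | "k \<notin> K1" "k \<in> K2"
      using \<open>k \<in> K1 \<union> K2\<close> by blast
    thus ?thesis
    proof cases
      case 1
      with \<open>\<forall>k\<in>K1. _\<close> \<open>\<forall>k\<in>K2. _\<close> show ?thesis
        unfolding h_def p_def by (simp add: quasimodular_form_of_weight_add)
    qed (use 1(2) 2(2) in \<open>simp_all add: h_def p_def\<close>)
  qed
  moreover have "\<forall>z\<in>upper_half_plane. g1 z + g2 z = (\<Sum>k\<in>K1 \<union> K2. h k z)"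
    using 1(3) 2(3) p[of K1 h1] p[of K2 h2] by (simp add: h_def sum.distrib)
  ultimately show ?thesis
    unfolding quasimodular_on_def using 1(1) 2(1) by (intro exI[of _ "K1 \<union> K2"] exI[of _ h]) auto
qed

lemma quasimodular_on_sum:
  assumes "finite I" "\<And>i. i \<in> I \<Longrightarrow> quasimodular_on \<Gamma> (g i)"
  shows "quasimodular_on \<Gamma> (\<lambda>z. \<Sum>i\<in>I. g i z)"
  using assms by (induction I rule: finite_induct) (auto intro: quasimodular_on_0 quasimodular_on_add)

lemma quasimodular_on_const: "quasimodular_on \<Gamma> (\<lambda>_. c)"
proof (rule quasimodular_on_of_weight)
  have "almost_holomorphic 0 (\<lambda>_ _. c) = (\<lambda>_. c)"
    by (simp add: fun_eq_iff almost_holomorphic_def)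
  moreover have "meromorphic_at_cusps 0 (\<lambda>_. c)"
    unfolding meromorphic_at_cusps_def
  proof (intro ballI exI)
    show "\<forall>z. Im z \<ge> 1 \<longrightarrow> norm (slash 0 A (\<lambda>_. c) z) \<le> norm c * exp (0 * Im z)" for A
      by (simp add: slash_def)
  qed
  ultimately have "almost_holomorphic_modular_form \<Gamma> 0 0 (\<lambda>_ _. c)"
    by (simp add: almost_holomorphic_modular_form_def slash_def)
  thus "quasimodular_form_of_weight \<Gamma> 0 (\<lambda>_. c)"
    unfolding quasimodular_form_of_weight_def by blast
qed

section \<open>The form \<open>\<eta>(2z)\<^sup>2 / \<eta>(z)\<^sup>4\<close> of weight -1\<close>

text \<open>The fractional powers of q in eta(2z)^2 and eta(z)^4 are both q^(1/6) and cancel,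
  leaving Pochhammer symbols only.\<close>

definition eta_quot :: "complex \<Rightarrow> complex" where
  "eta_quot z = (qpoch_inf (- e2pi z) (e2pi z) / qpoch_inf (e2pi z) (e2pi z)) ^ 2"

lemma e2pi_half: "e2pi (1 / 2) = -1"
  using e2pi_half_of_int[of 1] by simp

lemma e2pi_quarter: "e2pi (- (1 / 2) / 2) = - \<i>" "e2pi ((1 / 2) / 2) = \<i>"
proof -
  have *: "e2pi (of_real (x / (2 * pi))) = cis x" for x
    by (simp add: e2pi_def cis_conv_exp)
  have "- (1 / 2) / 2 = complex_of_real (- (pi / 2) / (2 * pi))" "(1 / 2) / 2 = complex_of_real (pi / 2 / (2 * pi))"
    by simp_all
  thus "e2pi (- (1 / 2) / 2) = - \<i>" "e2pi ((1 / 2) / 2) = \<i>"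
    by (simp_all only: *) (simp_all add: cis_minus_pi_half)
qed

lemma sine_kernel_half: "sine_kernel (1 / 2) = - (2 * \<i>)"
  unfolding sine_kernel_def e2pi_quarter by simp

text \<open>Here w = -1: the prefactor is -i, and (-1; q) = 2 (-q; q).\<close>

lemma jacobi_phi_half:
  assumes z: "Im z > 0"
  shows "jacobi_phi z (1 / 2) = - (2 * \<i>) * eta_quot z"
  using qpoch_inf_rec[OF norm_e2pi_less_1[OF z], of "-1"]
  unfolding jacobi_phi_def e2pi_quarter e2pi_half eta_quot_def
  by (simp add: power_divide power2_eq_square)

lemma half_period_not_in_lattice:
  fixes c d :: int
  assumes z: "Im z > 0" and odd: "odd c \<or> odd d"
  shows "(of_int c * z + of_int d) / 2 \<notin> period_lattice z"
proof
  assume "(of_int c * z + of_int d) / 2 \<in> period_lattice z"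
  then obtain m n :: int where "(of_int c * z + of_int d) / 2 = of_int m * z + of_int n"
    by (auto simp: period_lattice_def)
  hence eq: "of_int c * z + of_int d = of_int (2 * m) * z + of_int (2 * n)"
    by (simp add: field_simps)
  have "Im (of_int c * z + of_int d) = of_int c * Im z" "Im (of_int (2 * m) * z + of_int (2 * n)) = of_int (2 * m) * Im z"
    by simp_all
  hence "of_int c * Im z = of_int (2 * m) * Im z"
    by (simp only: eq)
  hence "real_of_int c = of_int (2 * m)" using z by simp
  hence c: "c = 2 * m" by linarith
  with eq have "complex_of_int d = of_int (2 * n)" by simp
  hence "d = 2 * n" by (simp only: of_int_eq_iff)
  with c odd show False by simp
qed

lemma half_not_in_lattice: "Im z > 0 \<Longrightarrow> 1 / 2 \<notin> period_lattice z"
  using half_period_not_in_lattice[of z 0 1] by simp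

text \<open>At u = 1/2 the sine kernel is -2 i, with square -4. The identity starts the induction on
  k at s = -4 and also gives the holomorphy of P.\<close>

lemma eta_quot_lambert_gen:
  assumes z: "Im z > 0"
  shows "eta_quot z * lambert_gen 0 (e2pi z) (- 4) = 1"
proof -
  have "(- (2 * \<i>)) ^ 2 = (-4 :: complex)"
    by (simp add: power2_eq_square)
  hence "lambert_gen 0 (e2pi z) (- 4) * (- (2 * \<i>) * eta_quot z) = - (2 * \<i>)"
    using lambert_gen_jacobi_phi[OF z half_not_in_lattice[OF z]]
    by (simp only: sine_kernel_half jacobi_phi_half[OF z])
  thus ?thesis
    by (simp add: mult_ac)
qed

lemma lambert_good_minus_4:
  assumes z: "Im z > 0"
  shows "lambert_good (e2pi z) (- 4)"
  using theta_good_imp_lambert_good[OF e2pi_nonzero norm_e2pi_less_1[OF z] theta_good_e2pi[OF half_not_in_lattice[OF z]]]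
  by (simp add: e2pi_half)

text \<open>The half-period 1/2 at z' corresponds to u = J/2 at z, and the exponent c u^2 / (2 J)
  becomes c J / 8. One formula serves both the invariance on the subgroup and the growth at every
  cusp.\<close>

lemma eta_quot_modular:
  fixes a b c d :: int
  assumes z: "Im z > 0" and det: "a * d - b * c = 1"
  defines "J \<equiv> of_int c * z + of_int d"
  defines "z' \<equiv> (of_int a * z + of_int b) / J"
  shows "J * eta_quot z' = e2pi (of_int c * J / 8) * jacobi_phi z (J / 2) / (- (2 * \<i>))"
proof -
  have J: "J \<noteq> 0" and z': "Im z' > 0"
    using sl2_action[OF z det] by (simp_all add: J_def z'_def)
  have "odd (a * d - b * c)" using det by simp
  hence "odd c \<or> odd d" by auto
  hence u: "J / 2 \<notin> period_lattice z"
    unfolding J_def by (rule half_period_not_in_lattice[OF z])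
  have "jacobi_phi z' (J / 2 / J) = e2pi (of_int c * (J / 2) ^ 2 / (2 * J)) * jacobi_phi z (J / 2) / J"
    unfolding z'_def J_def
    by (rule jacobi_phi_modular[OF z det]) (use u J z' in \<open>simp_all add: J_def z'_def\<close>)
  moreover have "J / 2 / J = 1 / 2" "of_int c * (J / 2) ^ 2 / (2 * J) = of_int c * J / 8"
    using J by (simp_all add: power2_eq_square)
  ultimately have "- (2 * \<i>) * eta_quot z' = e2pi (of_int c * J / 8) * jacobi_phi z (J / 2) / J"
    by (simp only: jacobi_phi_half[OF z'])
  hence "- (2 * \<i>) * (J * eta_quot z') = e2pi (of_int c * J / 8) * jacobi_phi z (J / 2)"
    using J by (simp add: field_simps)
  moreover have "x = y / k" if "k * x = y" "k \<noteq> 0" for x y k :: complex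
    using that by auto
  moreover have "- (2 * \<i>) \<noteq> 0" by simp
  ultimately show ?thesis by blast
qed

text \<open>With c = 8 m and d = 8 n + 1, the point J/2 differs from 1/2 by the lattice vector 4 m z
  + 4 n. The modulus 8 clears the denominator in c J / 8: the terms in z cancel and an integer
  exponent is left.\<close>

lemma eta_quot_invariant:
  fixes a b c d :: int
  assumes z: "Im z > 0" and det: "a * d - b * c = 1" and c: "c mod 8 = 0" and d: "d mod 8 = 1"
  defines "J \<equiv> of_int c * z + of_int d"
  defines "z' \<equiv> (of_int a * z + of_int b) / J"
  shows "J * eta_quot z' = eta_quot z"
proof -
  define m n where "m = c div 8" and "n = d div 8"
  have cd: "c = 8 * m" "d = 8 * n + 1"
    using c d div_mult_mod_eq[of c 8] div_mult_mod_eq[of d 8] unfolding m_def n_def by linarith+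
  have "J / 2 = 1 / 2 + of_int (4 * m) * z + of_int (4 * n)"
    by (simp add: J_def cd field_simps)
  hence "jacobi_phi z (J / 2) = (-1) powi (4 * m + 4 * n) *
      e2pi (- (of_int (4 * m) ^ 2 * z / 2 + of_int (4 * m) * (1 / 2))) * jacobi_phi z (1 / 2)"
    by (simp only: jacobi_phi_add_lattice[OF z])
  also have "(-1 :: complex) powi (4 * m + 4 * n) = 1"
    by (simp add: power_int_minus_left)
  finally have "e2pi (of_int c * J / 8) * jacobi_phi z (J / 2) =
      (e2pi (of_int c * J / 8) * e2pi (- (of_int (4 * m) ^ 2 * z / 2 + of_int (4 * m) * (1 / 2)))) * jacobi_phi z (1 / 2)"
    by simp
  also have "e2pi (of_int c * J / 8) * e2pi (- (of_int (4 * m) ^ 2 * z / 2 + of_int (4 * m) * (1 / 2))) = 1"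
  proof -
    have "of_int c * J / 8 + - (of_int (4 * m) ^ 2 * z / 2 + of_int (4 * m) * (1 / 2)) =
        of_int (m * (8 * n + 1) - 2 * m)"
      by (simp add: J_def cd algebra_simps power2_eq_square)
    thus ?thesis
      unfolding e2pi_add[symmetric] by (simp only: e2pi_of_int)
  qed
  finally have "e2pi (of_int c * J / 8) * jacobi_phi z (J / 2) = - (2 * \<i>) * eta_quot z"
    using jacobi_phi_half[OF z] by simp
  thus ?thesis
    unfolding z'_def J_def eta_quot_modular[OF z det] by simp
qed

section \<open>Growth at the cusps\<close>

lemma norm_e2pi_le_half:
  assumes "Im z \<ge> 1"
  shows "norm (e2pi z) \<le> 1 / 2"
proof -
  have "2 \<le> 1 + 2 * pi * Im z"
    using assms pi_gt3 mult_mono[of 1 pi 1 "Im z"] by linarith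
  also have "\<dots> \<le> exp (2 * pi * Im z)"
    by (rule exp_ge_add_one_self)
  finally show ?thesis
    by (simp add: norm_e2pi exp_minus field_simps)
qed

text \<open>In the strip 0 <= Im u <= Im z both w and q/w have modulus at most 1, so the Pochhammer
  symbols are bounded by constants and only w^(-1/2) can grow.\<close>

lemma norm_jacobi_phi_le:
  assumes z: "Im z \<ge> 1" and u: "0 \<le> Im u" "Im u \<le> Im z"
  shows "norm (jacobi_phi z u) \<le> exp (pi * Im u) * exp 8"
proof -
  have q: "norm (e2pi z) \<le> 1 / 2" by (rule norm_e2pi_le_half[OF z])
  have le: "norm (qpoch_inf a (e2pi z)) \<le> exp 2" if "norm a \<le> 1" for a
  proof -
    have "norm (qpoch_inf a (e2pi z)) \<le> exp (norm a / (1 - norm (e2pi z)))"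
      by (rule norm_qpoch_inf_le) (use q in simp)
    also have "norm a / (1 - norm (e2pi z)) \<le> 1 / (1 / 2)"
      using that q by (intro frac_le) auto
    finally show ?thesis by simp
  qed
  have ge: "norm (qpoch_inf (e2pi z) (e2pi z)) \<ge> exp (- 2)"
  proof -
    have "2 * norm (e2pi z) / (1 - norm (e2pi z)) \<le> 2 * (1 / 2) / (1 / 2)"
      using q by (intro frac_le) auto
    hence "exp (- 2) \<le> exp (- (2 * norm (e2pi z) / (1 - norm (e2pi z))))"
      by simp
    also have "\<dots> \<le> norm (qpoch_inf (e2pi z) (e2pi z))"
      by (rule norm_qpoch_inf_ge) (use q in simp_all)
    finally show ?thesis .
  qed
  have w: "norm (e2pi u) \<le> 1" "norm (e2pi z / e2pi u) \<le> 1"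
    using u by (simp_all add: norm_e2pi flip: e2pi_diff)
  have "norm (jacobi_phi z u) = norm (e2pi (- u / 2)) *
      (norm (qpoch_inf (e2pi u) (e2pi z)) * norm (qpoch_inf (e2pi z / e2pi u) (e2pi z))) /
      norm (qpoch_inf (e2pi z) (e2pi z)) ^ 2"
    by (simp add: jacobi_phi_def norm_mult norm_divide norm_power)
  also have "\<dots> \<le> exp (pi * Im u) * (exp 2 * exp 2) / exp (- 2) ^ 2"
    using le[OF w(1)] le[OF w(2)] ge
    by (intro frac_le mult_mono power_mono) (auto simp: norm_e2pi)
  also have "\<dots> = exp (pi * Im u) * exp 8"
    by (simp add: exp_minus field_simps power2_eq_square flip: exp_add)
  finally show ?thesis .
qed

text \<open>Reducing c and d mod 2 moves J/2 by a lattice vector to (e z + f) / 2 with e, f in {0,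
  1}, inside the strip of \<open>norm_jacobi_phi_le\<close>.\<close>

lemma eta_quot_growth:
  fixes a b c d :: int
  assumes det: "a * d - b * c = 1"
  shows "\<exists>C k. \<forall>z. Im z \<ge> 1 \<longrightarrow>
    norm ((of_int c * z + of_int d) * eta_quot ((of_int a * z + of_int b) / (of_int c * z + of_int d))) \<le> C * exp (k * Im z)"
proof -
  define m e n f where "m = c div 2" and "e = c mod 2" and "n = d div 2" and "f = d mod 2"
  have cd: "c = 2 * m + e" "d = 2 * n + f" by (simp_all add: m_def n_def e_def f_def)
  have e: "0 \<le> e" "e \<le> 1" by (auto simp: e_def)
  \<comment> \<open>The first summand is the exponent of the multiplier for the shift by m z, the
    second is pi Im u / Im z from the bound in the strip.\<close>
  define k where "k = pi * of_int (m ^ 2 + m * e) + pi * of_int e / 2"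
  have "norm ((of_int c * z + of_int d) * eta_quot ((of_int a * z + of_int b) / (of_int c * z + of_int d)))
      \<le> exp 8 * exp (k * Im z)" if z: "Im z \<ge> 1" for z
  proof -
    define J where "J = of_int c * z + of_int d"
    define u where "u = (of_int e * z + of_int f) / 2"
    have z0: "Im z > 0" using z by simp
    have Ju: "J / 2 = u + of_int m * z + of_int n"
      by (simp add: J_def u_def cd field_simps)
    have Imu: "Im u = of_int e * Im z / 2"
      by (simp add: u_def)
    have u: "0 \<le> Im u" "Im u \<le> Im z"
      using e z0 mult_right_mono[of "of_int e" "1::real" "Im z"] by (auto simp: Imu)
    have "norm (e2pi (of_int c * J / 8)) \<le> 1"
      using z0 by (simp add: norm_e2pi J_def)
    moreover have "norm (jacobi_phi z (J / 2)) \<le> exp 8 * exp (k * Im z)"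
    proof -
      have "norm (jacobi_phi z (J / 2)) =
          norm (e2pi (- (of_int m ^ 2 * z / 2 + of_int m * u))) * norm (jacobi_phi z u)"
        unfolding Ju jacobi_phi_add_lattice[OF z0] by (simp add: norm_mult norm_power_int)
      also have "norm (e2pi (- (of_int m ^ 2 * z / 2 + of_int m * u))) = exp (pi * of_int (m ^ 2 + m * e) * Im z)"
      proof -
        have "(of_int m :: complex) ^ 2 = of_real (of_int m ^ 2)" by simp
        thus ?thesis
          unfolding norm_e2pi
          by (intro arg_cong[of _ _ exp]) (simp add: Imu algebra_simps power2_eq_square flip: of_int_mult)
      qed
      also have "exp (pi * of_int (m ^ 2 + m * e) * Im z) * norm (jacobi_phi z u) \<le>
          exp (pi * of_int (m ^ 2 + m * e) * Im z) * (exp (pi * Im u) * exp 8)"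
        by (intro mult_left_mono norm_jacobi_phi_le z u) auto
      also have "\<dots> = exp 8 * exp (k * Im z)"
        unfolding exp_add[symmetric] by (intro arg_cong[of _ _ exp]) (simp add: k_def Imu algebra_simps)
      finally show ?thesis .
    qed
    ultimately have "norm (e2pi (of_int c * J / 8)) * norm (jacobi_phi z (J / 2)) \<le> 1 * (exp 8 * exp (k * Im z))"
      by (intro mult_mono) auto
    moreover have "norm (J * eta_quot ((of_int a * z + of_int b) / J)) =
        norm (e2pi (of_int c * J / 8)) * norm (jacobi_phi z (J / 2)) / 2"
      unfolding J_def eta_quot_modular[OF z0 det] by (simp add: norm_mult norm_divide)
    moreover have "exp 8 * exp (k * Im z) \<ge> 0" by simp
    ultimately show ?thesis
      unfolding J_def by linarith
  qed
  thus ?thesis by blast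
qed

lemma bounded_mult_image:
  fixes f g :: "'a \<Rightarrow> complex"
  assumes "bounded (f ` S)" "bounded (g ` S)"
  shows "bounded ((\<lambda>x. f x * g x) ` S)"
proof -
  obtain B C where "\<forall>x\<in>S. norm (f x) \<le> B" "\<forall>x\<in>S. norm (g x) \<le> C"
    using assms by (auto simp: bounded_iff)
  hence "\<forall>x\<in>S. norm (f x * g x) \<le> \<bar>B\<bar> * \<bar>C\<bar>"
    by (fastforce simp: norm_mult intro!: mult_mono)
  thus ?thesis by (auto simp: bounded_iff)
qed

lemma bounded_sum_image:
  fixes f :: "'i \<Rightarrow> 'a \<Rightarrow> complex"
  assumes "\<And>i. i \<in> I \<Longrightarrow> bounded (f i ` S)"
  shows "bounded ((\<lambda>x. \<Sum>i\<in>I. f i x) ` S)"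
  using assms by (induction I rule: infinite_finite_induct) (auto intro: bounded_plus_comp simp: image_constant_conv)

lemma bounded_const_image: "bounded ((\<lambda>_. c :: complex) ` S)"
  by (simp add: image_constant_conv)

lemma bounded_lambert_gen: "bounded ((\<lambda>z. lambert_gen k (e2pi z) 0) ` {z. Im z \<ge> 1})"
  unfolding bounded_iff
  using norm_lambert_gen_le[of "e2pi _" "1 / 2" 1 0 k] norm_e2pi_le_half by fastforce

lemma bounded_jacobi_inv_fps: "bounded ((\<lambda>z. fps_nth (jacobi_inv_fps z) n) ` {z. Im z \<ge> 1})"
  unfolding jacobi_inv_fps_nth
  by (intro bounded_sum_image bounded_mult_image bounded_const_image bounded_lambert_gen)

lemma bounded_gauss_fps: "bounded ((\<lambda>z. fps_nth (gauss_fps (- of_real (pi / (2 * Im z)))) n) ` {z. Im z \<ge> 1})"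
proof -
  have "norm (fps_nth (gauss_fps (- of_real (pi / (2 * Im z)))) n) \<le> (pi / 2) ^ (n div 2)" if "Im z \<ge> 1" for z
  proof (cases "even n")
    case True
    hence "norm (fps_nth (gauss_fps (- of_real (pi / (2 * Im z)))) n) = (pi / (2 * Im z)) ^ (n div 2) / fact (n div 2)"
      using that by (simp add: gauss_fps_nth norm_divide norm_power)
    also have "\<dots> \<le> (pi / 2) ^ (n div 2) / 1"
      using that by (intro frac_le power_mono) (auto intro!: divide_left_mono)
    finally show ?thesis by simp
  qed (simp add: gauss_fps_nth)
  thus ?thesis by (auto simp: bounded_iff)
qed

text \<open>By modularity under all of SL2(Z), this bound for Im z >= 1 controls the coefficient at
  every cusp.\<close>

lemma bounded_jacobi_inv_ah: "bounded ((\<lambda>z. fps_nth (jacobi_inv_ah z) n) ` {z. Im z \<ge> 1})"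
  unfolding jacobi_inv_ah_def fps_mult_nth
  by (intro bounded_sum_image bounded_mult_image bounded_jacobi_inv_fps bounded_gauss_fps)

section \<open>Holomorphy in the upper half-plane\<close>

text \<open>Holomorphy in q on a punctured disc of radius r < 1 around 0, composed with q =
  \<open>e2pi z\<close>. The lower bound d has to be uniform in q and n.\<close>

lemma lambert_gen_holomorphic_nome:
  assumes d: "\<And>r. r < 1 \<Longrightarrow> \<exists>d>0. \<forall>q n. q \<noteq> 0 \<longrightarrow> norm q \<le> r \<longrightarrow> n \<noteq> 0 \<longrightarrow> d \<le> norm (1 - s * lambert_var q n)"
  shows "(\<lambda>z. lambert_gen k (e2pi z) s) holomorphic_on upper_half_plane"
proof -
  have "(\<lambda>z. lambert_gen k (e2pi z) s) field_differentiable at z" if z: "Im z > 0" for z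
  proof -
    define r where "r = (1 + norm (e2pi z)) / 2"
    have r: "0 < r" "r < 1" "norm (e2pi z) < r"
      using norm_e2pi_less_1[OF z] by (auto simp: r_def intro: add_pos_nonneg)
    obtain d where d: "d > 0" "\<forall>q n. q \<noteq> 0 \<longrightarrow> norm q \<le> r \<longrightarrow> n \<noteq> 0 \<longrightarrow> d \<le> norm (1 - s * lambert_var q n)"
      using d[OF r(2)] by blast
    have "(\<lambda>q. lambert_gen k q s) holomorphic_on (ball 0 r - {0})"
      by (rule lambert_gen_holomorphic_param[where r = r and d = d]) (use r d in auto)
    hence "(\<lambda>q. lambert_gen k q s) field_differentiable at (e2pi z)"
      by (rule holomorphic_on_imp_differentiable_at) (use r in auto)
    moreover have "e2pi field_differentiable at z"
      by (rule holomorphic_on_imp_differentiable_at[of _ UNIV]) (auto intro: holomorphic_intros)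
    ultimately show ?thesis
      using field_differentiable_compose[of e2pi z "\<lambda>q. lambert_gen k q s"] by (simp add: o_def)
  qed
  thus ?thesis
    unfolding holomorphic_on_def upper_half_plane_def using field_differentiable_at_within by blast
qed

lemma holomorphic_lambert_gen_0: "(\<lambda>z. lambert_gen k (e2pi z) 0) holomorphic_on upper_half_plane"
  by (rule lambert_gen_holomorphic_nome) (auto intro!: exI[of _ 1])

text \<open>With x = q^|n| the denominator 1 + 4 X equals ((1 + x) / (1 - x))^2, and |x| <= r keeps
  it away from 0 uniformly.\<close>

lemma holomorphic_lambert_gen_minus_4: "(\<lambda>z. lambert_gen k (e2pi z) (- 4)) holomorphic_on upper_half_plane"
proof (rule lambert_gen_holomorphic_nome)
  fix r :: real assume r: "r < 1"
  have "(1 - r) ^ 2 / 4 \<le> norm (1 - (- 4) * lambert_var q n)"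
    if q: "q \<noteq> 0" "norm q \<le> r" and n: "n \<noteq> 0" for q and n :: int
  proof -
    define x where "x = q powi \<bar>n\<bar>"
    define m where "m = nat \<bar>n\<bar>"
    have r0: "0 \<le> r" using q(2) norm_ge_zero order_trans by blast
    have x: "x = q ^ m" by (simp add: x_def m_def power_int_def)
    have "norm x \<le> r ^ m"
      using q by (simp add: x norm_power power_mono)
    also have "r ^ m \<le> r ^ 1"
      using n r r0 by (intro power_decreasing) (auto simp: m_def)
    finally have xr: "norm x \<le> r" by simp
    hence x1: "x \<noteq> 1" using r by auto
    have "1 - (- 4) * lambert_var q n = ((1 + x) / (1 - x)) ^ 2"
    proof -
      have "lambert_var q n = x / (1 - x) ^ 2"
        using lambert_var_abs[OF q(1), of n] by (simp add: lambert_var_def x_def)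
      moreover have "1 - (- 4) * (x / (1 - x) ^ 2) = ((1 - x) ^ 2 + 4 * x) / (1 - x) ^ 2"
        using x1 by (simp add: field_simps)
      moreover have "(1 - x) ^ 2 + 4 * x = (1 + x) ^ 2"
        by (simp add: power2_eq_square algebra_simps)
      ultimately show ?thesis by (simp add: power_divide)
    qed
    hence "norm (1 - (- 4) * lambert_var q n) = (norm (1 + x) / norm (1 - x)) ^ 2"
      by (simp add: norm_divide norm_power)
    moreover have "(1 - r) / 2 \<le> norm (1 + x) / norm (1 - x)"
    proof (rule frac_le)
      show "1 - r \<le> norm (1 + x)"
        using norm_triangle_ineq2[of 1 "- x"] xr by simp
      show "norm (1 - x) \<le> 2"
        using norm_triangle_ineq4[of 1 x] xr r by simp
    qed (use r x1 in auto)
    hence "((1 - r) / 2) ^ 2 \<le> (norm (1 + x) / norm (1 - x)) ^ 2"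
      using r by (intro power_mono) auto
    ultimately show ?thesis by (simp add: power_divide)
  qed
  moreover have "(1 - r) ^ 2 / 4 > 0" using r by simp
  ultimately show "\<exists>d>0. \<forall>q n. q \<noteq> 0 \<longrightarrow> norm q \<le> r \<longrightarrow> n \<noteq> 0 \<longrightarrow> d \<le> norm (1 - (- 4) * lambert_var q n)"
    by blast
qed

text \<open>\<open>holomorphic_on_qpoch_inf\<close> concerns the first argument with the nome fixed;
  holomorphy in z is obtained from P = 1 / L(-4), where L(-4) has no zeros because its product with
  P is 1.\<close>

lemma holomorphic_eta_quot: "eta_quot holomorphic_on upper_half_plane"
proof -
  have nz: "lambert_gen 0 (e2pi z) (- 4) \<noteq> 0" if "z \<in> upper_half_plane" for z
    using eta_quot_lambert_gen[of z] that by (auto simp: upper_half_plane_def)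
  have "(\<lambda>z. 1 / lambert_gen 0 (e2pi z) (- 4)) holomorphic_on upper_half_plane"
    by (intro holomorphic_on_divide holomorphic_lambert_gen_minus_4 holomorphic_on_const nz)
  moreover have "1 / lambert_gen 0 (e2pi z) (- 4) = eta_quot z" if "z \<in> upper_half_plane" for z
    using eta_quot_lambert_gen[of z] nz[OF that] that by (simp add: upper_half_plane_def field_simps)
  ultimately show ?thesis
    by (rule holomorphic_transform)
qed

lemma holomorphic_jacobi_inv_fps: "(\<lambda>z. fps_nth (jacobi_inv_fps z) n) holomorphic_on upper_half_plane"
  unfolding jacobi_inv_fps_nth
  by (intro holomorphic_on_sum holomorphic_on_mult holomorphic_on_const holomorphic_lambert_gen_0)

lemma holomorphic_jacobi_inv_coeff: "jacobi_inv_coeff n m holomorphic_on upper_half_plane"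
proof (cases "2 * m \<le> n")
  case True
  hence "jacobi_inv_coeff n m =
      (\<lambda>z. of_real ((- 2 * pi ^ 2) ^ m / fact m) * fps_nth (jacobi_inv_fps z) (n - 2 * m))"
    by (auto simp: jacobi_inv_coeff_def)
  thus ?thesis
    by (simp only:) (intro holomorphic_on_mult holomorphic_on_const holomorphic_jacobi_inv_fps)
next
  case False
  hence "jacobi_inv_coeff n m = (\<lambda>_. 0)"
    by (auto simp: jacobi_inv_coeff_def)
  thus ?thesis by simp
qed

section \<open>Quasimodularity\<close>

text \<open>The corrected n-th coefficient has weight n and P has weight -1. In the slash action one
  factor J remains, which is the one that P requires.\<close>

lemma quasimodular_eta_quot_jacobi_inv:
  "quasimodular_form_of_weight (principal_congruence_subgroup 8) (int n - 1)
     (\<lambda>z. eta_quot z * fps_nth (jacobi_inv_fps z) n)"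
proof -
  define f where "f = (\<lambda>m z. eta_quot z * jacobi_inv_coeff n m z)"
  have F: "almost_holomorphic n f z = eta_quot z * fps_nth (jacobi_inv_ah z) n" if "Im z > 0" for z
    unfolding jacobi_inv_ah_nth[OF that] by (simp add: almost_holomorphic_def f_def sum_distrib_left)
  have slash: "slash (int n - 1) A (almost_holomorphic n f) z =
      ((of_int (A$2$1) * z + of_int (A$2$2)) * eta_quot (moebius A z)) * fps_nth (jacobi_inv_ah z) n"
    if A: "det A = 1" and z: "Im z > 0" for A :: "int^2^2" and z
  proof -
    define J where "J = of_int (A$2$1) * z + of_int (A$2$2)"
    have det: "A$1$1 * A$2$2 - A$1$2 * A$2$1 = 1"
      using A by (simp add: det_2)
    have J: "J \<noteq> 0" and z': "Im (moebius A z) > 0"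
      using sl2_action[OF z det] by (simp_all add: J_def moebius_def)
    have "fps_nth (jacobi_inv_ah (moebius A z)) n = J ^ n * fps_nth (jacobi_inv_ah z) n"
      unfolding moebius_def J_def by (rule jacobi_inv_ah_modular[OF z det])
    moreover have "J powi (- (int n - 1)) * J ^ n = J"
      using J by (simp add: power_int_diff)
    ultimately show ?thesis
      unfolding slash_def F[OF z'] J_def[symmetric] by (metis (no_types, opaque_lifting) mult.assoc mult.commute)
  qed
  have "almost_holomorphic_modular_form (principal_congruence_subgroup 8) (int n - 1) n f"
    unfolding almost_holomorphic_modular_form_def
  proof (intro conjI ballI allI impI)
    show "f m holomorphic_on upper_half_plane" for m
      unfolding f_def by (intro holomorphic_on_mult holomorphic_eta_quot holomorphic_jacobi_inv_coeff)
  next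
    fix A z assume A: "A \<in> principal_congruence_subgroup 8" and "z \<in> upper_half_plane"
    hence z: "Im z > 0" by (simp add: upper_half_plane_def)
    have det: "det A = 1" "A$1$1 * A$2$2 - A$1$2 * A$2$1 = 1"
      using A by (simp_all add: principal_congruence_subgroup_def det_2)
    have "A$2$1 mod 8 = 0" "A$2$2 mod 8 = 1"
      using A by (auto simp: principal_congruence_subgroup_def mat_def)
    hence "(of_int (A$2$1) * z + of_int (A$2$2)) * eta_quot (moebius A z) = eta_quot z"
      unfolding moebius_def by (rule eta_quot_invariant[OF z det(2)])
    thus "slash (int n - 1) A (almost_holomorphic n f) z = almost_holomorphic n f z"
      unfolding slash[OF det(1) z] F[OF z] by simp
  next
    show "meromorphic_at_cusps (int n - 1) (almost_holomorphic n f)"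
      unfolding meromorphic_at_cusps_def
    proof
      fix A assume "A \<in> carrier SL2Z"
      hence det: "det A = 1" "A$1$1 * A$2$2 - A$1$2 * A$2$1 = 1"
        by (simp_all add: SL2Z_def det_2)
      obtain C k where C: "\<forall>z. Im z \<ge> 1 \<longrightarrow>
          norm ((of_int (A$2$1) * z + of_int (A$2$2)) * eta_quot (moebius A z)) \<le> C * exp (k * Im z)"
        using eta_quot_growth[OF det(2)] unfolding moebius_def by blast
      obtain B where B: "\<forall>z. Im z \<ge> 1 \<longrightarrow> norm (fps_nth (jacobi_inv_ah z) n) \<le> B"
        using bounded_jacobi_inv_ah[of n] by (auto simp: bounded_iff)
      have "norm (slash (int n - 1) A (almost_holomorphic n f) z) \<le> (C * B) * exp (k * Im z)" if z: "Im z \<ge> 1" for z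
      proof -
        have z0: "Im z > 0" using z by simp
        have C0: "0 \<le> C * exp (k * Im z)"
          using C z norm_ge_zero order_trans by blast
        have "norm (slash (int n - 1) A (almost_holomorphic n f) z) =
            norm ((of_int (A$2$1) * z + of_int (A$2$2)) * eta_quot (moebius A z)) * norm (fps_nth (jacobi_inv_ah z) n)"
          unfolding slash[OF det(1) z0] by (rule norm_mult)
        also have "\<dots> \<le> (C * exp (k * Im z)) * B"
          using B C C0 z by (intro mult_mono) auto
        finally show ?thesis by (simp add: mult_ac)
      qed
      thus "\<exists>C c. \<forall>z. Im z \<ge> 1 \<longrightarrow> norm (slash (int n - 1) A (almost_holomorphic n f) z) \<le> C * exp (c * Im z)"
        by blast
    qed
  qed
  moreover have "\<forall>z\<in>upper_half_plane. eta_quot z * fps_nth (jacobi_inv_fps z) n = f 0 z"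
    by (simp add: f_def jacobi_inv_coeff_def)
  ultimately show ?thesis
    unfolding quasimodular_form_of_weight_def by blast
qed

text \<open>The triangular system for the Lambert series, multiplied by P and solved by strong
  induction. The coefficients of index i enter with weight i - 1, so several weights occur.\<close>

lemma quasimodular_eta_quot_lambert_gen_0:
  "quasimodular_on (principal_congruence_subgroup 8) (\<lambda>z. eta_quot z * lambert_gen k (e2pi z) 0)"
proof (induction k rule: less_induct)
  case (less k)
  let ?\<Gamma> = "principal_congruence_subgroup 8"
  define C where "C = complex_of_real ((- 4 * pi ^ 2) ^ k)"
  have C: "C \<noteq> 0" by (simp add: C_def)
  define g where "g = (\<lambda>z. (\<Sum>i = 0..2 * k + 1. fps_nth sine_fps (2 * k + 1 - i) * (eta_quot z * fps_nth (jacobi_inv_fps z) i)) +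
    (\<Sum>j<k. - fps_nth ((sine_fps ^ 2) ^ j) (2 * k) * (eta_quot z * lambert_gen j (e2pi z) 0)))"
  have "quasimodular_on ?\<Gamma> g"
    unfolding g_def
    by (intro quasimodular_on_add quasimodular_on_sum quasimodular_on_cmult less.IH
        quasimodular_on_of_weight[OF quasimodular_eta_quot_jacobi_inv]) auto
  hence "quasimodular_on ?\<Gamma> (\<lambda>z. (1 / C) * g z)"
    by (rule quasimodular_on_cmult)
  moreover have "(1 / C) * g z = eta_quot z * lambert_gen k (e2pi z) 0" for z
  proof -
    have "g z = eta_quot z * (C * lambert_gen k (e2pi z) 0)"
      unfolding C_def lambert_gen_in_terms_of_jacobi_inv g_def
      by (simp add: right_diff_distrib sum_distrib_left sum_negf mult_ac)
    thus ?thesis using C by simp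
  qed
  ultimately show ?case by simp
qed

text \<open>Repeated division of a power of X by 1 + 4 X: the recursion reads
  \<open>L\<^sub>k\<^sub>+\<^sub>1\<close>(-4) = (\<open>M\<^sub>k\<close> -
  \<open>L\<^sub>k\<close>(-4)) / 4, and it ends in P L(-4) = 1, the source of the component of
  weight 0.\<close>

lemma quasimodular_eta_quot_lambert_gen_minus_4:
  "quasimodular_on (principal_congruence_subgroup 8) (\<lambda>z. eta_quot z * lambert_gen k (e2pi z) (- 4))"
proof (induction k)
  case 0
  show ?case
    by (rule quasimodular_on_cong[OF quasimodular_on_const[of _ 1]]) (simp add: eta_quot_lambert_gen)
next
  case (Suc k)
  have "quasimodular_on (principal_congruence_subgroup 8)
      (\<lambda>z. (1 / 4) * (eta_quot z * lambert_gen k (e2pi z) 0) + (- 1 / 4) * (eta_quot z * lambert_gen k (e2pi z) (- 4)))"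
    by (intro quasimodular_on_add quasimodular_on_cmult Suc.IH quasimodular_eta_quot_lambert_gen_0)
  thus ?case
  proof (rule quasimodular_on_cong)
    fix z assume z: "Im z > 0"
    have eq: "lambert_gen k (e2pi z) (- 4) = lambert_gen k (e2pi z) 0 + (- 4) * lambert_gen (Suc k) (e2pi z) (- 4)"
      by (rule lambert_gen_Suc[OF e2pi_nonzero norm_e2pi_less_1[OF z] lambert_good_minus_4[OF z]])
    have "(1 / 4) * (P * a) + (- 1 / 4) * (P * (a + (- 4) * b)) = P * b" for P a b :: complex
      by (simp add: algebra_simps)
    thus "(1 / 4) * (eta_quot z * lambert_gen k (e2pi z) 0) + (- 1 / 4) * (eta_quot z * lambert_gen k (e2pi z) (- 4)) =
        eta_quot z * lambert_gen (Suc k) (e2pi z) (- 4)"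
      unfolding eq .
  qed
qed

section \<open>Identification of N with P times a Lambert series at s = -4\<close>

lemma qpoch_minus_1_ratio:
  assumes q: "q \<noteq> 0" "norm q < 1" and good: "theta_good q (- 1)"
  shows "qpoch (- 1) q n / qpoch (- q) q n = 2 / (1 + q powi n)"
proof -
  have nz: "qpoch_inf (- q) q \<noteq> 0"
    by (rule qpoch_inf_nonzero') (use q in auto)
  have nz': "qpoch_inf (- (q * q powi n)) q \<noteq> 0"
  proof (rule qpoch_inf_nonzero[OF q(2)])
    show "- (q * q powi n) * q ^ k \<noteq> 1" for k
      using theta_goodD(2)[OF good q(1), of "1 + n + int k"] q by (simp add: power_int_add mult_ac)
  qed
  have x: "1 + q powi n \<noteq> 0"
    using theta_goodD(2)[OF good q(1), of n] by (auto simp: add_eq_0_iff)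
  have "qpoch_inf (- 1) q = 2 * qpoch_inf (- q) q"
    using qpoch_inf_rec[OF q(2), of "- 1"] by simp
  moreover have "qpoch_inf (- (q powi n)) q = (1 + q powi n) * qpoch_inf (- (q * q powi n)) q"
    using qpoch_inf_rec[OF q(2), of "- (q powi n)"] by (simp add: mult.commute)
  ultimately show ?thesis
    using nz nz' x by (simp add: qpoch_def)
qed

text \<open>With x = q^n the two Pochhammer quotients give 4 / (1 + x)^2, and x^(v + 1) / ((1 -
  x)^(2 v) (1 + x)^2) equals X^(v + 1) / (1 + 4 X); the factor (1 - x)^2 of 1 + 4 X accounts for the
  power v + 1 in place of v.\<close>

lemma N_even_eq_lambert_gen:
  assumes z: "Im z > 0"
  shows "N_even v 1 1 (e2pi z) = 4 * (eta_quot z * lambert_gen (Suc v) (e2pi z) (- 4))"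
proof -
  define q where "q = e2pi z"
  have q: "q \<noteq> 0" "norm q < 1"
    using norm_e2pi_less_1[OF z] by (simp_all add: q_def)
  have good: "theta_good q (- 1)"
    using theta_good_e2pi[OF half_not_in_lattice[OF z]] by (simp add: q_def e2pi_half)
  have "(\<Sum>\<^sub>\<infinity>n\<in>UNIV - {0 :: int}.
        (-1) powi (n - 1) * q powi (n * (n + 1) div 2 + int v * n) * (1 * 1) powi n *
          (qpoch (- 1 / 1) q n * qpoch (- 1 / 1) q n) /
        ((1 - q powi n) ^ (2 * v) * (qpoch (- 1 * q) q n * qpoch (- 1 * q) q n))) =
      (\<Sum>\<^sub>\<infinity>n\<in>UNIV - {0 :: int}. 4 * (theta_coeff q n * lambert_var q n ^ Suc v / (1 - (- 4) * lambert_var q n)))"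
  proof (rule infsum_cong)
    fix n :: int assume n: "n \<in> UNIV - {0}"
    define x where "x = q powi n"
    have x: "x \<noteq> 0" "1 - x \<noteq> 0" "1 + x \<noteq> 0"
      using q n power_int_neq_1[of q n] theta_goodD(2)[OF good q(1), of n]
      by (auto simp: x_def add_eq_0_iff)
    have "n * (n + 1) div 2 = n * (n - 1) div 2 + n"
      using triangular_int_simps(1)[of n] by (simp add: mult.commute)
    hence pow: "q powi (n * (n + 1) div 2 + int v * n) = q powi (n * (n - 1) div 2) * x * x ^ v"
      using q by (simp add: x_def power_int_add power_int_mult mult.commute[of "int v"])
    have ratio: "qpoch (- 1) q n / qpoch (- q) q n = 2 / (1 + x)"
      unfolding x_def by (rule qpoch_minus_1_ratio[OF q good])
    have "1 - (- 4) * (x / (1 - x) ^ 2) = ((1 - x) ^ 2 + 4 * x) / (1 - x) ^ 2"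
      using x by (simp add: field_simps)
    also have "(1 - x) ^ 2 + 4 * x = (1 + x) ^ 2"
      by (simp add: power2_eq_square algebra_simps)
    finally have den: "1 - (- 4) * lambert_var q n = (1 + x) ^ 2 / (1 - x) ^ 2"
      by (simp add: lambert_var_def x_def)
    have "(-1) powi (n - 1) * q powi (n * (n + 1) div 2 + int v * n) * (1 * 1) powi n *
          (qpoch (- 1 / 1) q n * qpoch (- 1 / 1) q n) /
        ((1 - q powi n) ^ (2 * v) * (qpoch (- 1 * q) q n * qpoch (- 1 * q) q n)) =
        theta_coeff q n * x * x ^ v / (1 - x) ^ (2 * v) * (qpoch (- 1) q n / qpoch (- q) q n) ^ 2"
      unfolding pow theta_coeff_def by (simp add: x_def power2_eq_square mult_ac)
    also have "\<dots> = theta_coeff q n * x * x ^ v / (1 - x) ^ (2 * v) * (2 / (1 + x)) ^ 2"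
      unfolding ratio ..
    also have "\<dots> = 4 * (theta_coeff q n * (x / (1 - x) ^ 2) ^ Suc v / ((1 + x) ^ 2 / (1 - x) ^ 2))"
    proof -
      have "((1 - x) ^ 2) ^ Suc v = (1 - x) ^ (2 * v) * (1 - x) ^ 2"
        by (simp only: power_mult power_Suc2)
      hence "(x / (1 - x) ^ 2) ^ Suc v = x * x ^ v / ((1 - x) ^ (2 * v) * (1 - x) ^ 2)"
        by (simp only: power_divide) simp
      thus ?thesis
        using x by (simp add: power_divide)
    qed
    also have "\<dots> = 4 * (theta_coeff q n * lambert_var q n ^ Suc v / (1 - (- 4) * lambert_var q n))"
      unfolding den by (simp add: lambert_var_def x_def)
    finally show "(-1) powi (n - 1) * q powi (n * (n + 1) div 2 + int v * n) * (1 * 1) powi n *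
          (qpoch (- 1 / 1) q n * qpoch (- 1 / 1) q n) /
        ((1 - q powi n) ^ (2 * v) * (qpoch (- 1 * q) q n * qpoch (- 1 * q) q n)) =
        4 * (theta_coeff q n * lambert_var q n ^ Suc v / (1 - (- 4) * lambert_var q n))" .
  qed
  also have "\<dots> = 4 * lambert_gen (Suc v) q (- 4)"
    unfolding lambert_gen_def by (rule infsum_cmult_right')
  finally show ?thesis
    unfolding N_even_def q_def[symmetric]
    by (simp add: eta_quot_def power2_eq_square q_def)
qed

theorem theorem1p1:
  fixes v :: nat
  assumes "v \<ge> 1"
  shows "quasimodular_form (\<lambda>z. N_even v 1 1 (exp (2 * of_real pi * \<i> * z)))"
proof (rule quasimodular_on_imp_quasimodular_form)
  show "finite_index_subgroup (principal_congruence_subgroup 8)"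
    by (rule finite_index_principal_congruence_subgroup) simp
  have "quasimodular_on (principal_congruence_subgroup 8)
      (\<lambda>z. 4 * (eta_quot z * lambert_gen (Suc v) (e2pi z) (- 4)))"
    by (intro quasimodular_on_cmult quasimodular_eta_quot_lambert_gen_minus_4)
  thus "quasimodular_on (principal_congruence_subgroup 8)
      (\<lambda>z. N_even v 1 1 (exp (2 * of_real pi * \<i> * z)))"
    by (rule quasimodular_on_cong) (simp only: N_even_eq_lambert_gen flip: e2pi_def)
qed

end
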